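(* Let $a>1$ be an integer and let $\mu$ be a finitely supported probability measure on $\mathbf{Z}$ with $\gcd(\operatorname{supp}\mu-\operatorname{supp}\mu)=1$. Let $H=H(a,\mu)$ be the asymptotic entropy. The following hold for every $\delta>0$. (i) If $Hn\leq(1-\delta)\log q$ then $\frac12\|\mu_n \bmod q-u_q\|=1-o(1)$ as $q\to\infty$. That is, for every $\eta>0$ there is $q_1$ such that for all integers $q\ge q_1$ and all integers $n\ge 0$ with $Hn\le(1-\delta)\log q$ we have $\frac12\|\mu_n\bmod q-u_q\|\ge 1-\eta$. (ii) Assume $H>\frac12\log a$. Then, as $n\to\infty$, for a proportion $1-o(1)$ of the primes $q$ such that $\log q\leq(1-\delta)Hn$ we have $\|\mu_n\bmod q-u_q\|=o(1)$. The same holds for a proportion $1-o(1)$ of the composite integers $q$ such that $\gcd(q,a)=1$ and $\log q\le(1-\delta)Hn$. That is, there is a sequence $\eta_n\to0$ such that for all large $n$, among the primes $q$ with $\log q\le(1-\delta)Hn$, a proportion at least $1-\eta_n$ satisfy $\|\mu_n\bmod q-u_q\|\le\eta_n$, and likewise among the composite $q$ with $\gcd(q,a)=1$ and $\log q\le(1-\delta)Hn$.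
   Context: The measures $\mu_n$ on $\mathbf{Z}$ are defined by $\mu_0=\delta_0$ and $\mu_n=\mu*(m_a)_*\mu_{n-1}$ for $n\ge1$, where $m_a(x)=ax$; equivalently $\mu_n$ is the law of $X_n$, where $X_0=0$ and $X_{n+1}=aX_n+b_n$ with $b_n$ i.i.d. of law $\mu$, i.e. $\mu_n$ is the law of $\sum_{i=0}^{n-1}b_ia^i$. The entropy of a finitely supported probability measure $\rho$ on $\mathbf Z$ is $H(\rho)=\sum_x\rho(\{x\})\log\rho(\{x\})^{-1}$ (natural logarithm), and the asymptotic entropy is $H(a,\mu)=\lim_{n\to\infty}\frac1nH(\mu_n)$. It is well known that the limit exists and $0<H(a,\mu)\le\min(\log a,H(\mu))$. $\mu_n\bmod q$ is the pushforward of $\mu_n$ to $\mathbf{Z}/q\mathbf{Z}$, $u_q$ is the uniform probability measure on $\mathbf{Z}/q\mathbf{Z}$, and $\|\cdot\|$ is the $l^1$ norm, $\|\rho\|=\sum_x|\rho(\{x\})|$ (so the maximal distance between two probability measures is $2$). *)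

theory Defs
  imports "HOL-Probability.Probability" "HOL-Computational_Algebra.Primes"
begin

definition conv_pmf :: "int pmf \<Rightarrow> int pmf \<Rightarrow> int pmf" where
  "conv_pmf \<rho> \<sigma> = map_pmf (\<lambda>(x, y). x + y) (pair_pmf \<rho> \<sigma>)"

primrec step_law :: "int \<Rightarrow> int pmf \<Rightarrow> nat \<Rightarrow> int pmf" where
  "step_law a \<mu> 0 = return_pmf 0"
| "step_law a \<mu> (Suc n) = conv_pmf \<mu> (map_pmf (\<lambda>x. a * x) (step_law a \<mu> n))"

text \<open>Intended for finitely supported measures only: on an infinite support the sum is 0 by
  convention.\<close>

definition entropy_fin :: "int pmf \<Rightarrow> real" where
  "entropy_fin \<rho> = (\<Sum>x\<in>set_pmf \<rho>. pmf \<rho> x * ln (1 / pmf \<rho> x))"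

definition asymp_entropy :: "int \<Rightarrow> int pmf \<Rightarrow> real" where
  "asymp_entropy a \<mu> = lim (\<lambda>n. entropy_fin (step_law a \<mu> n) / real n)"

text \<open>For \<open>q \<ge> 1\<close>, the group of integers modulo \<open>q\<close> is represented by the residues
  \<open>{0..<int q}\<close>.\<close>

definition mod_pmf :: "int pmf \<Rightarrow> nat \<Rightarrow> int pmf" where
  "mod_pmf \<rho> q = map_pmf (\<lambda>x. x mod int q) \<rho>"

definition unif_mod :: "nat \<Rightarrow> int pmf" where
  "unif_mod q = pmf_of_set {0..<int q}"

definition l1_norm_mod :: "nat \<Rightarrow> (int \<Rightarrow> real) \<Rightarrow> real" where
  "l1_norm_mod q f = (\<Sum>x\<in>{0..<int q}. \<bar>f x\<bar>)"

text \<open>The \<open>l\<^sup>1\<close> distance between \<open>\<mu>\<^sub>n mod q\<close> and the uniform measure, with maximal value 2 (not the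
  total variation distance, which is half of it).\<close>

definition unif_dist :: "int \<Rightarrow> int pmf \<Rightarrow> nat \<Rightarrow> nat \<Rightarrow> real" where
  "unif_dist a \<mu> n q =
     l1_norm_mod q (\<lambda>x. pmf (mod_pmf (step_law a \<mu> n) q) x - pmf (unif_mod q) x)"

text \<open>At least a proportion \<open>1 - \<epsilon>\<close> of the finite set \<open>A\<close> satisfies \<open>P\<close>. The multiplied-out form
  makes this hold when \<open>A\<close> is empty and \<open>\<epsilon>\<close> is arbitrary.\<close>

definition proportion_ge :: "real \<Rightarrow> nat set \<Rightarrow> (nat \<Rightarrow> bool) \<Rightarrow> bool" where
  "proportion_ge \<epsilon> A P \<longleftrightarrow> real (card {q \<in> A. P q}) \<ge> (1 - \<epsilon>) * real (card A)"

definition composite :: "nat \<Rightarrow> bool" where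
  "composite q \<longleftrightarrow> q > 1 \<and> \<not> prime q"

end

theory Submission
  imports Defs "HOL-Library.Real_Mod"
begin

text \<open>
  Write \<open>X\<^sub>n\<close> for the walk, \<open>H\<close> for its asymptotic entropy and \<open>e(t) = exp(2\<pi>it)\<close>. Everything rests on
  the decomposition \<open>X\<^sub>m\<^sub>+\<^sub>n = X\<^sub>m + a\<^sup>m X'\<^sub>n\<close> with independent summands (\<open>law_add\<close>).

  \<^emph>\<open>Entropy.\<close> For a finitely supported distribution \<open>p\<close> consider the power sum \<open>\<Sum>\<^sub>x p(x)\<^sup>1\<^sup>+\<^sup>s\<close>. Its
  derivative at \<open>s = 0\<close> is minus the entropy. Under the decomposition above it is submultiplicative for
  \<open>s < 0\<close>; for \<open>s > 0\<close> it is so up to a constant, because the map \<open>(x, y) \<mapsto> x + a\<^sup>m y\<close> has fibres of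
  bounded size. For small \<open>s\<close> of either sign this bounds the power sum of the law of \<open>X\<^sub>n\<close>
  by \<open>C exp(-sHn + \<epsilon>|s|n)\<close>. So, outside a set of exponentially small mass, every atom of the law of
  \<open>X\<^sub>n\<close> has mass \<open>exp(-(H + o(1))n)\<close>.

  \<^emph>\<open>Few steps.\<close> If \<open>Hn \<le> (1 - \<delta>) log q\<close> then almost all of the mass of \<open>X\<^sub>n\<close> sits on at most
  \<open>q\<^sup>1\<^sup>-\<^sup>\<delta>\<^sup>/\<^sup>2\<close> atoms, which cover a negligible proportion of the residues modulo \<open>q\<close>. Here one needs
  \<open>H > 0\<close>, which holds because the step distribution is not carried by one residue class modulo \<open>a\<close>.

  \<^emph>\<open>Many steps.\<close> The Fourier expansion of \<open>X\<^sub>n mod q\<close> runs over the fractions \<open>b/q\<close>. Sorting them by their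
  reduced denominator \<open>d\<close> bounds the distance to uniform by a sum over the divisors \<open>d > 1\<close> of \<open>q\<close> of
  \<open>l\<^sup>1\<close> norms of primitive parts (\<open>prim_norm\<close>), each depending on \<open>q\<close> only through
  \<open>d\<close>. Such a norm does not increase with \<open>n\<close>. By the Cauchy--Schwarz inequality it is at most the square root of
  \<open>S\<^sub>d = \<Sum>\<^sub>b |\<phi>(b/d)|\<^sup>2\<close>, where \<open>\<phi>\<close> is the Fourier transform and \<open>b\<close> runs over the reduced residues; it
  is also at most \<open>2\<^sup>\<omega>\<^sup>(\<^sup>d\<^sup>)\<close> times the total mass. Given \<open>D\<close>, choose \<open>m\<close> with
  \<open>D \<approx> exp((1 - \<theta>)Hm)\<close> and split the law of \<open>X\<^sub>m\<close> into its atoms of mass at most \<open>exp(-(H - \<epsilon>)m)\<close> and the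
  rest. The rest has exponentially small mass, so the second bound handles it. For the first part the large
  sieve gives \<open>\<Sum>\<^sub>d\<^sub>\<le>\<^sub>D S\<^sub>d \<lless> (a\<^sup>m + D\<^sup>2) exp(-(H - \<epsilon>)m)\<close>. Both terms are at most \<open>D\<^sup>1\<^sup>-\<^sup>c\<close>: the term
  with \<open>D\<^sup>2\<close> because \<open>D < exp(Hm)\<close> with room to spare, and the term with \<open>a\<^sup>m\<close> exactly because
  \<open>H > (log a)/2\<close>. The outcome is \<open>sum_law_prim_norm_le\<close>: the primitive norms at time \<open>n\<close> sum over
  \<open>d \<le> D\<close> to \<open>O(D\<^sup>1\<^sup>-\<^sup>c)\<close> whenever \<open>D \<le> exp((1 - \<delta>)Hn)\<close>.

  For prime moduli this already beats the number of primes up to \<open>D\<close>, which is at least of order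
  \<open>D / log D\<close>. For composite moduli up to \<open>N\<close>, exchanging sums leaves \<open>N \<Sum>\<^sub>d g(d)/d\<close>, where
  \<open>g(d)\<close> is the primitive norm; by partial summation the large \<open>d\<close> contribute little, and for each fixed
  \<open>d > 1\<close> coprime to \<open>a\<close> the norm tends to 0 since \<open>|\<phi>(c/d)| < 1\<close> for the one-step transform at every
  non-integral fraction \<open>c/d\<close>, by the gcd hypothesis. Markov's inequality turns averages into
  proportions.
\<close>

section \<open>Power sums of finitely supported distributions\<close>

text \<open>The moments underlying the Renyi entropies, parametrised so that \<open>s = 0\<close> gives the total mass and the
  derivative there is minus the Shannon entropy.\<close>

definition power_sum :: "real \<Rightarrow> 'a pmf \<Rightarrow> real" where
  "power_sum s p = (\<Sum>x\<in>set_pmf p. pmf p x powr (1 + s))"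

lemma pmf_map_sum:
  assumes "finite (set_pmf p)"
  shows "pmf (map_pmf f p) y = (\<Sum>x | x \<in> set_pmf p \<and> f x = y. pmf p x)"
proof -
  have "pmf (map_pmf f p) y = measure p (f -` {y} \<inter> set_pmf p)"
    by (simp add: pmf_map measure_Int_set_pmf)
  also have "f -` {y} \<inter> set_pmf p = {x. x \<in> set_pmf p \<and> f x = y}" by auto
  finally show ?thesis using assms by (simp add: measure_measure_pmf_finite)
qed

text \<open>Dividing by the total makes all terms at most 1, and then lowering the exponent below 1 only increases
  them.\<close>

lemma sum_powr_le:
  fixes t :: "'a \<Rightarrow> real"
  assumes "finite I" "\<And>i. i \<in> I \<Longrightarrow> t i > 0" "r \<le> 1"
  shows "(\<Sum>i\<in>I. t i) powr r \<le> (\<Sum>i\<in>I. t i powr r)"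
proof (cases "I = {}")
  case False
  define S where "S = (\<Sum>i\<in>I. t i)"
  have S: "S > 0" unfolding S_def using assms False by (intro sum_pos) auto
  have le: "t i \<le> S" if "i \<in> I" for i unfolding S_def using assms that by (intro member_le_sum) (auto intro: less_imp_le)
  have "t i / S \<le> t i powr r / S powr r" if i: "i \<in> I" for i
  proof -
    have "t i / S \<le> (t i / S) powr r"
      using powr_mono'[of r 1 "t i / S"] S le[OF i] assms(2)[OF i] assms(3) by simp
    thus ?thesis using S assms(2)[OF i] by (simp add: powr_divide)
  qed
  hence "(\<Sum>i\<in>I. t i / S) \<le> (\<Sum>i\<in>I. t i powr r / S powr r)" by (rule sum_mono)
  hence "1 \<le> (\<Sum>i\<in>I. t i powr r) / S powr r" using S
    by (simp flip: sum_divide_distrib S_def)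
  thus ?thesis using S by (simp add: S_def field_simps)
qed auto

text \<open>Convexity of \<open>t \<mapsto> t\<^sup>1\<^sup>+\<^sup>s\<close>. The constant is \<open>C\<^sup>s\<close> and not \<open>C\<^sup>1\<^sup>+\<^sup>s\<close>: it tends to 1 with \<open>s\<close>, so
  merging at most \<open>C\<close> atoms costs only a bounded amount of entropy.\<close>

lemma sum_powr_ge:
  fixes t :: "'a \<Rightarrow> real"
  assumes "finite I" "\<And>i. i \<in> I \<Longrightarrow> t i > 0" "s \<ge> 0" "real (card I) \<le> C"
  shows "(\<Sum>i\<in>I. t i) powr (1 + s) \<le> C powr s * (\<Sum>i\<in>I. t i powr (1 + s))"
proof (cases "I = {}")
  case False
  define n where "n = real (card I)"
  have n: "n > 0" using False assms(1) by (simp add: n_def card_gt_0_iff)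
  have "(\<Sum>i\<in>I. (1 / n) *\<^sub>R t i) powr (1 + s) \<le> (\<Sum>i\<in>I. 1 / n * (t i) powr (1 + s))"
    by (rule convex_on_sum[OF assms(1) False powr_convex[of "1 + s"], of "\<lambda>_. 1 / n" t])
       (use assms n in \<open>auto simp: n_def\<close>)
  hence "((\<Sum>i\<in>I. t i) / n) powr (1 + s) \<le> (\<Sum>i\<in>I. t i powr (1 + s)) / n"
    by (simp flip: sum_divide_distrib)
  hence "(\<Sum>i\<in>I. t i) powr (1 + s) \<le> n powr s * (\<Sum>i\<in>I. t i powr (1 + s))"
    using n assms(2) by (simp add: powr_divide sum_nonneg less_imp_le powr_add field_simps)
  also have "\<dots> \<le> C powr s * (\<Sum>i\<in>I. t i powr (1 + s))"
    using n assms by (intro mult_right_mono powr_mono2 sum_nonneg) (auto simp: n_def)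
  finally show ?thesis .
qed auto

lemma power_sum_pos: "finite (set_pmf p) \<Longrightarrow> power_sum s p > 0"
  unfolding power_sum_def by (intro sum_pos) (auto simp: set_pmf_not_empty set_pmf_iff)

lemma power_sum_0 [simp]: "finite (set_pmf p) \<Longrightarrow> power_sum 0 p = 1"
  unfolding power_sum_def by (simp add: pmf_positive sum_pmf_eq_1)

lemma power_sum_le_1:
  assumes "finite (set_pmf p)" "s \<ge> 0"
  shows "power_sum s p \<le> 1"
proof -
  have "power_sum s p \<le> (\<Sum>x\<in>set_pmf p. pmf p x)"
    unfolding power_sum_def
  proof (intro sum_mono)
    fix x assume "x \<in> set_pmf p"
    thus "pmf p x powr (1 + s) \<le> pmf p x"
      using powr_mono'[of 1 "1 + s" "pmf p x"] assms by (simp add: pmf_positive pmf_le_1)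
  qed
  thus ?thesis using assms by (simp add: sum_pmf_eq_1)
qed

text \<open>For exponents below 1, merging atoms decreases the power sum. At \<open>s = 0\<close> both sides are 1, so this contains
  the fact that a pushforward cannot increase entropy.\<close>

lemma power_sum_map_le:
  assumes fin: "finite (set_pmf p)" and "s \<ge> 0"
  shows "power_sum (- s) (map_pmf f p) \<le> power_sum (- s) p"
proof -
  have "power_sum (- s) (map_pmf f p)
      = (\<Sum>y\<in>f ` set_pmf p. (\<Sum>x | x \<in> set_pmf p \<and> f x = y. pmf p x) powr (1 - s))"
    unfolding power_sum_def by (simp add: pmf_map_sum[OF fin])
  also have "\<dots> \<le> (\<Sum>y\<in>f ` set_pmf p. \<Sum>x | x \<in> set_pmf p \<and> f x = y. pmf p x powr (1 - s))"
    using assms by (intro sum_mono sum_powr_le) (auto simp: pmf_positive)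
  also have "\<dots> = power_sum (- s) p"
    unfolding power_sum_def using fin by (subst sum.group) auto
  finally show ?thesis .
qed

text \<open>The counterpart for exponents above 1: a map with small fibres loses little entropy.\<close>

lemma power_sum_le_map:
  assumes fin: "finite (set_pmf p)" and "s \<ge> 0"
    and C: "\<And>y. real (card {x \<in> set_pmf p. f x = y}) \<le> C"
  shows "power_sum s (map_pmf f p) \<le> C powr s * power_sum s p"
proof -
  have "power_sum s (map_pmf f p)
      = (\<Sum>y\<in>f ` set_pmf p. (\<Sum>x | x \<in> set_pmf p \<and> f x = y. pmf p x) powr (1 + s))"
    unfolding power_sum_def by (simp add: pmf_map_sum[OF fin])
  also have "\<dots> \<le> (\<Sum>y\<in>f ` set_pmf p. C powr s * (\<Sum>x | x \<in> set_pmf p \<and> f x = y. pmf p x powr (1 + s)))"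
    using assms by (intro sum_mono sum_powr_ge) (auto simp: pmf_positive)
  also have "\<dots> = C powr s * power_sum s p"
    unfolding power_sum_def using fin by (subst sum_distrib_left[symmetric], subst sum.group) auto
  finally show ?thesis .
qed

lemma power_sum_pair:
  "power_sum s (pair_pmf p q) = power_sum s p * power_sum s q"
  unfolding power_sum_def
  by (auto simp: sum_product sum.cartesian_product pmf_pair powr_mult intro!: sum.cong)

lemma power_sum_deriv:
  assumes "finite (set_pmf p)"
  shows "((\<lambda>s. power_sum s p) has_real_derivative (\<Sum>x\<in>set_pmf p. pmf p x * ln (pmf p x))) (at 0)"
  unfolding power_sum_def
  by (rule derivative_eq_intros refl | simp add: pmf_positive mult.commute)+

lemma entropy_fin_eq: "entropy_fin p = - (\<Sum>x\<in>set_pmf p. pmf p x * ln (pmf p x))"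
  unfolding entropy_fin_def sum_negf[symmetric]
  by (intro sum.cong) (auto simp: ln_div pmf_positive)

lemma power_sum_deriv_0:
  assumes "finite (set_pmf p)"
  shows "((\<lambda>s. power_sum s p) has_real_derivative - entropy_fin p) (at 0)"
  using power_sum_deriv[OF assms] by (simp add: entropy_fin_eq)

lemma power_sum_neg_deriv_0:
  assumes "finite (set_pmf p)"
  shows "((\<lambda>s. power_sum (- s) p) has_real_derivative entropy_fin p) (at 0)"
proof -
  have "((\<lambda>s. power_sum (- s) p) has_real_derivative (- entropy_fin p) * (- 1)) (at 0)"
    by (rule DERIV_chain2[of "\<lambda>s. power_sum s p"])
       (use power_sum_deriv_0[OF assms] in \<open>auto intro!: derivative_eq_intros\<close>)
  thus ?thesis by simp
qed

text \<open>Chernoff's bound: if \<open>X\<close> has distribution \<open>p\<close>, the power sum is the expectation of \<open>p(X)\<^sup>s\<close>.\<close>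

lemma mass_large_atoms_le:
  assumes fin: "finite (set_pmf p)" and "s \<ge> 0" "\<kappa> > 0"
  shows "(\<Sum>x | x \<in> set_pmf p \<and> pmf p x > \<kappa>. pmf p x) \<le> \<kappa> powr (- s) * power_sum s p"
proof -
  have "(\<Sum>x | x \<in> set_pmf p \<and> pmf p x > \<kappa>. pmf p x)
     \<le> (\<Sum>x | x \<in> set_pmf p \<and> pmf p x > \<kappa>. \<kappa> powr (- s) * pmf p x powr (1 + s))"
  proof (intro sum_mono)
    fix x assume x: "x \<in> {x \<in> set_pmf p. pmf p x > \<kappa>}"
    have "1 \<le> (pmf p x / \<kappa>) powr s" using x assms by (intro ge_one_powr_ge_zero) auto
    hence "pmf p x * 1 \<le> pmf p x * (pmf p x / \<kappa>) powr s" by (intro mult_left_mono) auto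
    thus "pmf p x \<le> \<kappa> powr (- s) * pmf p x powr (1 + s)"
      using x assms by (simp add: powr_divide powr_add powr_minus divide_simps)
  qed
  also have "\<dots> \<le> (\<Sum>x\<in>set_pmf p. \<kappa> powr (- s) * pmf p x powr (1 + s))"
    using fin by (intro sum_mono2) auto
  finally show ?thesis by (simp add: power_sum_def sum_distrib_left)
qed

lemma mass_small_atoms_le:
  assumes fin: "finite (set_pmf p)" and "s \<ge> 0" "\<kappa> > 0"
  shows "(\<Sum>x | x \<in> set_pmf p \<and> pmf p x < \<kappa>. pmf p x) \<le> \<kappa> powr s * power_sum (- s) p"
proof -
  have "(\<Sum>x | x \<in> set_pmf p \<and> pmf p x < \<kappa>. pmf p x)
     \<le> (\<Sum>x | x \<in> set_pmf p \<and> pmf p x < \<kappa>. \<kappa> powr s * pmf p x powr (1 - s))"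
  proof (intro sum_mono)
    fix x assume x: "x \<in> {x \<in> set_pmf p. pmf p x < \<kappa>}"
    hence pos: "pmf p x > 0" by (auto simp: pmf_positive)
    have "1 \<le> (\<kappa> / pmf p x) powr s" using x assms pos by (intro ge_one_powr_ge_zero) auto
    hence "pmf p x * 1 \<le> pmf p x * (\<kappa> / pmf p x) powr s" by (intro mult_left_mono) auto
    thus "pmf p x \<le> \<kappa> powr s * pmf p x powr (1 - s)"
      using pos assms by (simp add: powr_divide powr_diff field_simps)
  qed
  also have "\<dots> \<le> (\<Sum>x\<in>set_pmf p. \<kappa> powr s * pmf p x powr (1 - s))"
    using fin by (intro sum_mono2) auto
  finally show ?thesis by (simp add: power_sum_def sum_distrib_left)
qed

section \<open>The random walk and its asymptotic entropy\<close>

text \<open>Fekete's subadditivity argument. The limit is also a lower bound for all quotients, which later gives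
  \<open>Hn \<le> H(\<mu>\<^sub>n)\<close> without any error term.\<close>

lemma fekete:
  fixes u :: "nat \<Rightarrow> real"
  assumes sub: "\<And>m n. u (m + n) \<le> u m + u n" and nonneg: "\<And>n. u n \<ge> 0"
  obtains L where "(\<lambda>n. u n / real n) \<longlonglongrightarrow> L" "\<And>n. n \<ge> 1 \<Longrightarrow> L * real n \<le> u n"
proof -
  define A where "A = (\<lambda>n. u n / real n) ` {1..}"
  define L where "L = Inf A"
  have bdd: "bdd_below A" unfolding A_def by (rule bdd_belowI[of _ 0]) (auto simp: nonneg)
  have L_le: "L \<le> u n / real n" if "n \<ge> 1" for n
    unfolding L_def using that bdd by (intro cInf_lower) (auto simp: A_def)
  have mult: "u (k * m + r) \<le> real k * u m + u r" for k m r
  proof (induction k)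
    case (Suc k)
    have "u (Suc k * m + r) \<le> u m + u (k * m + r)" using sub[of m "k * m + r"] by (simp add: add.assoc)
    thus ?case using Suc by (simp add: algebra_simps)
  qed simp
  have "(\<lambda>n. u n / real n) \<longlonglongrightarrow> L"
  proof (rule order_tendstoI)
    fix y assume "y < L"
    show "eventually (\<lambda>n. y < u n / real n) sequentially"
      using eventually_ge_at_top[of "1::nat"] by eventually_elim (use L_le \<open>y < L\<close> in force)
  next
    fix y assume "L < y"
    then obtain m where m: "m \<ge> 1" "u m / real m < y"
      unfolding L_def using cInf_lessD[of A y] by (auto simp: A_def)
    define M where "M = (\<Sum>r<m. u r)"
    have "((\<lambda>n. u m / real m + M / real n) \<longlongrightarrow> u m / real m + 0) sequentially"
      by (intro tendsto_intros lim_const_over_n)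
    hence "eventually (\<lambda>n. u m / real m + M / real n < y) sequentially"
      using m by (intro order_tendstoD) auto
    thus "eventually (\<lambda>n. u n / real n < y) sequentially"
      using eventually_ge_at_top[of "1::nat"]
    proof eventually_elim
      case (elim n)
      have "u n \<le> real (n div m) * u m + u (n mod m)" using mult[of "n div m" m "n mod m"] by simp
      also have "u (n mod m) \<le> M" unfolding M_def
        using m nonneg by (intro member_le_sum) auto
      also have "real (n div m) * u m \<le> real n / real m * u m"
        using nonneg by (intro mult_right_mono of_nat_div_le_of_nat) auto
      finally have "u n \<le> real n * (u m / real m) + M" by simp
      hence "u n / real n \<le> (real n * (u m / real m) + M) / real n"
        by (intro divide_right_mono) auto
      also have "\<dots> = u m / real m + M / real n" using elim by (simp add: field_simps)
      finally show ?case using elim by simp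
    qed
  qed
  moreover have "L * real n \<le> u n" if "n \<ge> 1" for n
    using L_le[OF that] that by (simp add: field_simps)
  ultimately show ?thesis using that by blast
qed

lemma entropy_nonneg: "finite (set_pmf p) \<Longrightarrow> entropy_fin p \<ge> 0"
  unfolding entropy_fin_def by (intro sum_nonneg mult_nonneg_nonneg ln_ge_zero) (auto simp: pmf_positive pmf_le_1)

locale affine_walk =
  fixes a :: int and \<mu> :: "int pmf"
  assumes a_gt_1: "a > 1"
    and finite_supp: "finite (set_pmf \<mu>)"
    and Gcd_diff: "Gcd {x - y | x y. x \<in> set_pmf \<mu> \<and> y \<in> set_pmf \<mu>} = 1"
begin

abbreviation law :: "nat \<Rightarrow> int pmf" where "law n \<equiv> step_law a \<mu> n"
abbreviation H :: real where "H \<equiv> asymp_entropy a \<mu>"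

lemma finite_law [simp]: "finite (set_pmf (law n))"
  by (induction n) (auto simp: conv_pmf_def finite_supp)

text \<open>The first \<open>m\<close> digits and the next \<open>n\<close> digits are independent, the latter shifted by \<open>a\<^sup>m\<close>.\<close>

lemma law_add: "law (m + n) = map_pmf (\<lambda>(x, y). x + a ^ m * y) (pair_pmf (law m) (law n))"
proof (induction m)
  case 0
  show ?case by (simp add: map_pmf_def pair_pmf_def bind_assoc_pmf bind_return_pmf bind_return_pmf')
next
  case (Suc m)
  show ?case
    by (simp add: Suc conv_pmf_def map_pmf_def pair_pmf_def bind_assoc_pmf bind_return_pmf algebra_simps)
qed

lemma law_1: "law (Suc 0) = \<mu>"
  by (simp add: conv_pmf_def map_pmf_def pair_pmf_def bind_assoc_pmf bind_return_pmf bind_return_pmf')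

definition step_bound :: int where "step_bound = Max (abs ` set_pmf \<mu>)"

lemma abs_step_le: "x \<in> set_pmf \<mu> \<Longrightarrow> \<bar>x\<bar> \<le> step_bound"
  unfolding step_bound_def using finite_supp by (intro Max_ge) auto

lemma step_bound_nonneg: "step_bound \<ge> 0"
  using set_pmf_not_empty[of \<mu>] abs_step_le by fastforce

lemma abs_law_le_geometric: "x \<in> set_pmf (law n) \<Longrightarrow> \<bar>x\<bar> \<le> step_bound * (a ^ n - 1)"
proof (induction n arbitrary: x)
  case (Suc n)
  then obtain b y where b: "b \<in> set_pmf \<mu>" "y \<in> set_pmf (law n)" "x = b + a * y"
    by (auto simp: conv_pmf_def)
  have "\<bar>x\<bar> \<le> \<bar>b\<bar> + a * \<bar>y\<bar>" using b a_gt_1 abs_triangle_ineq[of b "a * y"] by (simp add: abs_mult)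
  also have "\<dots> \<le> step_bound + a * (step_bound * (a ^ n - 1))"
    using b Suc.IH[of y] abs_step_le a_gt_1 by (intro add_mono mult_left_mono) auto
  also have "\<dots> = step_bound * (a ^ Suc n - 1) - step_bound * (a - 2)" by (simp add: algebra_simps)
  also have "\<dots> \<le> step_bound * (a ^ Suc n - 1)" using step_bound_nonneg a_gt_1 by simp
  finally show ?case .
qed simp

lemma abs_law_le: "x \<in> set_pmf (law n) \<Longrightarrow> \<bar>x\<bar> \<le> step_bound * a ^ n"
  using abs_law_le_geometric[of x n] step_bound_nonneg by (simp add: algebra_simps)

definition fibre_bound :: real where "fibre_bound = 2 * of_int step_bound + 3"

lemma fibre_bound_ge_1: "fibre_bound \<ge> 1" unfolding fibre_bound_def using step_bound_nonneg by simp

text \<open>Since \<open>|x| \<le> B a\<^sup>m\<close>, where \<open>B\<close> is the largest step, a value of \<open>x + a\<^sup>m y\<close> determines the integer \<open>y\<close> up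
  to \<open>2B + 3\<close> possibilities, whatever \<open>m\<close> and \<open>n\<close> are.\<close>

lemma card_fibre_le:
  "real (card {w \<in> set_pmf (pair_pmf (law m) (law n)). (case w of (x, y) \<Rightarrow> x + a ^ m * y) = z}) \<le> fibre_bound"
proof -
  let ?S = "{w \<in> set_pmf (pair_pmf (law m) (law n)). (case w of (x, y) \<Rightarrow> x + a ^ m * y) = z}"
  define u where "u = z div a ^ m"
  have am: "a ^ m > 0" using a_gt_1 by simp
  have inj: "inj_on snd ?S" by (auto simp: inj_on_def)
  have "snd ` ?S \<subseteq> {u - (step_bound + 1)..u + (step_bound + 1)}"
  proof
    fix y assume "y \<in> snd ` ?S"
    then obtain x where x: "x \<in> set_pmf (law m)" and z: "x + a ^ m * y = z" by auto
    have z': "z = a ^ m * u + z mod a ^ m" by (simp add: u_def)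
    have "0 \<le> z mod a ^ m" "z mod a ^ m < a ^ m" using am by auto
    hence "\<bar>a ^ m * (y - u)\<bar> \<le> a ^ m * (step_bound + 1)"
      using abs_law_le[OF x] z z' by (simp add: algebra_simps) 
    hence "\<bar>y - u\<bar> \<le> step_bound + 1" using am by (simp add: abs_mult)
    thus "y \<in> {u - (step_bound + 1)..u + (step_bound + 1)}" by auto
  qed
  hence "card (snd ` ?S) \<le> card {u - (step_bound + 1)..u + (step_bound + 1)}" by (intro card_mono) auto
  also have "card (snd ` ?S) = card ?S" by (rule card_image[OF inj])
  finally have "int (card ?S) \<le> 2 * step_bound + 3" using step_bound_nonneg by simp
  hence "real_of_int (int (card ?S)) \<le> real_of_int (2 * step_bound + 3)" by (simp only: of_int_le_iff)
  thus ?thesis by (simp add: fibre_bound_def)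
qed

lemma power_sum_neg_law_add_le:
  assumes "s \<ge> 0"
  shows "power_sum (- s) (law (m + n)) \<le> power_sum (- s) (law m) * power_sum (- s) (law n)"
  unfolding law_add power_sum_pair[symmetric] using assms by (intro power_sum_map_le) auto

lemma power_sum_law_add_le:
  assumes "s \<ge> 0"
  shows "power_sum s (law (m + n)) \<le> fibre_bound powr s * (power_sum s (law m) * power_sum s (law n))"
  unfolding law_add power_sum_pair[symmetric] using assms card_fibre_le
  by (intro power_sum_le_map) auto

text \<open>Both sides of \<open>power_sum_neg_law_add_le\<close> equal 1 at \<open>s = 0\<close>, so the inequality passes to the right derivatives
  there, which are the entropies.\<close>

lemma entropy_law_add_le: "entropy_fin (law (m + n)) \<le> entropy_fin (law m) + entropy_fin (law n)"
proof (rule ccontr)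
  assume neg: "\<not> ?thesis"
  define f where "f = (\<lambda>s. power_sum (- s) (law m) * power_sum (- s) (law n) - power_sum (- s) (law (m + n)))"
  have "(f has_real_derivative (entropy_fin (law m) + entropy_fin (law n) - entropy_fin (law (m + n)))) (at 0)"
    unfolding f_def by (auto intro!: derivative_eq_intros power_sum_neg_deriv_0)
  then obtain d where d: "d > 0" "\<And>h. 0 < h \<Longrightarrow> h < d \<Longrightarrow> f h < f 0"
    using DERIV_neg_dec_right[of f _ 0] neg by force
  have "f (d / 2) < f 0" using d(1) by (intro d(2)) auto
  moreover have "f (d / 2) \<ge> 0" unfolding f_def using d(1) power_sum_neg_law_add_le[of "d / 2"] by simp
  moreover have "f 0 = 0" by (simp add: f_def)
  ultimately show False by simp
qed

lemma
  shows asymp_entropy_tendsto: "(\<lambda>n. entropy_fin (law n) / real n) \<longlonglongrightarrow> H"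
    and asymp_entropy_le: "n \<ge> 1 \<Longrightarrow> H * real n \<le> entropy_fin (law n)"
proof -
  obtain L where L: "(\<lambda>n. entropy_fin (law n) / real n) \<longlonglongrightarrow> L" "\<And>n. n \<ge> 1 \<Longrightarrow> L * real n \<le> entropy_fin (law n)"
    using fekete[of "\<lambda>n. entropy_fin (law n)"] entropy_law_add_le entropy_nonneg by (metis finite_law)
  have "H = L" unfolding asymp_entropy_def using L(1) by (rule limI)
  thus "(\<lambda>n. entropy_fin (law n) / real n) \<longlonglongrightarrow> H" "n \<ge> 1 \<Longrightarrow> H * real n \<le> entropy_fin (law n)" using L by auto
qed

lemma not_all_congruent:
  assumes "d > 1"
  shows "\<exists>x\<in>set_pmf \<mu>. \<exists>y\<in>set_pmf \<mu>. \<not> d dvd x - y"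
proof (rule ccontr)
  assume "\<not> ?thesis"
  hence "d dvd Gcd {x - y | x y. x \<in> set_pmf \<mu> \<and> y \<in> set_pmf \<mu>}"
    by (intro Gcd_greatest) auto
  thus False using assms by (simp add: Gcd_diff)
qed

lemma residue_mass_le:
  obtains \<kappa> :: real where "0 < \<kappa>" "\<kappa> < 1"
    "\<And>c. (\<Sum>x | x \<in> set_pmf \<mu> \<and> x mod a = c. pmf \<mu> x) \<le> \<kappa>"
proof -
  define m where "m = Min (pmf \<mu> ` set_pmf \<mu>)"
  have ne: "pmf \<mu> ` set_pmf \<mu> \<noteq> {}" by (simp add: set_pmf_not_empty)
  have m_pos: "m > 0" unfolding m_def using finite_supp ne by (auto simp: pmf_positive)
  have m_le: "m \<le> pmf \<mu> x" if "x \<in> set_pmf \<mu>" for x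
    unfolding m_def using finite_supp that by (intro Min_le) auto
  show thesis
  proof (rule that[of "max (1 - m) (1 / 2)"])
    fix c
    obtain x where x: "x \<in> set_pmf \<mu>" "x mod a \<noteq> c"
      using not_all_congruent[OF a_gt_1] by (metis mod_eq_dvd_iff)
    have "(\<Sum>x | x \<in> set_pmf \<mu> \<and> x mod a = c. pmf \<mu> x) \<le> (\<Sum>y\<in>set_pmf \<mu> - {x}. pmf \<mu> y)"
      using finite_supp x by (intro sum_mono2) auto
    also have "\<dots> = 1 - pmf \<mu> x" using finite_supp x by (simp add: sum_diff1 sum_pmf_eq_1)
    finally show "(\<Sum>x | x \<in> set_pmf \<mu> \<and> x mod a = c. pmf \<mu> x) \<le> max (1 - m) (1 / 2)"
      using m_le[OF x(1)] by linarith
  qed (use m_pos in auto)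
qed

text \<open>The lowest digit is determined modulo \<open>a\<close> by the position, and no residue class carries all of the step
  distribution. Hence the largest atom of the law shrinks by a factor \<open>\<kappa> < 1\<close> at each step, and the entropy
  is at least minus the logarithm of the largest atom.\<close>

lemma H_pos: "H > 0"
proof -
  obtain \<kappa> where \<kappa>: "0 < \<kappa>" "\<kappa> < 1"
    "\<And>c. (\<Sum>x | x \<in> set_pmf \<mu> \<and> x mod a = c. pmf \<mu> x) \<le> \<kappa>" using residue_mass_le by blast
  have atom: "pmf (law n) z \<le> \<kappa> ^ n" for n z
  proof (induction n arbitrary: z)
    case 0
    show ?case by (simp add: pmf_le_1)
  next
    case (Suc n)
    let ?S = "{w \<in> set_pmf (pair_pmf \<mu> (law n)). (case w of (x, y) \<Rightarrow> x + a * y) = z}"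
    have law: "law (Suc n) = map_pmf (\<lambda>(x, y). x + a * y) (pair_pmf \<mu> (law n))"
      using law_add[of "Suc 0" n] by (simp add: law_1 del: step_law.simps)
    have fin: "finite ?S" using finite_supp by auto
    have inj: "inj_on fst ?S" using a_gt_1 by (auto simp: inj_on_def)
    have "pmf (law (Suc n)) z = (\<Sum>w\<in>?S. pmf (pair_pmf \<mu> (law n)) w)"
      unfolding law using finite_supp by (subst pmf_map_sum) auto
    also have "\<dots> \<le> (\<Sum>w\<in>?S. pmf \<mu> (fst w) * \<kappa> ^ n)"
      using Suc.IH by (intro sum_mono) (auto simp: pmf_pair intro!: mult_left_mono)
    also have "\<dots> = (\<Sum>x\<in>fst ` ?S. pmf \<mu> x) * \<kappa> ^ n"
      by (subst sum.reindex[OF inj]) (simp add: sum_distrib_right)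
    also have "(\<Sum>x\<in>fst ` ?S. pmf \<mu> x) \<le> (\<Sum>x | x \<in> set_pmf \<mu> \<and> x mod a = z mod a. pmf \<mu> x)"
      using finite_supp by (intro sum_mono2) auto
    also have "\<dots> \<le> \<kappa>" by (rule \<kappa>)
    finally show ?case using \<kappa> by (simp add: mult_right_mono del: step_law.simps)
  qed
  have "entropy_fin (law n) / real n \<ge> ln (1 / \<kappa>)" if "n \<ge> 1" for n
  proof -
    have "real n * ln (1 / \<kappa>) = (\<Sum>x\<in>set_pmf (law n). pmf (law n) x * ln (1 / \<kappa> ^ n))"
      using \<kappa> by (subst sum_distrib_right[symmetric]) (simp add: sum_pmf_eq_1 ln_div ln_realpow)
    also have "\<dots> \<le> entropy_fin (law n)"
      unfolding entropy_fin_def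
    proof (intro sum_mono mult_left_mono)
      fix x assume "x \<in> set_pmf (law n)"
      hence "pmf (law n) x > 0" by (rule pmf_positive)
      thus "ln (1 / \<kappa> ^ n) \<le> ln (1 / pmf (law n) x)" using \<kappa> atom[of n x] by (simp add: ln_div)
    qed auto
    finally show ?thesis using that by (simp add: field_simps)
  qed
  hence "ln (1 / \<kappa>) \<le> H"
    by (intro tendsto_lowerbound[OF asymp_entropy_tendsto] eventually_sequentiallyI[of 1]) auto
  moreover have "ln (1 / \<kappa>) > 0" using \<kappa> by (intro ln_gt_zero) auto
  ultimately show ?thesis by linarith
qed

end

section \<open>Too few steps: the law charges few residues\<close>

lemma pmf_unif_mod: "q > 0 \<Longrightarrow> y \<in> {0..<int q} \<Longrightarrow> pmf (unif_mod q) y = 1 / real q"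
  unfolding unif_mod_def by (subst pmf_of_set) auto

lemma sum_pmf_mod: "q > 0 \<Longrightarrow> (\<Sum>y\<in>{0..<int q}. pmf (mod_pmf p q) y) = 1"
  unfolding mod_pmf_def by (rule sum_pmf_eq_1) auto

text \<open>Test the two distributions on the set of residues of \<open>A\<close>.\<close>

lemma unif_dist_ge:
  assumes q: "q > 0" and A: "finite A"
  shows "unif_dist a \<mu> n q / 2 \<ge> (\<Sum>x\<in>A. pmf (step_law a \<mu> n) x) - real (card A) / real q"
proof -
  define p where "p = pmf (mod_pmf (step_law a \<mu> n) q)"
  define u where "u = pmf (unif_mod q)"
  define B where "B = (\<lambda>x. x mod int q) ` A"
  have B: "B \<subseteq> {0..<int q}" "finite B" using q A by (auto simp: B_def)
  have sum_p: "(\<Sum>y\<in>{0..<int q}. p y) = 1" unfolding p_def by (rule sum_pmf_mod[OF q])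
  have sum_u: "(\<Sum>y\<in>{0..<int q}. u y) = 1" using q by (simp add: u_def pmf_unif_mod)
  have diff: "(\<Sum>y\<in>{0..<int q} - B. f y) = 1 - (\<Sum>y\<in>B. f y)"
    if "(\<Sum>y\<in>{0..<int q}. f y) = 1" for f :: "int \<Rightarrow> real"
    using B that by (simp add: sum_diff)
  have "(\<Sum>x\<in>A. pmf (step_law a \<mu> n) x) = measure (step_law a \<mu> n) A"
    using A by (simp add: measure_measure_pmf_finite)
  also have "\<dots> \<le> measure (step_law a \<mu> n) ((\<lambda>x. x mod int q) -` B)"
    by (intro measure_pmf.finite_measure_mono) (auto simp: B_def)
  also have "\<dots> = (\<Sum>y\<in>B. p y)"
    using B by (simp add: p_def mod_pmf_def flip: measure_measure_pmf_finite measure_map_pmf)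
  finally have 1: "(\<Sum>x\<in>A. pmf (step_law a \<mu> n) x) \<le> (\<Sum>y\<in>B. p y)" .
  have "(\<Sum>y\<in>B. u y) = real (card B) / real q"
    using q B by (subst sum.cong[of B B u "\<lambda>_. 1 / real q"]) (auto simp: u_def pmf_unif_mod subset_iff)
  also have "\<dots> \<le> real (card A) / real q"
    using A by (intro divide_right_mono) (auto simp: B_def card_image_le)
  finally have 2: "(\<Sum>y\<in>B. u y) \<le> real (card A) / real q" .
  have "unif_dist a \<mu> n q = (\<Sum>y\<in>B. \<bar>p y - u y\<bar>) + (\<Sum>y\<in>{0..<int q} - B. \<bar>p y - u y\<bar>)"
    unfolding unif_dist_def l1_norm_mod_def p_def u_def
    using B by (simp add: sum.subset_diff[of B "{0..<int q}"] add.commute)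
  also have "\<dots> \<ge> (\<Sum>y\<in>B. p y - u y) + (\<Sum>y\<in>{0..<int q} - B. u y - p y)"
    by (intro add_mono sum_mono) auto
  also have "(\<Sum>y\<in>B. p y - u y) + (\<Sum>y\<in>{0..<int q} - B. u y - p y) = 2 * ((\<Sum>y\<in>B. p y) - (\<Sum>y\<in>B. u y))"
    by (simp add: sum_subtractf diff sum_p sum_u)
  finally show ?thesis using 1 2 by simp
qed

context affine_walk
begin

text \<open>Near \<open>s = 0\<close> the power sum at \<open>-s\<close> is \<open>1 + s H(\<mu>\<^sub>m) + o(s)\<close>. Choosing first \<open>m\<close> with
  \<open>H(\<mu>\<^sub>m) < (H + \<epsilon>) m\<close> and then \<open>s\<close> small makes it less than \<open>exp(s(H + \<epsilon>)m)\<close>; submultiplicativity extends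
  this to all multiples of \<open>m\<close>, and the remainder modulo \<open>m\<close> costs a constant.\<close>

lemma power_sum_neg_law_le:
  assumes "\<epsilon> > 0"
  obtains s C where "s > 0" "C > 0" "\<And>n. power_sum (- s) (law n) \<le> C * exp (s * (H + \<epsilon>) * real n)"
proof -
  have "eventually (\<lambda>n. entropy_fin (law n) / real n < H + \<epsilon>) sequentially"
    using assms by (intro order_tendstoD(2)[OF asymp_entropy_tendsto]) auto
  then obtain m where m: "m \<ge> 1" "entropy_fin (law m) / real m < H + \<epsilon>"
    by (metis (mono_tags, lifting) eventually_sequentially max.cobounded1 max.cobounded2)
  define f where "f = (\<lambda>s. exp (s * ((H + \<epsilon>) * real m)) - power_sum (- s) (law m))"
  have "(f has_real_derivative ((H + \<epsilon>) * real m - entropy_fin (law m))) (at 0)"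
    unfolding f_def by (auto intro!: derivative_eq_intros power_sum_neg_deriv_0)
  moreover have "(H + \<epsilon>) * real m - entropy_fin (law m) > 0" using m by (simp add: field_simps)
  ultimately obtain d where d: "d > 0" "\<And>h. 0 < h \<Longrightarrow> h < d \<Longrightarrow> f h > f 0"
    using DERIV_pos_inc_right[of f _ 0] by force
  define s where "s = d / 2"
  define E where "E = exp (s * ((H + \<epsilon>) * real m))"
  have s: "s > 0" "s < d" using d(1) by (auto simp: s_def)
  hence Em: "power_sum (- s) (law m) \<le> E" using d(2)[of s] by (simp add: f_def E_def)
  have mult: "power_sum (- s) (law (k * m + r)) \<le> E ^ k * power_sum (- s) (law r)" for k r
  proof (induction k)
    case (Suc k)
    have "power_sum (- s) (law (Suc k * m + r)) \<le> power_sum (- s) (law m) * power_sum (- s) (law (k * m + r))"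
      using power_sum_neg_law_add_le[of s m "k * m + r"] s by (simp add: add.assoc)
    also have "\<dots> \<le> E * (E ^ k * power_sum (- s) (law r))"
      using Suc Em by (intro mult_mono) (auto simp: E_def less_imp_le power_sum_pos)
    finally show ?case by (simp add: mult_ac)
  qed simp
  define C where "C = (\<Sum>r<m. power_sum (- s) (law r))"
  have C: "C > 0" unfolding C_def using m by (intro sum_pos) (auto simp: power_sum_pos lessThan_empty_iff)
  show ?thesis
  proof (rule that[OF s(1) C])
    fix n
    have "power_sum (- s) (law n) \<le> E ^ (n div m) * power_sum (- s) (law (n mod m))"
      using mult[of "n div m" "n mod m"] by simp
    also have "\<dots> \<le> E ^ (n div m) * C" unfolding C_def
      using m by (intro mult_left_mono member_le_sum) (auto simp: less_imp_le power_sum_pos E_def)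
    also have "E ^ (n div m) = exp (s * (H + \<epsilon>) * real (n div m * m))"
      unfolding E_def by (simp add: exp_of_nat_mult[symmetric] algebra_simps)
    also have "\<dots> \<le> exp (s * (H + \<epsilon>) * real n)"
      using s H_pos assms by (auto intro!: mult_left_mono simp flip: of_nat_mult)
    finally show "power_sum (- s) (law n) \<le> C * exp (s * (H + \<epsilon>) * real n)"
      using C by (simp add: mult.commute)
  qed
qed

text \<open>The same argument for positive exponents. Each block of length \<open>m\<close> now costs a factor \<open>fibre_bound\<^sup>s\<close>, which
  is absorbed by taking \<open>m\<close> so long that \<open>ln fibre_bound < \<epsilon> m\<close>.\<close>

lemma power_sum_law_le:
  assumes "\<epsilon> > 0" "\<epsilon> < H"
  obtains s C where "s > 0" "C > 0" "\<And>n. power_sum s (law n) \<le> C * exp (- s * (H - \<epsilon>) * real n)"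
proof -
  define m where "m = nat \<lceil>ln fibre_bound / \<epsilon>\<rceil> + 1"
  have "ln fibre_bound / \<epsilon> < real m" unfolding m_def by linarith
  hence "ln fibre_bound < \<epsilon> * real m" using assms by (simp add: field_simps)
  moreover have m: "m \<ge> 1" by (simp add: m_def)
  ultimately have neg: "ln fibre_bound - entropy_fin (law m) < - ((H - \<epsilon>) * real m)"
    using asymp_entropy_le[OF m] by (simp add: algebra_simps)
  have fibre_bound: "fibre_bound > 0" using fibre_bound_ge_1 by simp
  define f where "f = (\<lambda>s. exp (- s * ((H - \<epsilon>) * real m)) - exp (s * ln fibre_bound) * power_sum s (law m))"
  have "(f has_real_derivative (- ((H - \<epsilon>) * real m) - (ln fibre_bound - entropy_fin (law m)))) (at 0)"
    unfolding f_def by (auto intro!: derivative_eq_intros power_sum_deriv_0)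
  then obtain d where d: "d > 0" "\<And>h. 0 < h \<Longrightarrow> h < d \<Longrightarrow> f h > f 0"
    using DERIV_pos_inc_right[of f _ 0] neg by force
  define s where "s = d / 2"
  define E where "E = exp (- s * ((H - \<epsilon>) * real m))"
  have s: "s > 0" "s < d" using d(1) by (auto simp: s_def)
  have C0s: "exp (s * ln fibre_bound) = fibre_bound powr s" "fibre_bound powr s > 0" using fibre_bound by (auto simp: powr_def)
  hence Em: "fibre_bound powr s * power_sum s (law m) \<le> E" using d(2)[of s] s by (simp add: f_def E_def)
  have mult: "power_sum s (law (k * m + r)) \<le> E ^ k" for k r
  proof (induction k)
    case 0
    thus ?case using s by (simp add: power_sum_le_1)
  next
    case (Suc k)
    have "power_sum s (law (Suc k * m + r)) \<le> fibre_bound powr s * (power_sum s (law m) * power_sum s (law (k * m + r)))"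
      using power_sum_law_add_le[of s m "k * m + r"] s by (simp add: add.assoc)
    also have "\<dots> = (fibre_bound powr s * power_sum s (law m)) * power_sum s (law (k * m + r))" by simp
    also have "\<dots> \<le> E * E ^ k"
      using Suc Em by (intro mult_mono) (auto simp: E_def less_imp_le power_sum_pos)
    finally show ?case by simp
  qed
  show ?thesis
  proof (rule that[OF s(1)])
    fix n
    have "power_sum s (law n) \<le> E ^ (n div m)"
      using mult[of "n div m" "n mod m"] by simp
    also have "E ^ (n div m) = exp (- (s * (H - \<epsilon>) * real (n div m * m)))"
      unfolding E_def by (simp add: exp_of_nat_mult[symmetric] algebra_simps)
    also have "\<dots> \<le> exp (- (s * (H - \<epsilon>) * (real n - real m)))"
    proof -
      have "n mod m < m" using m by simp
      hence "n \<le> n div m * m + m" using div_mult_mod_eq[of n m] by linarith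
      hence "real n - real m \<le> real (n div m * m)" by linarith
      thus ?thesis using s assms by (auto intro!: mult_left_mono)
    qed
    also have "\<dots> = exp (s * (H - \<epsilon>) * real m) * exp (- s * (H - \<epsilon>) * real n)"
      by (simp add: exp_add[symmetric] algebra_simps)
    finally show "power_sum s (law n) \<le> exp (s * (H - \<epsilon>) * real m) * exp (- s * (H - \<epsilon>) * real n)" .
  qed auto
qed

text \<open>Atoms of mass at least \<open>\<kappa> = q\<^sup>-\<^sup>(\<^sup>1\<^sup>-\<^sup>\<theta>\<^sup>/\<^sup>2\<^sup>)\<close> number at most \<open>1/\<kappa>\<close>, which is negligible against \<open>q\<close>; the
  Chernoff bound shows that they carry almost all of the mass. The bounds depend on \<open>n\<close> only through
  \<open>Hn \<le> (1 - \<theta>) log q\<close>, so small and large \<open>n\<close> are treated alike.\<close>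

lemma few_steps_far_from_uniform:
  assumes "\<delta> > 0" "\<eta> > 0"
  shows "\<exists>q1::nat. \<forall>q\<ge>q1. \<forall>n::nat. H * real n \<le> (1 - \<delta>) * ln (real q) \<longrightarrow>
           1 / 2 * unif_dist a \<mu> n q \<ge> 1 - \<eta>"
proof -
  define \<theta> where "\<theta> = min \<delta> (1 / 2)"
  have \<theta>: "\<theta> > 0" "\<theta> \<le> 1 / 2" "\<theta> \<le> \<delta>" using assms by (auto simp: \<theta>_def)
  \<comment> \<open>With this choice \<open>(H + \<epsilon>)n \<le> (1 - 3\<theta>/4) log q\<close>, which stays below the threshold \<open>t = (1 - \<theta>/2) log q\<close>.\<close>
  define \<epsilon> where "\<epsilon> = H * \<theta> / 4"
  have \<epsilon>: "\<epsilon> > 0" using H_pos \<theta> by (simp add: \<epsilon>_def)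
  obtain s C where sC: "s > 0" "C > 0" "\<And>n. power_sum (- s) (law n) \<le> C * exp (s * (H + \<epsilon>) * real n)"
    using power_sum_neg_law_le[OF \<epsilon>] by blast
  have "((\<lambda>q. C * real q powr (- (s * \<theta> / 4)) + real q powr (- (\<theta> / 2))) \<longlongrightarrow> C * 0 + 0) sequentially"
    using sC \<theta> by (intro tendsto_intros tendsto_neg_powr filterlim_real_sequentially) auto
  hence "eventually (\<lambda>q. C * real q powr (- (s * \<theta> / 4)) + real q powr (- (\<theta> / 2)) < \<eta>) sequentially"
    using assms by (intro order_tendstoD) auto
  hence "eventually (\<lambda>q. \<forall>n::nat. H * real n \<le> (1 - \<delta>) * ln (real q) \<longrightarrow>
           1 / 2 * unif_dist a \<mu> n q \<ge> 1 - \<eta>) sequentially"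
    using eventually_gt_at_top[of "1::nat"]
  proof eventually_elim
    case (elim q)
    define L where "L = ln (real q)"
    have L: "L > 0" "exp L = real q" using elim by (auto simp: L_def)
    show ?case
    proof (intro allI impI)
      fix n assume n: "H * real n \<le> (1 - \<delta>) * ln (real q)"
      define t where "t = (1 - \<theta> / 2) * L"
      define \<kappa> where "\<kappa> = exp (- t)"
      have "H * real n \<le> (1 - \<theta>) * L"
        using n L \<theta> mult_right_mono[of "1 - \<delta>" "1 - \<theta>" L] by (fold L_def) linarith
      hence "(1 + \<theta> / 4) * (H * real n) \<le> (1 + \<theta> / 4) * ((1 - \<theta>) * L)"
        using \<theta> by (intro mult_left_mono) auto
      also have "\<dots> = (1 - \<theta> * 3 / 4) * L - \<theta>\<^sup>2 / 4 * L" by (simp add: field_simps power2_eq_square)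
      also have "\<dots> \<le> (1 - \<theta> * 3 / 4) * L" using L by simp
      finally have 1: "(H + \<epsilon>) * real n \<le> t - \<theta> / 4 * L"
        by (simp add: \<epsilon>_def t_def algebra_simps)
      define A where "A = {x \<in> set_pmf (law n). pmf (law n) x \<ge> \<kappa>}"
      have finA: "finite A" by (simp add: A_def)
      have "real (card A) * \<kappa> \<le> (\<Sum>x\<in>A. pmf (law n) x)"
        using sum_mono[of A "\<lambda>_. \<kappa>" "pmf (law n)"] by (simp add: A_def)
      also have "\<dots> \<le> 1" using finA by (metis measure_measure_pmf_finite measure_pmf.prob_le_1)
      finally have "real (card A) \<le> exp t" by (simp add: \<kappa>_def exp_minus field_simps)
      hence "real (card A) / real q \<le> exp t / exp L" unfolding L(2) by (intro divide_right_mono) auto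
      also have "\<dots> = real q powr (- (\<theta> / 2))"
        using elim by (subst exp_diff[symmetric]) (simp add: powr_def t_def L_def algebra_simps)
      finally have card: "real (card A) / real q \<le> real q powr (- (\<theta> / 2))" .
      have "(\<Sum>x | x \<in> set_pmf (law n) \<and> pmf (law n) x < \<kappa>. pmf (law n) x) \<le> \<kappa> powr s * power_sum (- s) (law n)"
        using sC by (intro mass_small_atoms_le) (auto simp: \<kappa>_def)
      also have "\<dots> \<le> \<kappa> powr s * (C * exp (s * (H + \<epsilon>) * real n))"
        using sC by (intro mult_left_mono) auto
      also have "\<dots> = C * exp (s * ((H + \<epsilon>) * real n - t))"
        by (simp add: \<kappa>_def powr_def algebra_simps flip: exp_add)
      also have "\<dots> \<le> C * exp (s * (- (\<theta> / 4 * L)))"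
        using sC 1 by (intro mult_left_mono iffD2[OF exp_le_cancel_iff]) auto
      also have "\<dots> = C * real q powr (- (s * \<theta> / 4))"
        using elim by (simp add: powr_def L_def algebra_simps)
      finally have small: "(\<Sum>x | x \<in> set_pmf (law n) \<and> pmf (law n) x < \<kappa>. pmf (law n) x) \<le> C * real q powr (- (s * \<theta> / 4))" .
      have "1 = (\<Sum>x\<in>set_pmf (law n). pmf (law n) x)" by (simp add: sum_pmf_eq_1)
      also have "set_pmf (law n) = A \<union> {x. x \<in> set_pmf (law n) \<and> pmf (law n) x < \<kappa>}" by (auto simp: A_def)
      also have "(\<Sum>x\<in>\<dots>. pmf (law n) x) = (\<Sum>x\<in>A. pmf (law n) x) + (\<Sum>x | x \<in> set_pmf (law n) \<and> pmf (law n) x < \<kappa>. pmf (law n) x)"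
        by (intro sum.union_disjoint) (auto simp: A_def)
      finally have "(\<Sum>x\<in>A. pmf (law n) x) \<ge> 1 - C * real q powr (- (s * \<theta> / 4))" using small by simp
      thus "1 / 2 * unif_dist a \<mu> n q \<ge> 1 - \<eta>"
        using unif_dist_ge[of q A a \<mu> n] finA elim card by simp
    qed
  qed
  thus ?thesis by (simp add: eventually_sequentially)
qed

end

section \<open>Exponential sums and the large sieve\<close>

text \<open>The standard additive character, written \<open>e(t)\<close> in analytic number theory.\<close>

definition e :: "real \<Rightarrow> complex" where "e t = cis (2 * pi * t)"

lemma e_add: "e (s + t) = e s * e t"
  by (simp add: e_def cis_mult algebra_simps)

lemma norm_e [simp]: "norm (e t) = 1"
  by (simp add: e_def)

lemma e_0 [simp]: "e 0 = 1"
  by (simp add: e_def)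

lemma cnj_e: "cnj (e t) = e (- t)"
  by (simp add: e_def cis_cnj)

lemma e_int [simp]: "e (of_int k) = 1"
  unfolding e_def by (rule cis_multiple_2pi) auto

lemma e_add_int [simp]: "e (t + of_int k) = e t"
  by (simp add: e_add)

lemma e_eq_1_iff: "e t = 1 \<longleftrightarrow> t \<in> \<int>"
proof
  assume "e t = 1"
  then obtain k where "2 * pi * t = of_int k * (2 * pi)" unfolding e_def cis_eq_1_iff by blast
  hence "t = of_int k" by simp
  thus "t \<in> \<int>" by simp
qed (auto elim: Ints_cases)

lemma e_power: "e t ^ n = e (of_nat n * t)"
  by (simp add: e_def Complex.DeMoivre algebra_simps)

lemma sin_ge_chord:
  assumes "0 \<le> x" "x \<le> pi / 2"
  shows "sin x \<ge> 2 * x / pi"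
proof -
  \<comment> \<open>The sine is concave on this interval and so lies above its chord.\<close>
  have "convex_on {0..pi / 2} (\<lambda>x. - sin x)"
    by (rule f''_ge0_imp_convex[where f' = "\<lambda>x. - cos x" and f'' = sin])
       (auto intro!: derivative_eq_intros sin_ge_zero)
  from convex_onD_Icc'[OF this, of x] assms show ?thesis by simp
qed

lemma norm_1_minus_e: "norm (1 - e t) = 2 * \<bar>sin (pi * t)\<bar>"
proof -
  have "(norm (1 - e t))\<^sup>2 = (1 - cos (2 * (pi * t)))\<^sup>2 + (sin (2 * (pi * t)))\<^sup>2"
    by (simp add: cmod_power2 e_def mult.assoc)
  also have "\<dots> = 2 - 2 * cos (2 * (pi * t))"
    using sin_cos_squared_add[of "2 * (pi * t)"] by (simp add: power2_eq_square algebra_simps)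
  also have "\<dots> = (2 * \<bar>sin (pi * t)\<bar>)\<^sup>2" by (subst cos_double_sin) (simp add: power2_eq_square)
  finally show ?thesis by (metis abs_ge_zero mult_nonneg_nonneg norm_ge_zero power2_eq_imp_eq zero_le_numeral)
qed

lemma norm_1_minus_e_ge:
  assumes "0 \<le> t" "t \<le> 1"
  shows "norm (1 - e t) \<ge> 4 * min t (1 - t)"
proof -
  have *: "2 * t \<le> sin (pi * t)" if "0 \<le> t" "t \<le> 1 / 2" for t
    using sin_ge_chord[of "pi * t"] that by simp
  show ?thesis
  proof (cases "t \<le> 1 / 2")
    case True
    thus ?thesis using *[of t] assms by (simp add: norm_1_minus_e)
  next
    case False
    have "sin (pi * (1 - t)) = sin (pi * t)" by (simp add: right_diff_distrib)
    thus ?thesis using *[of "1 - t"] assms False by (simp add: norm_1_minus_e)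
  qed
qed

definition exp_sum :: "nat \<Rightarrow> real \<Rightarrow> complex" where
  "exp_sum K t = (\<Sum>i<K. e (real i * t))"

lemma exp_sum_add_int [simp]: "exp_sum K (t + of_int k) = exp_sum K t"
proof -
  have "e (real i * (t + of_int k)) = e (real i * t)" for i
    using e_add_int[of "real i * t" "int i * k"] by (simp add: algebra_simps)
  thus ?thesis by (simp add: exp_sum_def)
qed

lemma exp_sum_minus: "exp_sum K (- t) = cnj (exp_sum K t)"
  by (simp add: exp_sum_def cnj_e)

text \<open>The geometric series is at most \<open>2 / |1 - e(t)|\<close>, and the chord is at least four times the distance of \<open>t\<close>
  to the nearest integer. The sum of two squares replaces the minimum of \<open>t\<close> and \<open>1 - t\<close>, so that the two ends
  of the unit interval can be summed separately.\<close>

lemma exp_sum_bound: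
  assumes "0 < t" "t < 1"
  shows "(norm (exp_sum K t))\<^sup>2 \<le> (1 / t\<^sup>2 + 1 / (1 - t)\<^sup>2) / 4"
proof -
  define m where "m = min t (1 - t)"
  have m: "m > 0" using assms by (simp add: m_def)
  have ge: "norm (1 - e t) \<ge> 4 * m" using norm_1_minus_e_ge[of t] assms by (simp add: m_def)
  hence ne: "e t \<noteq> 1" using m by auto
  have "exp_sum K t = (e t ^ K - 1) / (e t - 1)"
    unfolding exp_sum_def using ne by (simp flip: e_power add: geometric_sum)
  hence "norm (exp_sum K t) = norm (e t ^ K - 1) / norm (1 - e t)"
    by (simp add: norm_divide norm_minus_commute)
  also have "\<dots> \<le> 2 / (4 * m)"
    using ge m norm_triangle_ineq4[of "e t ^ K" 1] by (intro frac_le) (auto simp: norm_power)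
  finally have "(norm (exp_sum K t))\<^sup>2 \<le> (2 / (4 * m))\<^sup>2" by (intro power_mono) auto
  also have "\<dots> = (1 / m\<^sup>2) / 4" by (simp add: power2_eq_square)
  also have "1 / m\<^sup>2 \<le> 1 / t\<^sup>2 + 1 / (1 - t)\<^sup>2" by (auto simp: m_def min_def)
  finally show ?thesis by simp
qed

text \<open>Rounding \<open>t r / \<delta>\<close> down gives distinct positive integers, so the sum is dominated by \<open>\<Sum> 1/(k\<delta>)\<^sup>2\<close>.\<close>

lemma sum_inverse_squares_le:
  fixes t :: "'i \<Rightarrow> real"
  assumes "finite R" "\<delta> > 0" "\<And>r. r \<in> R \<Longrightarrow> t r \<ge> \<delta>"
    and sep: "\<And>r s. r \<in> R \<Longrightarrow> s \<in> R \<Longrightarrow> r \<noteq> s \<Longrightarrow> \<bar>t r - t s\<bar> \<ge> \<delta>"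
  shows "(\<Sum>r\<in>R. 1 / (t r)\<^sup>2) \<le> 2 / \<delta>\<^sup>2"
proof -
  define k where "k = (\<lambda>r. nat \<lfloor>t r / \<delta>\<rfloor>)"
  have fl: "\<lfloor>t r / \<delta>\<rfloor> \<ge> 1" if "r \<in> R" for r
    using assms(2) assms(3)[OF that] by (simp add: le_floor_iff)
  hence k1: "k r \<ge> 1" if "r \<in> R" for r using fl[OF that] unfolding k_def by linarith
  have k2: "real (k r) * \<delta> \<le> t r" if "r \<in> R" for r
  proof -
    have "real (k r) = of_int \<lfloor>t r / \<delta>\<rfloor>" using fl[OF that] by (simp add: k_def)
    also have "\<dots> \<le> t r / \<delta>" by simp
    finally show ?thesis using assms(2) by (simp add: field_simps)
  qed
  have inj: "inj_on k R"
  proof (rule inj_onI)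
    fix r s assume rs: "r \<in> R" "s \<in> R" "k r = k s"
    hence "\<lfloor>t r / \<delta>\<rfloor> = \<lfloor>t s / \<delta>\<rfloor>" using fl[of r] fl[of s] by (simp add: k_def eq_nat_nat_iff)
    hence "\<bar>t r / \<delta> - t s / \<delta>\<bar> < 1" by linarith
    hence "\<bar>t r - t s\<bar> < \<delta>" using assms(2) by (simp add: field_simps flip: diff_divide_distrib)
    thus "r = s" using sep[of r s] rs by force
  qed
  have tel: "(\<Sum>i=1..n. 1 / (real i)\<^sup>2) \<le> 2 - 1 / real n" for n
  proof (induction n)
    case (Suc n)
    have "1 / (real (Suc n))\<^sup>2 \<le> 1 / real n - 1 / real (Suc n)" if "n > 0"
    proof -
      have "1 / (real (Suc n))\<^sup>2 \<le> 1 / (real n * real (Suc n))"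
        using that by (intro frac_le) (auto simp: power2_eq_square)
      also have "\<dots> = 1 / real n - 1 / real (Suc n)" using that by (simp add: field_simps)
      finally show ?thesis .
    qed
    with Suc show ?case by (cases "n = 0") auto
  qed auto
  have "(\<Sum>r\<in>R. 1 / (t r)\<^sup>2) \<le> (\<Sum>r\<in>R. 1 / (real (k r) * \<delta>)\<^sup>2)"
  proof (intro sum_mono)
    fix r assume r: "r \<in> R"
    have "0 < real (k r) * \<delta>" using k1[OF r] assms(2) by simp
    thus "1 / (t r)\<^sup>2 \<le> 1 / (real (k r) * \<delta>)\<^sup>2"
      using k2[OF r] by (intro frac_le power_mono zero_less_power) auto
  qed
  also have "\<dots> = (\<Sum>r\<in>R. 1 / (real (k r))\<^sup>2) / \<delta>\<^sup>2"
    by (simp add: sum_divide_distrib power_mult_distrib)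
  also have "(\<Sum>r\<in>R. 1 / (real (k r))\<^sup>2) = (\<Sum>i\<in>k ` R. 1 / (real i)\<^sup>2)"
    by (simp add: sum.reindex[OF inj])
  also have "\<dots> \<le> (\<Sum>i=1..Max (k ` R). 1 / (real i)\<^sup>2)"
    using assms(1) k1 by (intro sum_mono2) auto
  also have "\<dots> \<le> 2"
    by (rule order_trans[OF tel]) auto
  finally show ?thesis using assms(2) by (simp add: divide_right_mono)
qed

text \<open>A row sum of the Fejer kernel over \<open>\<delta>\<close>-separated points of the circle: the diagonal contributes \<open>K\<^sup>2\<close>, and the
  remaining terms decay quadratically and contribute at most \<open>1/\<delta>\<^sup>2 \<le> K\<^sup>2\<close>.\<close>

lemma sum_exp_sum_sq_le:
  fixes \<alpha> :: "'i \<Rightarrow> real"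
  assumes fin: "finite R" and \<delta>: "\<delta> > 0" "1 / \<delta> \<le> real K"
    and sep: "\<And>r s k. r \<in> R \<Longrightarrow> s \<in> R \<Longrightarrow> r \<noteq> s \<Longrightarrow> \<bar>\<alpha> r - \<alpha> s - of_int k\<bar> \<ge> \<delta>"
    and r: "r \<in> R"
  shows "(\<Sum>s\<in>R. (norm (exp_sum K (\<alpha> s - \<alpha> r)))\<^sup>2) \<le> 2 * (real K)\<^sup>2"
proof -
  define R' where "R' = R - {r}"
  define t where "t = (\<lambda>s. frac (\<alpha> s - \<alpha> r))"
  have teq: "exp_sum K (\<alpha> s - \<alpha> r) = exp_sum K (t s)" for s
    using exp_sum_add_int[of K "t s" "\<lfloor>\<alpha> s - \<alpha> r\<rfloor>"] by (simp add: t_def frac_def)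
  have t1: "t s \<ge> \<delta>" if "s \<in> R'" for s
    using sep[of s r "\<lfloor>\<alpha> s - \<alpha> r\<rfloor>"] that r frac_ge_0[of "\<alpha> s - \<alpha> r"] by (auto simp: R'_def t_def frac_def)
  have t2: "1 - t s \<ge> \<delta>" if "s \<in> R'" for s
    using sep[of s r "\<lfloor>\<alpha> s - \<alpha> r\<rfloor> + 1"] that r frac_lt_1[of "\<alpha> s - \<alpha> r"] by (auto simp: R'_def t_def frac_def)
  have t3: "\<bar>t s - t s'\<bar> \<ge> \<delta>" if "s \<in> R'" "s' \<in> R'" "s \<noteq> s'" for s s'
    using sep[of s s' "\<lfloor>\<alpha> s - \<alpha> r\<rfloor> - \<lfloor>\<alpha> s' - \<alpha> r\<rfloor>"] that by (auto simp: R'_def t_def frac_def algebra_simps)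
  have "(\<Sum>s\<in>R. (norm (exp_sum K (\<alpha> s - \<alpha> r)))\<^sup>2)
      = (norm (exp_sum K 0))\<^sup>2 + (\<Sum>s\<in>R'. (norm (exp_sum K (t s)))\<^sup>2)"
    unfolding R'_def using fin r by (subst sum.remove[of R r]) (auto simp: teq)
  also have "(\<Sum>s\<in>R'. (norm (exp_sum K (t s)))\<^sup>2) \<le> (\<Sum>s\<in>R'. (1 / (t s)\<^sup>2 + 1 / (1 - t s)\<^sup>2) / 4)"
  proof (intro sum_mono exp_sum_bound)
    fix s assume "s \<in> R'"
    thus "0 < t s" "t s < 1" using t1[of s] t2[of s] \<delta> by auto
  qed
  also have "\<dots> = ((\<Sum>s\<in>R'. 1 / (t s)\<^sup>2) + (\<Sum>s\<in>R'. 1 / (1 - t s)\<^sup>2)) / 4"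
    by (subst sum_divide_distrib[symmetric]) (simp add: sum.distrib)
  also have "\<dots> \<le> (2 / \<delta>\<^sup>2 + 2 / \<delta>\<^sup>2) / 4"
  proof (intro divide_right_mono add_mono sum_inverse_squares_le)
    show "\<bar>1 - t s - (1 - t s')\<bar> \<ge> \<delta>" if "s \<in> R'" "s' \<in> R'" "s \<noteq> s'" for s s'
      using t3[OF that] by (simp add: abs_minus_commute)
  qed (use t1 t2 t3 \<delta> fin in \<open>auto simp: R'_def\<close>)
  also have "\<dots> = (1 / \<delta>)\<^sup>2" by (simp add: power2_eq_square)
  also have "\<dots> \<le> (real K)\<^sup>2" using \<delta> by (intro power_mono) auto
  also have "(norm (exp_sum K 0))\<^sup>2 = (real K)\<^sup>2" by (simp add: exp_sum_def)
  finally show ?thesis by simp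
qed

definition ft :: "(int \<Rightarrow> real) \<Rightarrow> int set \<Rightarrow> real \<Rightarrow> complex" where
  "ft w A \<theta> = (\<Sum>x\<in>A. of_real (w x) * e (of_int x * \<theta>))"

lemma sum_swap_pairs:
  "(\<Sum>i\<in>A. \<Sum>j\<in>B. \<Sum>r\<in>C. \<Sum>s\<in>D. f i j r s) = (\<Sum>r\<in>C. \<Sum>s\<in>D. \<Sum>i\<in>A. \<Sum>j\<in>B. f i j r s)"
proof -
  have "(\<Sum>p\<in>A \<times> B. \<Sum>q\<in>C \<times> D. f (fst p) (snd p) (fst q) (snd q))
      = (\<Sum>q\<in>C \<times> D. \<Sum>p\<in>A \<times> B. f (fst p) (snd p) (fst q) (snd q))"
    by (rule sum.swap)
  thus ?thesis by (simp add: sum.cartesian_product')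
qed

text \<open>The large sieve inequality, proved by duality. Let \<open>g\<close> be the adjoint transform of the vector \<open>c\<close> of values of
  the Fourier transform. The quantity \<open>E\<close> to be bounded is the pairing of \<open>w\<close> with \<open>g\<close>, so Cauchy--Schwarz
  reduces the claim to a bound \<open>4KE\<close> for the square sum of \<open>g\<close> over the support. That sum is majorised by
  averaging \<open>|g(i - j)|\<^sup>2\<close> over \<open>i, j < K\<close>, which produces the nonnegative Fejer kernel and hence needs only
  its row sums.\<close>

lemma large_sieve:
  fixes \<alpha> :: "'i \<Rightarrow> real" and w :: "int \<Rightarrow> real"
  assumes fin: "finite R" and \<delta>: "\<delta> > 0" "1 / \<delta> \<le> real K"
    and sep: "\<And>r s k. r \<in> R \<Longrightarrow> s \<in> R \<Longrightarrow> r \<noteq> s \<Longrightarrow> \<bar>\<alpha> r - \<alpha> s - of_int k\<bar> \<ge> \<delta>"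
    and A: "A \<subseteq> {- int L..int L}" and K: "4 * L \<le> K"
  shows "(\<Sum>r\<in>R. (norm (ft w A (\<alpha> r)))\<^sup>2) \<le> 4 * real K * (\<Sum>x\<in>A. (w x)\<^sup>2)"
proof -
  have finA: "finite A" using A by (rule finite_subset) auto
  have K0: "real K > 0" using \<delta> by (intro less_le_trans[OF _ \<delta>(2)]) auto
  define c where "c = (\<lambda>r. ft w A (\<alpha> r))"
  define g where "g = (\<lambda>x::int. \<Sum>r\<in>R. cnj (c r) * e (of_int x * \<alpha> r))"
  define E where "E = (\<Sum>r\<in>R. (norm (c r))\<^sup>2)"
  define W where "W = (\<Sum>x\<in>A. (w x)\<^sup>2)"
  have E0: "E \<ge> 0" unfolding E_def by (intro sum_nonneg) auto
  have "complex_of_real E = (\<Sum>r\<in>R. cnj (c r) * c r)"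
    by (simp add: E_def complex_norm_square mult.commute del: of_real_power)
  also have "\<dots> = (\<Sum>r\<in>R. \<Sum>x\<in>A. of_real (w x) * (cnj (c r) * e (of_int x * \<alpha> r)))"
    by (subst (2) c_def) (simp add: ft_def sum_distrib_left mult_ac)
  also have "\<dots> = (\<Sum>x\<in>A. of_real (w x) * g x)"
    by (subst sum.swap) (simp add: g_def sum_distrib_left)
  finally have "E = norm (\<Sum>x\<in>A. of_real (w x) * g x)"
    using E0 by (metis abs_of_nonneg norm_of_real)
  also have "\<dots> \<le> (\<Sum>x\<in>A. \<bar>w x\<bar> * norm (g x))"
    by (rule order_trans[OF norm_sum]) (simp add: norm_mult)
  finally have "E\<^sup>2 \<le> (\<Sum>x\<in>A. \<bar>w x\<bar> * norm (g x))\<^sup>2" using E0 by (intro power_mono) auto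
  also have "\<dots> \<le> (\<Sum>x\<in>A. \<bar>w x\<bar>\<^sup>2) * (\<Sum>x\<in>A. (norm (g x))\<^sup>2)" by (rule Cauchy_Schwarz_ineq_sum)
  finally have E_sq: "E\<^sup>2 \<le> W * (\<Sum>x\<in>A. (norm (g x))\<^sup>2)" by (simp add: W_def)

  have dual: "(\<Sum>i<K. \<Sum>j<K. (norm (g (int i - int j)))\<^sup>2) \<le> 2 * (real K)\<^sup>2 * E"
  proof -
    have sym: "norm (exp_sum K (\<alpha> r - \<alpha> s)) = norm (exp_sum K (\<alpha> s - \<alpha> r))" for r s
      using exp_sum_minus[of K "\<alpha> s - \<alpha> r"] by simp
    have X0: "(\<Sum>i<K. \<Sum>j<K. (norm (g (int i - int j)))\<^sup>2) \<ge> 0" by (intro sum_nonneg) auto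
    have "complex_of_real (\<Sum>i<K. \<Sum>j<K. (norm (g (int i - int j)))\<^sup>2)
        = (\<Sum>i<K. \<Sum>j<K. \<Sum>r\<in>R. \<Sum>s\<in>R. (cnj (c r) * c s) * (e (real i * (\<alpha> r - \<alpha> s)) * e (- (real j * (\<alpha> r - \<alpha> s)))))"
      unfolding of_real_sum
    proof (intro sum.cong refl)
      fix i j
      have eq: "e ((real i - real j) * \<alpha> r) * e (- ((real i - real j) * \<alpha> s)) = e (real i * (\<alpha> r - \<alpha> s)) * e (- (real j * (\<alpha> r - \<alpha> s)))" for r s
        unfolding e_add[symmetric] by (rule arg_cong[where f = e]) (simp add: algebra_simps)
      have "complex_of_real ((norm (g (int i - int j)))\<^sup>2) = g (int i - int j) * cnj (g (int i - int j))"
        by (simp add: complex_norm_square del: of_real_power)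
      also have "\<dots> = (\<Sum>r\<in>R. \<Sum>s\<in>R. (cnj (c r) * c s) * (e ((real i - real j) * \<alpha> r) * e (- ((real i - real j) * \<alpha> s))))"
        unfolding g_def cnj_sum sum_product by (intro sum.cong refl) (simp add: cnj_e mult_ac)
      finally show "complex_of_real ((norm (g (int i - int j)))\<^sup>2) = (\<Sum>r\<in>R. \<Sum>s\<in>R. (cnj (c r) * c s) * (e (real i * (\<alpha> r - \<alpha> s)) * e (- (real j * (\<alpha> r - \<alpha> s)))))"
        unfolding eq .
    qed
    also have "\<dots> = (\<Sum>r\<in>R. \<Sum>s\<in>R. (cnj (c r) * c s) * (\<Sum>i<K. \<Sum>j<K. e (real i * (\<alpha> r - \<alpha> s)) * e (- (real j * (\<alpha> r - \<alpha> s)))))"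
      unfolding sum_distrib_left by (rule sum_swap_pairs)
    also have "\<dots> = (\<Sum>r\<in>R. \<Sum>s\<in>R. (cnj (c r) * c s) * of_real ((norm (exp_sum K (\<alpha> r - \<alpha> s)))\<^sup>2))"
    proof (intro sum.cong refl arg_cong2[where f = "(*)"])
      fix r s
      show "(\<Sum>i<K. \<Sum>j<K. e (real i * (\<alpha> r - \<alpha> s)) * e (- (real j * (\<alpha> r - \<alpha> s))))
          = of_real ((norm (exp_sum K (\<alpha> r - \<alpha> s)))\<^sup>2)"
        unfolding complex_norm_square exp_sum_def cnj_sum sum_product by (simp add: cnj_e)
    qed
    finally have "norm (complex_of_real (\<Sum>i<K. \<Sum>j<K. (norm (g (int i - int j)))\<^sup>2))
        = norm (\<Sum>r\<in>R. \<Sum>s\<in>R. (cnj (c r) * c s) * of_real ((norm (exp_sum K (\<alpha> r - \<alpha> s)))\<^sup>2))"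
      by (rule arg_cong[where f = norm])
    hence "(\<Sum>i<K. \<Sum>j<K. (norm (g (int i - int j)))\<^sup>2)
        = norm (\<Sum>r\<in>R. \<Sum>s\<in>R. (cnj (c r) * c s) * of_real ((norm (exp_sum K (\<alpha> r - \<alpha> s)))\<^sup>2))"
      using X0 by (simp only: norm_of_real abs_of_nonneg)
    also have "\<dots> \<le> (\<Sum>r\<in>R. \<Sum>s\<in>R. norm (c r) * norm (c s) * (norm (exp_sum K (\<alpha> r - \<alpha> s)))\<^sup>2)"
      by (intro sum_norm_le) (simp add: norm_mult norm_power)
    also have "\<dots> \<le> (\<Sum>r\<in>R. \<Sum>s\<in>R. ((norm (c r))\<^sup>2 + (norm (c s))\<^sup>2) / 2 * (norm (exp_sum K (\<alpha> r - \<alpha> s)))\<^sup>2)"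
    proof (intro sum_mono mult_right_mono)
      fix r s
      show "norm (c r) * norm (c s) \<le> ((norm (c r))\<^sup>2 + (norm (c s))\<^sup>2) / 2"
        using sum_squares_bound[of "norm (c r)" "norm (c s)"] by simp
    qed auto
    also have "\<dots> = (\<Sum>r\<in>R. \<Sum>s\<in>R. (norm (c r))\<^sup>2 / 2 * (norm (exp_sum K (\<alpha> r - \<alpha> s)))\<^sup>2)
                 + (\<Sum>r\<in>R. \<Sum>s\<in>R. (norm (c s))\<^sup>2 / 2 * (norm (exp_sum K (\<alpha> r - \<alpha> s)))\<^sup>2)"
      by (simp only: add_divide_distrib distrib_right sum.distrib)
    also have "(\<Sum>r\<in>R. \<Sum>s\<in>R. (norm (c s))\<^sup>2 / 2 * (norm (exp_sum K (\<alpha> r - \<alpha> s)))\<^sup>2)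
             = (\<Sum>r\<in>R. \<Sum>s\<in>R. (norm (c r))\<^sup>2 / 2 * (norm (exp_sum K (\<alpha> s - \<alpha> r)))\<^sup>2)"
      by (rule sum.swap)
    also have "(\<Sum>r\<in>R. \<Sum>s\<in>R. (norm (c r))\<^sup>2 / 2 * (norm (exp_sum K (\<alpha> r - \<alpha> s)))\<^sup>2)
             = (\<Sum>r\<in>R. \<Sum>s\<in>R. (norm (c r))\<^sup>2 / 2 * (norm (exp_sum K (\<alpha> s - \<alpha> r)))\<^sup>2)"
      by (intro sum.cong refl arg_cong2[where f = "(*)"] arg_cong[where f = "\<lambda>x. x\<^sup>2"] sym)
    also have "(\<Sum>r\<in>R. \<Sum>s\<in>R. (norm (c r))\<^sup>2 / 2 * (norm (exp_sum K (\<alpha> s - \<alpha> r)))\<^sup>2)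
             = (\<Sum>r\<in>R. (norm (c r))\<^sup>2 * (\<Sum>s\<in>R. (norm (exp_sum K (\<alpha> s - \<alpha> r)))\<^sup>2)) / 2"
      by (simp add: sum_distrib_left sum_divide_distrib)
    also have "\<dots> + \<dots> = (\<Sum>r\<in>R. (norm (c r))\<^sup>2 * (\<Sum>s\<in>R. (norm (exp_sum K (\<alpha> s - \<alpha> r)))\<^sup>2))"
      by simp
    also have "\<dots> \<le> (\<Sum>r\<in>R. (norm (c r))\<^sup>2 * (2 * (real K)\<^sup>2))"
      by (intro sum_mono mult_left_mono sum_exp_sum_sq_le[OF fin \<delta> sep]) auto
    also have "\<dots> = 2 * (real K)\<^sup>2 * E"
      by (simp add: E_def sum_distrib_left mult_ac)
    finally show ?thesis .
  qed

  have "real K / 2 * (\<Sum>x\<in>A. (norm (g x))\<^sup>2) \<le> (\<Sum>i<K. \<Sum>j<K. (norm (g (int i - int j)))\<^sup>2)"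
  proof -
    define f where "f = (\<lambda>p. (norm (g (int (fst p) - int (snd p))))\<^sup>2)"
    define h where "h = (\<lambda>(x, j). (nat (int j + x), j))"
    have A': "- int L \<le> x" "x \<le> int L" if "x \<in> A" for x using A that by auto
    have h_int: "int (nat (int j + x)) = int j + x" if "x \<in> A" "L \<le> j" for x j
      using A'[OF that(1)] that(2) by simp
    have inj: "inj_on h (A \<times> {L..<K - L})"
    proof (rule inj_onI)
      fix p p' assume **: "p \<in> A \<times> {L..<K - L}" "p' \<in> A \<times> {L..<K - L}" "h p = h p'"
      obtain x j x' j' where p: "p = (x, j)" "p' = (x', j')" by (metis surj_pair)
      have *: "x \<in> A" "j \<in> {L..<K - L}" "x' \<in> A" "j' \<in> {L..<K - L}" "h (x, j) = h (x', j')"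
        using ** p by auto
      hence "j = j'" "nat (int j + x) = nat (int j' + x')"
        unfolding h_def prod.case Pair_inject by blast+
      with h_int[of x j] h_int[of x' j'] * have "int j + x = int j' + x'"
        by (metis atLeastLessThan_iff)
      with \<open>j = j'\<close> show "p = p'" by (simp add: p)
    qed
    have img: "h ` (A \<times> {L..<K - L}) \<subseteq> {..<K} \<times> {..<K}"
    proof (rule image_subsetI)
      fix p assume "p \<in> A \<times> {L..<K - L}"
      then obtain x j where p: "p = (x, j)" and *: "x \<in> A" "j \<in> {L..<K - L}" by auto
      hence "nat (int j + x) < K" "j < K" using A'[of x] by auto
      thus "h p \<in> {..<K} \<times> {..<K}" using * by (simp add: h_def p)
    qed
    \<comment> \<open>Every \<open>x\<close> in \<open>A\<close> is a difference \<open>i - j\<close> of indices below \<open>K\<close> for each of the \<open>K - 2L\<close> values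
      \<open>j\<close> in \<open>{L..<K - L}\<close>, because \<open>|x| \<le> L\<close>.\<close>
    have "real K / 2 * (\<Sum>x\<in>A. (norm (g x))\<^sup>2) \<le> real (K - L - L) * (\<Sum>x\<in>A. (norm (g x))\<^sup>2)"
      using K by (intro mult_right_mono sum_nonneg) auto
    also have "\<dots> = (\<Sum>p\<in>A \<times> {L..<K - L}. (norm (g (fst p)))\<^sup>2)"
      using finA by (simp add: sum.cartesian_product' sum_distrib_left)
    also have "\<dots> = (\<Sum>p\<in>A \<times> {L..<K - L}. f (h p))"
      by (intro sum.cong) (auto simp: f_def h_def h_int simp del: int_nat_eq)
    also have "\<dots> = (\<Sum>p\<in>h ` (A \<times> {L..<K - L}). f p)"
      by (simp add: sum.reindex[OF inj])
    also have "\<dots> \<le> (\<Sum>p\<in>{..<K} \<times> {..<K}. f p)"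
      using img by (intro sum_mono2) (auto simp: f_def)
    finally show ?thesis by (simp add: f_def sum.cartesian_product')
  qed
  also note dual
  finally have "(\<Sum>x\<in>A. (norm (g x))\<^sup>2) \<le> 4 * real K * E"
    using K0 by (simp add: power2_eq_square)
  hence "W * (\<Sum>x\<in>A. (norm (g x))\<^sup>2) \<le> W * (4 * real K * E)"
    by (intro mult_left_mono) (auto simp: W_def sum_nonneg)
  with E_sq have "E * E \<le> (4 * real K * W) * E" by (simp add: power2_eq_square mult_ac)
  moreover have "4 * real K * W \<ge> 0" unfolding W_def by (intro mult_nonneg_nonneg sum_nonneg) auto
  ultimately have "E \<le> 4 * real K * W"
    using E0 by (cases "E = 0") (simp, metis less_eq_real_def mult_right_le_imp_le)
  thus ?thesis by (simp add: E_def c_def W_def)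
qed

section \<open>Primitive frequencies and Ramanujan sums\<close>

lemma sum_periodic_shift:
  fixes f :: "int \<Rightarrow> 'b::comm_monoid_add"
  assumes d: "d > 0" and per: "\<And>y. f (y mod d) = f y"
  shows "(\<Sum>y\<in>{0..<d}. f (y + s)) = (\<Sum>y\<in>{0..<d}. f y)"
proof (rule sum.reindex_bij_witness[where i = "\<lambda>y. (y - s) mod d" and j = "\<lambda>y. (y + s) mod d"])
  fix y assume "y \<in> {0..<d}"
  thus "((y + s) mod d - s) mod d = y" "((y - s) mod d + s) mod d = y"
    by (simp_all add: mod_diff_left_eq mod_add_left_eq)
qed (use d per in auto)

lemma sum_periodic_mult:
  fixes f :: "int \<Rightarrow> real"
  assumes d: "d > 0" and per: "\<And>y. f (y mod d) = f y" and m: "m \<ge> 0"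
  shows "(\<Sum>y\<in>{0..<m * d}. f y) = of_int m * (\<Sum>y\<in>{0..<d}. f y)"
proof -
  have "(\<Sum>y\<in>{0..<m * d}. f y) = (\<Sum>(i, j)\<in>{0..<m} \<times> {0..<d}. f j)"
  proof (rule sum.reindex_bij_witness[where i = "\<lambda>(i, j). i * d + j" and j = "\<lambda>y. (y div d, y mod d)"])
    fix y assume y: "y \<in> {0..<m * d}"
    have "y div d < m"
    proof (rule ccontr)
      assume "\<not> y div d < m"
      hence "m * d \<le> y div d * d" using d by (intro mult_right_mono) auto
      also have "\<dots> \<le> y" using d by (metis minus_mod_eq_div_mult pos_mod_sign diff_le_eq le_add_same_cancel1)
      finally show False using y by simp
    qed
    thus "(y div d, y mod d) \<in> {0..<m} \<times> {0..<d}" using d y by (auto simp: pos_imp_zdiv_nonneg_iff)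
  next
    fix p assume "p \<in> {0..<m} \<times> {0..<d}"
    then obtain i j where p: "p = (i, j)" "0 \<le> i" "i \<le> m - 1" "0 \<le> j" "j < d" by auto
    show "(case p of (i, j) \<Rightarrow> i * d + j) \<in> {0..<m * d}"
    proof -
      have "i * d \<le> (m - 1) * d" using p d by (intro mult_right_mono) auto
      hence "i * d + j < m * d" using p by (simp add: algebra_simps)
      thus ?thesis using p d by simp
    qed
    show "((case p of (i, j) \<Rightarrow> i * d + j) div d, (case p of (i, j) \<Rightarrow> i * d + j) mod d) = p"
      using p d by simp
  qed (use per in auto)
  also have "\<dots> = of_int m * (\<Sum>y\<in>{0..<d}. f y)"
    using m by (simp add: sum.cartesian_product')
  finally show ?thesis .
qed

lemma sum_e_orthogonal:
  assumes q: "q > 0"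
  shows "(\<Sum>b<q. e (real b * of_int t / real q)) = (if int q dvd t then of_nat q else 0)"
proof (cases "int q dvd t")
  case True
  then obtain k where k: "t = int q * k" by auto
  have "e (real b * of_int t / real q) = 1" for b
    using e_int[of "int b * k"] q by (simp add: k)
  thus ?thesis using True by simp
next
  case False
  define z where "z = e (of_int t / real q)"
  have "z \<noteq> 1"
  proof
    assume "z = 1"
    then obtain k where "of_int t / real q = of_int k" unfolding z_def e_eq_1_iff by (elim Ints_cases)
    hence "real_of_int t = of_int (int q * k)" using q by (simp add: field_simps)
    hence "t = int q * k" by (simp only: of_int_eq_iff)
    thus False using False by simp
  qed
  moreover have "z ^ q = 1" unfolding z_def e_power using q by simp
  moreover have "e (real b * of_int t / real q) = z ^ b" for b
    unfolding z_def e_power by simp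
  ultimately show ?thesis using False by (simp add: geometric_sum)
qed

definition coprime_residues :: "nat \<Rightarrow> nat set" where
  "coprime_residues d = {b \<in> {..<d}. coprime b d}"

lemma finite_coprime_residues [simp]: "finite (coprime_residues d)"
  by (simp add: coprime_residues_def)

definition ramanujan :: "nat \<Rightarrow> int \<Rightarrow> complex" where
  "ramanujan d t = (\<Sum>b\<in>coprime_residues d. e (real b * of_int t / real d))"

lemma ramanujan_1 [simp]: "ramanujan (Suc 0) t = 1"
proof -
  have "coprime_residues (Suc 0) = {0}" by (auto simp: coprime_residues_def)
  thus ?thesis by (simp add: ramanujan_def)
qed

lemma e_periodic: "d > 0 \<Longrightarrow> e (real b * of_int (t mod int d) / real d) = e (real b * of_int t / real d)"
proof -
  assume d: "d > 0"
  define r k where "r = t mod int d" and "k = t div int d"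
  have "t = r + int d * k" by (simp add: r_def k_def)
  hence "real_of_int t = of_int r + real d * of_int k" by simp
  hence "real b * of_int t / real d = real b * of_int (t mod int d) / real d + of_int (int b * k)"
    using d by (simp add: field_simps flip: r_def)
  thus ?thesis by (simp only: e_add_int)
qed

lemma ramanujan_mod: "d > 0 \<Longrightarrow> ramanujan d (t mod int d) = ramanujan d t"
  by (simp add: ramanujan_def e_periodic)

text \<open>Reducing the fractions \<open>b/q\<close> to lowest terms sorts them by their denominator \<open>d\<close>, so the full orthogonality
  relation modulo \<open>q\<close> is the sum of the primitive contributions.\<close>

lemma sum_divisors_ramanujan:
  assumes q: "q > 0"
  shows "(\<Sum>d | d dvd q. ramanujan d t) = (if int q dvd t then of_nat q else 0)"
proof -
  have "(\<Sum>d | d dvd q. ramanujan d t)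
      = (\<Sum>(d, c)\<in>Sigma {d. d dvd q} coprime_residues. e (real c * of_int t / real d))"
    unfolding ramanujan_def using q by (intro sum.Sigma) auto
  also have "\<dots> = (\<Sum>b<q. e (real b * of_int t / real q))"
  proof (rule sum.reindex_bij_witness[where i = "\<lambda>b. (q div gcd b q, b div gcd b q)" and j = "\<lambda>(d, c). c * (q div d)"])
    fix p assume "p \<in> Sigma {d. d dvd q} coprime_residues"
    then obtain d c where p: "p = (d, c)" "d dvd q" "c < d" "coprime c d"
      by (auto simp: coprime_residues_def)
    then obtain k where k: "q = d * k" by auto
    have pos: "d > 0" "k > 0" using q k by auto
    have "gcd (c * k) (d * k) = k" using p gcd_mult_distrib_nat[of k c d] by (simp add: mult.commute)
    thus "(q div gcd (case p of (d, c) \<Rightarrow> c * (q div d)) q, (case p of (d, c) \<Rightarrow> c * (q div d)) div gcd (case p of (d, c) \<Rightarrow> c * (q div d)) q) = p"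
      using p k pos by simp
    show "(case p of (d, c) \<Rightarrow> c * (q div d)) \<in> {..<q}" using p k pos by simp
    show "e (real (case p of (d, c) \<Rightarrow> c * (q div d)) * of_int t / real q) = (case p of (d, c) \<Rightarrow> e (real c * of_int t / real d))"
      using p k pos by simp
  next
    fix b assume b: "b \<in> {..<q}"
    define g where "g = gcd b q"
    have g: "g > 0" "g dvd b" "g dvd q" using q by (auto simp: g_def)
    obtain b' q' where bq: "b = g * b'" "q = g * q'" using g by (elim dvdE)
    have q': "q' > 0" using q bq by auto
    have "coprime b' q'" using g bq g_def by (metis coprime_iff_gcd_eq_1 gcd_mult_distrib_nat nat_mult_eq_1_iff mult.right_neutral nat_mult_eq_cancel1)
    moreover have "b' < q'" using b bq g by simp
    ultimately show "(q div gcd b q, b div gcd b q) \<in> Sigma {d. d dvd q} coprime_residues"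
      unfolding g_def[symmetric] using g bq by (simp add: coprime_residues_def)
    show "(case (q div gcd b q, b div gcd b q) of (d, c) \<Rightarrow> c * (q div d)) = b"
      unfolding g_def[symmetric] using g bq q' by simp
  qed
  also have "\<dots> = (if int q dvd t then of_nat q else 0)" by (rule sum_e_orthogonal[OF q])
  finally show ?thesis .
qed

lemma sum_e_orthogonal_int:
  assumes q: "q > 0"
  shows "(\<Sum>y\<in>{0..<int q}. e (of_int t * of_int y / real q)) = (if int q dvd t then of_nat q else 0)"
proof -
  have "(\<Sum>y\<in>{0..<int q}. e (of_int t * of_int y / real q)) = (\<Sum>b<q. e (real b * of_int t / real q))"
    by (rule sum.reindex_bij_witness[where i = int and j = nat]) (auto simp: mult.commute)
  thus ?thesis using sum_e_orthogonal[OF q] by simp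
qed

lemma ramanujan_parseval:
  fixes z :: "nat \<Rightarrow> complex"
  assumes d: "d > 0"
  shows "(\<Sum>y\<in>{0..<int d}. (norm (\<Sum>b\<in>coprime_residues d. z b * e (- (real b * of_int y / real d))))\<^sup>2)
       = real d * (\<Sum>b\<in>coprime_residues d. (norm (z b))\<^sup>2)"
proof -
  let ?B = "coprime_residues d"
  have "complex_of_real (\<Sum>y\<in>{0..<int d}. (norm (\<Sum>b\<in>?B. z b * e (- (real b * of_int y / real d))))\<^sup>2)
      = (\<Sum>y\<in>{0..<int d}. \<Sum>b\<in>?B. \<Sum>b'\<in>?B. z b * cnj (z b') * e (of_int (int b' - int b) * of_int y / real d))"
    unfolding of_real_sum complex_norm_square cnj_sum sum_product
    by (intro sum.cong refl) (simp add: cnj_e mult_ac diff_divide_distrib left_diff_distrib e_add[symmetric] right_diff_distrib)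
  also have "\<dots> = (\<Sum>b\<in>?B. \<Sum>b'\<in>?B. z b * cnj (z b') * (\<Sum>y\<in>{0..<int d}. e (of_int (int b' - int b) * of_int y / real d)))"
    by (subst sum.swap, intro sum.cong refl, subst sum.swap) (simp only: sum_distrib_left)
  also have "\<dots> = (\<Sum>b\<in>?B. \<Sum>b'\<in>?B. if b' = b then z b * cnj (z b') * of_nat d else 0)"
  proof (intro sum.cong refl)
    fix b b' assume bb: "b \<in> ?B" "b' \<in> ?B"
    have "int d dvd int b' - int b \<longleftrightarrow> int b' mod int d = int b mod int d" by (simp add: mod_eq_dvd_iff)
    also have "\<dots> \<longleftrightarrow> b' = b" using bb by (simp add: coprime_residues_def)
    finally show "z b * cnj (z b') * (\<Sum>y\<in>{0..<int d}. e (of_int (int b' - int b) * of_int y / real d))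
        = (if b' = b then z b * cnj (z b') * of_nat d else 0)"
      by (subst sum_e_orthogonal_int[OF d]) simp
  qed
  also have "\<dots> = (\<Sum>b\<in>?B. z b * cnj (z b) * of_nat d)" by (simp add: sum.delta)
  also have "\<dots> = complex_of_real (real d * (\<Sum>b\<in>?B. (norm (z b))\<^sup>2))"
    by (simp only: of_real_mult of_real_sum complex_norm_square sum_distrib_left of_real_of_nat_eq mult.commute)
  finally show ?thesis by (simp only: of_real_eq_iff)
qed

text \<open>Up to normalisation the inner sum is the part of \<open>w mod d\<close> at the primitive frequencies \<open>b/d\<close>, with \<open>b\<close>
  coprime to \<open>d\<close>; the value is the \<open>l\<^sup>1\<close> norm of that part over the residues modulo \<open>d\<close>. Writing it with Ramanujan sums
  makes it visibly linear in \<open>w\<close> and equivariant under translations.\<close>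

definition prim_norm :: "(int \<Rightarrow> real) \<Rightarrow> int set \<Rightarrow> nat \<Rightarrow> real" where
  "prim_norm w A d = (\<Sum>y\<in>{0..<int d}. norm (\<Sum>x\<in>A. of_real (w x) * ramanujan d (x - y))) / real d"

lemma prim_norm_nonneg: "prim_norm w A d \<ge> 0"
  unfolding prim_norm_def by (intro divide_nonneg_nonneg sum_nonneg) auto

lemma prim_norm_union_le:
  assumes "finite A" "finite B" "A \<inter> B = {}"
  shows "prim_norm w (A \<union> B) d \<le> prim_norm w A d + prim_norm w B d"
  unfolding prim_norm_def add_divide_distrib[symmetric] sum.distrib[symmetric]
  using assms by (intro divide_right_mono sum_mono) (auto simp: sum.union_disjoint intro: norm_triangle_ineq)

text \<open>Cauchy--Schwarz over the \<open>d\<close> residues, followed by Parseval's identity.\<close>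

lemma prim_norm_le_sqrt:
  assumes d: "d > 0"
  shows "prim_norm w A d \<le> sqrt (\<Sum>b\<in>coprime_residues d. (norm (ft w A (real b / real d)))\<^sup>2)"
proof -
  let ?S = "\<Sum>b\<in>coprime_residues d. (norm (ft w A (real b / real d)))\<^sup>2"
  have eq: "(\<Sum>x\<in>A. of_real (w x) * ramanujan d (x - y))
      = (\<Sum>b\<in>coprime_residues d. ft w A (real b / real d) * e (- (real b * of_int y / real d)))" for y
    unfolding ramanujan_def ft_def sum_distrib_left sum_distrib_right
    by (subst sum.swap, intro sum.cong refl)
       (simp add: e_add[symmetric] diff_divide_distrib right_diff_distrib mult_ac)
  have "(\<Sum>y\<in>{0..<int d}. norm (\<Sum>x\<in>A. of_real (w x) * ramanujan d (x - y)) * 1)\<^sup>2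
      \<le> (\<Sum>y\<in>{0..<int d}. (norm (\<Sum>x\<in>A. of_real (w x) * ramanujan d (x - y)))\<^sup>2) * (\<Sum>y\<in>{0..<int d}. 1\<^sup>2)"
    by (rule Cauchy_Schwarz_ineq_sum)
  also have "\<dots> = (real d)\<^sup>2 * ?S"
    unfolding eq ramanujan_parseval[OF d] by (simp add: power2_eq_square)
  finally have "(real d * prim_norm w A d)\<^sup>2 \<le> (real d)\<^sup>2 * ?S" using d by (simp add: prim_norm_def)
  hence "(prim_norm w A d)\<^sup>2 \<le> ?S" using d by (simp add: power_mult_distrib)
  thus ?thesis by (rule real_le_rsqrt)
qed

text \<open>Restricting to frequencies \<open>b\<close> prime to \<open>d\<close> amounts to removing, for each prime \<open>p\<close> dividing \<open>d\<close>, those \<open>b\<close>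
  divisible by \<open>p\<close>. Each removal subtracts from a function its average over translates by multiples of \<open>d/p\<close>, and
  so at most doubles the \<open>l\<^sup>1\<close> norm.\<close>

lemma sum_norm_ramanujan_le:
  assumes d: "d > 0"
  shows "(\<Sum>t\<in>{0..<int d}. norm (ramanujan d t)) \<le> real d * 2 ^ card (prime_factors d)"
proof -
  define f where "f = (\<lambda>P t. \<Sum>b | b < d \<and> (\<forall>p\<in>P. \<not> p dvd b). e (real b * of_int t / real d))"
  have per: "f P (t mod int d) = f P t" for P t by (simp add: f_def e_periodic d)
  have main: "(\<Sum>t\<in>{0..<int d}. norm (f P t)) \<le> real d * 2 ^ card P"
    if "finite P" "P \<subseteq> prime_factors d" for P
    using that
  proof (induction P rule: finite_induct)
    case empty
    have "f {} t = (if int d dvd t then of_nat d else 0)" for t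
      using sum_e_orthogonal[OF d, of t] by (simp add: f_def lessThan_def)
    hence "(\<Sum>t\<in>{0..<int d}. norm (f {} t)) = (\<Sum>t\<in>{0..<int d}. if t = 0 then real d else 0)"
      by (intro sum.cong refl) (use zdvd_imp_le in force)
    also have "\<dots> = real d" using d by (simp add: sum.delta)
    finally show ?case by simp
  next
    case (insert p P)
    have p: "prime p" "p dvd d" using insert by auto
    then obtain m where m: "d = p * m" by auto
    have pos: "p > 0" "m > 0" using d m by auto
    have orth: "(\<Sum>j<p. e (real j * real b / real p)) = (if p dvd b then of_nat p else 0)" for b
      using sum_e_orthogonal[of p "int b"] pos by simp
    have step: "f (insert p P) t = f P t - (\<Sum>j<p. f P (t + int (j * m))) / of_nat p" for t
    proof -
      have "(\<Sum>j<p. f P (t + int (j * m))) / of_nat p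
          = (\<Sum>b | b < d \<and> (\<forall>p\<in>P. \<not> p dvd b). e (real b * of_int t / real d) * ((\<Sum>j<p. e (real j * real b / real p)) / of_nat p))"
        unfolding f_def
        by (subst sum.swap)
           (use pos in \<open>simp add: m sum_distrib_left sum_divide_distrib distrib_left add_divide_distrib e_add mult_ac\<close>)
      also have "\<dots> = (\<Sum>b | b < d \<and> (\<forall>p\<in>P. \<not> p dvd b). if p dvd b then e (real b * of_int t / real d) else 0)"
        by (intro sum.cong refl) (use pos in \<open>simp add: orth\<close>)
      finally have "f P t - (\<Sum>j<p. f P (t + int (j * m))) / of_nat p
          = (\<Sum>b | b < d \<and> (\<forall>p\<in>P. \<not> p dvd b). if p dvd b then 0 else e (real b * of_int t / real d))"
        unfolding f_def by (simp add: sum_subtractf[symmetric] if_distrib cong: if_cong)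
      also have "\<dots> = f (insert p P) t"
        unfolding f_def by (intro sum.mono_neutral_cong_right) auto
      finally show ?thesis by simp
    qed
    have "(\<Sum>t\<in>{0..<int d}. norm (f (insert p P) t))
        \<le> (\<Sum>t\<in>{0..<int d}. norm (f P t) + (\<Sum>j<p. norm (f P (t + int (j * m)))) / real p)"
    proof (intro sum_mono)
      fix t
      have "norm ((\<Sum>j<p. f P (t + int (j * m))) / of_nat p) \<le> (\<Sum>j<p. norm (f P (t + int (j * m)))) / real p"
        using norm_sum[of "\<lambda>j. f P (t + int (j * m))" "{..<p}"] by (simp add: norm_divide divide_right_mono)
      thus "norm (f (insert p P) t) \<le> norm (f P t) + (\<Sum>j<p. norm (f P (t + int (j * m)))) / real p"
        unfolding step using norm_triangle_ineq4[of "f P t" "(\<Sum>j<p. f P (t + int (j * m))) / of_nat p"] by linarith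
    qed
    also have "\<dots> = (\<Sum>t\<in>{0..<int d}. norm (f P t)) + (\<Sum>j<p. \<Sum>t\<in>{0..<int d}. norm (f P (t + int (j * m)))) / real p"
      by (simp add: sum.distrib sum_divide_distrib[symmetric] sum.swap[of _ "{..<p}"])
    also have "(\<Sum>j<p. \<Sum>t\<in>{0..<int d}. norm (f P (t + int (j * m)))) = (\<Sum>j<p. \<Sum>t\<in>{0..<int d}. norm (f P t))"
      using d by (intro sum.cong refl sum_periodic_shift) (auto simp: per)
    also have "(\<Sum>t\<in>{0..<int d}. norm (f P t)) + (\<Sum>j<p. \<Sum>t\<in>{0..<int d}. norm (f P t)) / real p
        = 2 * (\<Sum>t\<in>{0..<int d}. norm (f P t))" using pos by simp
    also have "\<dots> \<le> 2 * (real d * 2 ^ card P)" using insert by (intro mult_left_mono) auto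
    finally show ?case using insert by simp
  qed
  have "{b. b < d \<and> (\<forall>p\<in>prime_factors d. \<not> p dvd b)} = coprime_residues d"
  proof -
    have "coprime b d \<longleftrightarrow> (\<forall>p\<in>prime_factors d. \<not> p dvd b)" for b
    proof
      assume "coprime b d"
      thus "\<forall>p\<in>prime_factors d. \<not> p dvd b"
        by (metis coprime_common_divisor in_prime_factors_iff not_prime_unit)
    next
      assume *: "\<forall>p\<in>prime_factors d. \<not> p dvd b"
      show "coprime b d"
      proof (rule ccontr)
        assume "\<not> coprime b d"
        hence "gcd b d \<noteq> 1" by (simp add: coprime_iff_gcd_eq_1)
        then obtain p where "prime p" "p dvd gcd b d" using prime_factor_nat by blast
        thus False using * d by (auto simp: in_prime_factors_iff)
      qed
    qed
    thus ?thesis by (auto simp: coprime_residues_def)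
  qed
  hence "f (prime_factors d) = ramanujan d" by (simp add: f_def ramanujan_def fun_eq_iff)
  with main[of "prime_factors d"] show ?thesis by simp
qed

text \<open>Unlike the bound by \<open>prim_norm_le_sqrt\<close>, this one sees only the total mass. It is used for the few large
  atoms, on which there is no control of the square sum.\<close>

lemma prim_norm_le_mass:
  assumes d: "d > 0"
  shows "prim_norm w A d \<le> 2 ^ card (prime_factors d) * (\<Sum>x\<in>A. \<bar>w x\<bar>)"
proof -
  have shift: "(\<Sum>y\<in>{0..<int d}. norm (ramanujan d (x - y))) = (\<Sum>y\<in>{0..<int d}. norm (ramanujan d y))" for x
  proof -
    have "(\<Sum>y\<in>{0..<int d}. norm (ramanujan d (x - y))) = (\<Sum>y\<in>{0..<int d}. norm (ramanujan d ((x - y) mod int d)))"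
      using d by (simp add: ramanujan_mod)
    also have "\<dots> = (\<Sum>y\<in>{0..<int d}. norm (ramanujan d y))"
    proof (rule sum.reindex_bij_witness[where i = "\<lambda>y. (x - y) mod int d" and j = "\<lambda>y. (x - y) mod int d"])
      fix y assume "y \<in> {0..<int d}"
      thus "(x - (x - y) mod int d) mod int d = y" "(x - (x - y) mod int d) mod int d = y"
        by (simp_all add: mod_diff_right_eq)
    qed (use d in auto)
    finally show ?thesis .
  qed
  have "(\<Sum>y\<in>{0..<int d}. norm (\<Sum>x\<in>A. of_real (w x) * ramanujan d (x - y)))
      \<le> (\<Sum>y\<in>{0..<int d}. \<Sum>x\<in>A. \<bar>w x\<bar> * norm (ramanujan d (x - y)))"
    by (intro sum_mono order_trans[OF norm_sum]) (simp add: norm_mult)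
  also have "\<dots> = (\<Sum>x\<in>A. \<bar>w x\<bar> * (\<Sum>y\<in>{0..<int d}. norm (ramanujan d y)))"
    by (subst sum.swap) (simp add: shift flip: sum_distrib_left)
  also have "\<dots> \<le> (\<Sum>x\<in>A. \<bar>w x\<bar> * (real d * 2 ^ card (prime_factors d)))"
    using sum_norm_ramanujan_le[OF d] by (intro sum_mono mult_left_mono) auto
  also have "\<dots> = real d * (2 ^ card (prime_factors d) * (\<Sum>x\<in>A. \<bar>w x\<bar>))"
    by (simp add: sum_distrib_left sum_distrib_right mult_ac)
  finally show ?thesis using d by (simp add: prim_norm_def field_simps)
qed

section \<open>Primitive parts of the laws of the walk\<close>

text \<open>Only primes below \<open>2\<^sup>1\<^sup>/\<^sup>\<kappa>\<close> have \<open>2 > p\<^sup>\<kappa>\<close>, and there are boundedly many of them.\<close>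

lemma two_power_omega_le:
  assumes "\<kappa> > (0::real)"
  obtains C :: real where "C > 0" "\<And>d. d > 0 \<Longrightarrow> 2 ^ card (prime_factors d) \<le> C * real d powr \<kappa>"
proof -
  define K where "K = nat \<lceil>2 powr (1 / \<kappa>)\<rceil>"
  show ?thesis
  proof (rule that[of "2 ^ K"])
    fix d :: nat assume d: "d > 0"
    let ?P = "prime_factors d"
    have "(2::real) ^ card ?P = (\<Prod>p\<in>?P. 2)" by simp
    also have "\<dots> \<le> (\<Prod>p\<in>?P. (if p < K then 2 else 1) * real (p ^ multiplicity p d) powr \<kappa>)"
    proof (intro prod_mono conjI)
      fix p assume p: "p \<in> ?P"
      hence "prime p" "multiplicity p d \<ge> 1" by (auto simp: prime_factors_multiplicity)
      hence "p \<le> p ^ multiplicity p d" using self_le_power[of p] prime_ge_1_nat by simp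
      hence ge: "real p powr \<kappa> \<le> real (p ^ multiplicity p d) powr \<kappa>"
        using assms by (intro powr_mono2) auto
      have p1: "real p \<ge> 1" using prime_ge_1_nat[OF \<open>prime p\<close>] by simp
      show "2 \<le> (if p < K then 2 else 1) * real (p ^ multiplicity p d) powr \<kappa>"
      proof (cases "p < K")
        case True
        have "1 \<le> real p powr \<kappa>" using p1 assms by (intro ge_one_powr_ge_zero) auto
        thus ?thesis using True ge by (simp del: of_nat_power)
      next
        case False
        hence "2 powr (1 / \<kappa>) \<le> real p" unfolding K_def by linarith
        hence "(2 powr (1 / \<kappa>)) powr \<kappa> \<le> real p powr \<kappa>" using assms by (intro powr_mono2) auto
        thus ?thesis using False ge assms by (simp add: powr_powr del: of_nat_power)
      qed
    qed auto
    also have "\<dots> = (\<Prod>p\<in>?P. if p < K then 2 else 1) * (\<Prod>p\<in>?P. real (p ^ multiplicity p d) powr \<kappa>)"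
      by (rule prod.distrib)
    also have "(\<Prod>p\<in>?P. real (p ^ multiplicity p d) powr \<kappa>) = (\<Prod>p\<in>?P. real (p ^ multiplicity p d)) powr \<kappa>"
      by (rule prod_powr_distrib[symmetric])
    also have "(\<Prod>p\<in>?P. real (p ^ multiplicity p d)) = real d"
      using d prime_factorization_nat[of d] by (simp flip: of_nat_prod del: of_nat_power)
    also have "(\<Prod>p\<in>?P. if p < K then 2 else (1::real)) = 2 ^ card {p \<in> ?P. p < K}"
      by (simp add: prod.If_cases Int_def)
    also have "\<dots> \<le> 2 ^ K"
      using card_mono[of "{..<K}" "{p \<in> ?P. p < K}"] by (intro power_increasing) auto
    finally show "2 ^ card ?P \<le> 2 ^ K * real d powr \<kappa>" by (simp add: mult_right_mono)
  qed auto
qed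

text \<open>Over the common denominator \<open>d d'\<close> the difference is a nonzero integer divided by \<open>d d' \<le> D\<^sup>2\<close>.\<close>

lemma farey_separated:
  assumes d: "d > 0" "d \<le> D" "b < d" "coprime b d" and d': "d' > 0" "d' \<le> D" "b' < d'" "coprime b' d'"
    and ne: "(d, b) \<noteq> (d', b')"
  shows "\<bar>real b / real d - real b' / real d' - of_int k\<bar> \<ge> 1 / (real D)\<^sup>2"
proof -
  define N where "N = int b * int d' - int b' * int d - k * int d * int d'"
  have "N \<noteq> 0"
  proof
    assume "N = 0"
    hence eq: "int b * int d' = int d * (int b' + k * int d')" "int b' * int d = int d' * (int b - k * int d)"
      by (simp_all add: N_def algebra_simps)
    have "int d dvd int b * int d'" unfolding eq(1) by simp
    hence "d dvd d'" using d by (metis coprime_commute coprime_dvd_mult_right_iff int_dvd_int_iff of_nat_mult)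
    moreover have "int d' dvd int b' * int d" unfolding eq(2) by simp
    hence "d' dvd d" using d' by (metis coprime_commute coprime_dvd_mult_right_iff int_dvd_int_iff of_nat_mult)
    ultimately have dd: "d = d'" by (rule dvd_antisym)
    with eq(1) d have "int b = int b' + k * int d" by (simp add: mult.commute)
    hence "int b mod int d = int b' mod int d" by simp
    hence "b = b'" using d d' dd by simp
    with dd ne show False by simp
  qed
  hence "\<bar>real_of_int N\<bar> \<ge> 1" by linarith
  hence "1 / (real D)\<^sup>2 \<le> \<bar>real_of_int N\<bar> / (real d * real d')"
    using d d' by (intro frac_le) (auto simp: power2_eq_square intro: mult_mono)
  also have "\<dots> = \<bar>real_of_int N / (real d * real d')\<bar>" by simp
  also have "real_of_int N / (real d * real d') = real b / real d - real b' / real d' - of_int k"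
    using d d' by (simp add: N_def field_simps)
  finally show ?thesis .
qed

lemma large_sieve_farey:
  assumes D: "D > 0" and A: "A \<subseteq> {- int L..int L}"
  shows "(\<Sum>d\<in>{1..D}. \<Sum>b\<in>coprime_residues d. (norm (ft w A (real b / real d)))\<^sup>2)
       \<le> 4 * real (4 * L + D\<^sup>2) * (\<Sum>x\<in>A. (w x)\<^sup>2)"
proof -
  have "(\<Sum>d\<in>{1..D}. \<Sum>b\<in>coprime_residues d. (norm (ft w A (real b / real d)))\<^sup>2)
      = (\<Sum>p\<in>Sigma {1..D} coprime_residues. (norm (ft w A (case p of (d, b) \<Rightarrow> real b / real d)))\<^sup>2)"
    by (simp add: sum.Sigma case_prod_unfold)
  also have "\<dots> \<le> 4 * real (4 * L + D\<^sup>2) * (\<Sum>x\<in>A. (w x)\<^sup>2)"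
  proof (rule large_sieve[where \<delta> = "1 / (real D)\<^sup>2" and L = L])
    fix r s k assume "r \<in> Sigma {1..D} coprime_residues" "s \<in> Sigma {1..D} coprime_residues" "r \<noteq> s"
    thus "\<bar>(case r of (d, b) \<Rightarrow> real b / real d) - (case s of (d, b) \<Rightarrow> real b / real d) - of_int k\<bar> \<ge> 1 / (real D)\<^sup>2"
      by (cases r; cases s; simp only: prod.case; intro farey_separated) (auto simp: coprime_residues_def)
  qed (use D A in auto)
  finally show ?thesis .
qed

text \<open>The term \<open>d = 1\<close> of the expansion is the uniform distribution. The terms for \<open>d > 1\<close> are \<open>d\<close>-periodic, so
  summing over the residues modulo \<open>q\<close> repeats the sum over the residues modulo \<open>d\<close> exactly \<open>q/d\<close> times.\<close>

lemma unif_dist_le_sum_prim_norm: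
  assumes q: "q > 0" and fin: "finite (set_pmf (step_law a \<mu> n))"
  shows "unif_dist a \<mu> n q \<le> (\<Sum>d | d dvd q \<and> d > 1. prim_norm (pmf (step_law a \<mu> n)) (set_pmf (step_law a \<mu> n)) d)"
proof -
  define w A where "w = pmf (step_law a \<mu> n)" and "A = set_pmf (step_law a \<mu> n)"
  define G where "G = (\<lambda>d y. norm (\<Sum>x\<in>A. of_real (w x) * ramanujan d (x - y)))"
  define Ds where "Ds = {d. d dvd q \<and> d > 1}"
  have Ds: "{d. d dvd q} = insert 1 Ds" "1 \<notin> Ds" "finite Ds"
    using q by (auto simp: Ds_def intro: finite_subset[of _ "{d. d dvd q}"])
  have pt: "\<bar>pmf (mod_pmf (step_law a \<mu> n) q) y - pmf (unif_mod q) y\<bar> \<le> (\<Sum>d\<in>Ds. G d y) / real q"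
    if y: "y \<in> {0..<int q}" for y
  proof -
    have "complex_of_real (pmf (mod_pmf (step_law a \<mu> n) q) y) = (\<Sum>x\<in>A. if x mod int q = y then of_real (w x) else 0)"
      unfolding mod_pmf_def using fin
      by (simp add: pmf_map_sum A_def w_def sum.inter_filter[symmetric])
    also have "\<dots> = (\<Sum>x\<in>A. of_real (w x) * (\<Sum>d | d dvd q. ramanujan d (x - y)) / of_nat q)"
    proof (intro sum.cong refl)
      fix x
      have "int q dvd x - y \<longleftrightarrow> x mod int q = y mod int q" by (simp add: mod_eq_dvd_iff)
      also have "y mod int q = y" using y by simp
      finally show "(if x mod int q = y then of_real (w x) else 0) = of_real (w x) * (\<Sum>d | d dvd q. ramanujan d (x - y)) / of_nat q"
        using q by (simp add: sum_divisors_ramanujan)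
    qed
    also have "\<dots> = (\<Sum>d | d dvd q. \<Sum>x\<in>A. of_real (w x) * ramanujan d (x - y)) / of_nat q"
      by (subst sum.swap) (simp add: sum_distrib_left sum_divide_distrib)
    also have "\<dots> = ((\<Sum>x\<in>A. of_real (w x)) + (\<Sum>d\<in>Ds. \<Sum>x\<in>A. of_real (w x) * ramanujan d (x - y))) / of_nat q"
      using Ds by simp
    also have "(\<Sum>x\<in>A. of_real (w x)) = complex_of_real 1"
      unfolding of_real_sum[symmetric] using fin by (simp add: A_def w_def sum_pmf_eq_1)
    finally have "complex_of_real (pmf (mod_pmf (step_law a \<mu> n) q) y - pmf (unif_mod q) y)
        = (\<Sum>d\<in>Ds. \<Sum>x\<in>A. of_real (w x) * ramanujan d (x - y)) / of_nat q"
      using q y by (simp add: pmf_unif_mod add_divide_distrib)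
    hence "norm (complex_of_real (pmf (mod_pmf (step_law a \<mu> n) q) y - pmf (unif_mod q) y))
        = norm (\<Sum>d\<in>Ds. \<Sum>x\<in>A. of_real (w x) * ramanujan d (x - y)) / real q"
      by (simp only: norm_divide norm_of_nat)
    also have "\<dots> \<le> (\<Sum>d\<in>Ds. G d y) / real q"
      unfolding G_def by (intro divide_right_mono norm_sum) auto
    finally show ?thesis by (simp only: norm_of_real)
  qed
  have "unif_dist a \<mu> n q \<le> (\<Sum>y\<in>{0..<int q}. (\<Sum>d\<in>Ds. G d y) / real q)"
    unfolding unif_dist_def l1_norm_mod_def using pt by (intro sum_mono) auto
  also have "\<dots> = (\<Sum>d\<in>Ds. (\<Sum>y\<in>{0..<int q}. G d y) / real q)"
    by (simp only: sum_divide_distrib sum.swap[of _ Ds])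
  also have "\<dots> = (\<Sum>d\<in>Ds. prim_norm w A d)"
  proof (intro sum.cong refl)
    fix d assume "d \<in> Ds"
    then obtain m where m: "q = m * d" "d > 0" by (auto simp: Ds_def mult.commute)
    have "(\<Sum>y\<in>{0..<int q}. G d y) = (\<Sum>y\<in>{0..<int m * int d}. G d y)" by (simp add: m)
    also have "\<dots> = of_int (int m) * (\<Sum>y\<in>{0..<int d}. G d y)"
    proof (rule sum_periodic_mult)
      fix y
      have "ramanujan d (x - y mod int d) = ramanujan d (x - y)" for x
        using ramanujan_mod[OF m(2), of "x - y mod int d"] ramanujan_mod[OF m(2), of "x - y"]
        by (simp add: mod_diff_right_eq)
      thus "G d (y mod int d) = G d y" by (simp add: G_def)
    qed (use m in auto)
    finally show "(\<Sum>y\<in>{0..<int q}. G d y) / real q = prim_norm w A d"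
      using m q by (simp add: prim_norm_def G_def)
  qed
  finally show ?thesis by (simp add: w_def A_def Ds_def)
qed

lemma sum_pmf_map:
  fixes F :: "'b \<Rightarrow> complex"
  assumes fin: "finite (set_pmf p)"
  shows "(\<Sum>y\<in>set_pmf (map_pmf f p). of_real (pmf (map_pmf f p) y) * F y) = (\<Sum>x\<in>set_pmf p. of_real (pmf p x) * F (f x))"
proof -
  have "(\<Sum>y\<in>set_pmf (map_pmf f p). of_real (pmf (map_pmf f p) y) * F y)
      = (\<Sum>y\<in>f ` set_pmf p. \<Sum>x | x \<in> set_pmf p \<and> f x = y. of_real (pmf p x) * F (f x))"
    by (simp add: pmf_map_sum[OF fin] sum_distrib_right)
  also have "\<dots> = (\<Sum>x\<in>set_pmf p. of_real (pmf p x) * F (f x))"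
    using fin by (intro sum.group) auto
  finally show ?thesis .
qed

context affine_walk
begin

definition law_prim_norm :: "nat \<Rightarrow> nat \<Rightarrow> real" where
  "law_prim_norm n d = prim_norm (pmf (law n)) (set_pmf (law n)) d"

lemma law_prim_norm_nonneg: "law_prim_norm n d \<ge> 0"
  unfolding law_prim_norm_def by (rule prim_norm_nonneg)

lemma sum_law_add:
  fixes F :: "int \<Rightarrow> complex"
  shows "(\<Sum>z\<in>set_pmf (law (m + n)). of_real (pmf (law (m + n)) z) * F z)
    = (\<Sum>y\<in>set_pmf (law n). of_real (pmf (law n) y) * (\<Sum>x\<in>set_pmf (law m). of_real (pmf (law m) x) * F (x + a ^ m * y)))"
proof -
  have "(\<Sum>z\<in>set_pmf (law (m + n)). of_real (pmf (law (m + n)) z) * F z)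
     = (\<Sum>w\<in>set_pmf (pair_pmf (law m) (law n)). of_real (pmf (pair_pmf (law m) (law n)) w) * F (case w of (x, y) \<Rightarrow> x + a ^ m * y))"
    unfolding law_add by (rule sum_pmf_map) simp
  also have "\<dots> = (\<Sum>x\<in>set_pmf (law m). \<Sum>y\<in>set_pmf (law n). of_real (pmf (law m) x) * of_real (pmf (law n) y) * F (x + a ^ m * y))"
    by (simp add: sum.cartesian_product' pmf_pair)
  also have "\<dots> = (\<Sum>y\<in>set_pmf (law n). of_real (pmf (law n) y) * (\<Sum>x\<in>set_pmf (law m). of_real (pmf (law m) x) * F (x + a ^ m * y)))"
    by (subst sum.swap) (simp add: sum_distrib_left mult_ac)
  finally show ?thesis .
qed

text \<open>Later digits are added to \<open>X\<^sub>m\<close>, so the primitive part at time \<open>m + n\<close> is an average of translates of the one at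
  time \<open>m\<close>. Adding new digits at the top, instead of multiplying the old ones by \<open>a\<close>, makes this valid even
  when \<open>d\<close> and \<open>a\<close> have common factors.\<close>

lemma law_prim_norm_antimono:
  assumes d: "d > 0"
  shows "law_prim_norm (m + n) d \<le> law_prim_norm m d"
proof -
  define g where "g = (\<lambda>y. norm (\<Sum>x\<in>set_pmf (law m). of_real (pmf (law m) x) * ramanujan d (x - y)))"
  have per: "g (y mod int d) = g y" for y
  proof -
    have "ramanujan d (x - y mod int d) = ramanujan d (x - y)" for x
      using ramanujan_mod[OF d, of "x - y mod int d"] ramanujan_mod[OF d, of "x - y"]
      by (simp add: mod_diff_right_eq)
    thus ?thesis by (simp add: g_def)
  qed
  have "(\<Sum>y\<in>{0..<int d}. norm (\<Sum>z\<in>set_pmf (law (m + n)). of_real (pmf (law (m + n)) z) * ramanujan d (z - y)))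
     \<le> (\<Sum>y\<in>{0..<int d}. \<Sum>v\<in>set_pmf (law n). pmf (law n) v * g (y + - (a ^ m * v)))"
  proof (intro sum_mono)
    fix y
    have "norm (\<Sum>z\<in>set_pmf (law (m + n)). of_real (pmf (law (m + n)) z) * ramanujan d (z - y))
       \<le> (\<Sum>v\<in>set_pmf (law n). norm (of_real (pmf (law n) v) * (\<Sum>x\<in>set_pmf (law m). of_real (pmf (law m) x) * ramanujan d (x + a ^ m * v - y))))"
      by (subst sum_law_add) (rule norm_sum)
    also have "\<dots> = (\<Sum>v\<in>set_pmf (law n). pmf (law n) v * g (y + - (a ^ m * v)))"
      by (simp add: g_def norm_mult algebra_simps)
    finally show "norm (\<Sum>z\<in>set_pmf (law (m + n)). of_real (pmf (law (m + n)) z) * ramanujan d (z - y))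
       \<le> (\<Sum>v\<in>set_pmf (law n). pmf (law n) v * g (y + - (a ^ m * v)))" .
  qed
  also have "\<dots> = (\<Sum>v\<in>set_pmf (law n). pmf (law n) v * (\<Sum>y\<in>{0..<int d}. g (y + - (a ^ m * v))))"
    by (subst sum.swap) (simp add: sum_distrib_left)
  also have "\<dots> = (\<Sum>v\<in>set_pmf (law n). pmf (law n) v * (\<Sum>y\<in>{0..<int d}. g y))"
    using d per by (intro sum.cong refl arg_cong2[where f = "(*)"] sum_periodic_shift) auto
  also have "\<dots> = (\<Sum>y\<in>{0..<int d}. g y)"
    by (simp add: sum_distrib_right[symmetric] sum_pmf_eq_1)
  finally show ?thesis unfolding law_prim_norm_def prim_norm_def g_def by (intro divide_right_mono) auto
qed

lemma unif_dist_le_sum_law_prim_norm: "q > 0 \<Longrightarrow> unif_dist a \<mu> n q \<le> (\<Sum>d | d dvd q \<and> d > 1. law_prim_norm n d)"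
  unfolding law_prim_norm_def by (rule unif_dist_le_sum_prim_norm) auto

definition ft_law :: "nat \<Rightarrow> real \<Rightarrow> complex" where
  "ft_law n \<theta> = ft (pmf (law n)) (set_pmf (law n)) \<theta>"

lemma ft_law_Suc: "ft_law (Suc n) \<theta> = ft_law 1 \<theta> * ft_law n (of_int a * \<theta>)"
proof -
  have "ft_law (1 + n) \<theta> = (\<Sum>y\<in>set_pmf (law n). of_real (pmf (law n) y) * (\<Sum>x\<in>set_pmf (law 1). of_real (pmf (law 1) x) * e (of_int (x + a ^ 1 * y) * \<theta>)))"
    unfolding ft_law_def ft_def by (rule sum_law_add)
  also have "\<dots> = ft_law 1 \<theta> * ft_law n (of_int a * \<theta>)"
  proof -
    have split: "e (of_int (x + a ^ 1 * y) * \<theta>) = e (of_int x * \<theta>) * e (of_int y * (of_int a * \<theta>))" for x y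
      by (simp add: e_add[symmetric] algebra_simps)
    show ?thesis
      unfolding ft_law_def ft_def split sum_product
      unfolding sum_distrib_left
      by (subst sum.swap) (simp only: mult_ac)
  qed
  finally show ?thesis by simp
qed

text \<open>If the transform had modulus 1, all phases \<open>e(xc/d)\<close> with \<open>x\<close> in the support would coincide. Then \<open>d\<close> divides
  \<open>c(x - y)\<close> for all support points, and therefore divides \<open>c\<close> by the gcd hypothesis.\<close>

lemma norm_ft_law_1_less:
  assumes d: "d > 0" and c: "\<not> int d dvd c"
  shows "norm (ft_law 1 (of_int c / real d)) < 1"
proof (rule ccontr)
  define \<theta> where "\<theta> = of_int c / real d"
  define z where "z = ft_law 1 \<theta>"
  have law1: "law 1 = \<mu>" using law_1 by simp
  have z_eq: "z = (\<Sum>x\<in>set_pmf \<mu>. of_real (pmf \<mu> x) * e (of_int x * \<theta>))"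
    unfolding z_def ft_law_def ft_def law1 by simp
  assume "\<not> ?thesis"
  hence z1: "norm z \<ge> 1" by (simp add: z_def \<theta>_def)
  \<comment> \<open>Rotating by \<open>u\<close> makes the average of the phases real and equal to its modulus, so a modulus of 1 forces every
  rotated phase to be 1.\<close>
  define u where "u = cnj z / of_real (norm z)"
  have z0: "z \<noteq> 0" by (metis norm_zero not_one_le_zero z1)
  have nu: "norm u = 1" using z0 by (simp add: u_def norm_divide)
  have "Re (u * z) = norm z"
  proof -
    have "u * z = (z * cnj z) / of_real (norm z)" by (simp add: u_def)
    also have "\<dots> = of_real ((norm z)\<^sup>2 / norm z)" by (simp only: complex_norm_square of_real_divide)
    also have "(norm z)\<^sup>2 / norm z = norm z" using z0 by (simp add: power2_eq_square)
    finally have "u * z = of_real (norm z)" .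
    thus ?thesis by simp
  qed
  moreover have "Re (u * z) = (\<Sum>x\<in>set_pmf \<mu>. pmf \<mu> x * Re (u * e (of_int x * \<theta>)))"
    unfolding z_eq sum_distrib_left by (simp add: Re_sum mult.left_commute[of u])
  ultimately have "(\<Sum>x\<in>set_pmf \<mu>. pmf \<mu> x * (1 - Re (u * e (of_int x * \<theta>)))) \<le> 0"
    using z1 finite_supp by (simp add: right_diff_distrib sum_subtractf sum_pmf_eq_1)
  moreover have nonneg: "pmf \<mu> x * (1 - Re (u * e (of_int x * \<theta>))) \<ge> 0" for x
    using complex_Re_le_cmod[of "u * e (of_int x * \<theta>)"] nu by (simp add: norm_mult)
  ultimately have sum0: "(\<Sum>x\<in>set_pmf \<mu>. pmf \<mu> x * (1 - Re (u * e (of_int x * \<theta>)))) = 0"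
    by (intro antisym sum_nonneg) auto
  have zero: "pmf \<mu> x * (1 - Re (u * e (of_int x * \<theta>))) = 0" if "x \<in> set_pmf \<mu>" for x
    by (rule sum_nonneg_0[OF finite_supp _ sum0 that]) (rule nonneg)
  have one: "u * e (of_int x * \<theta>) = 1" if "x \<in> set_pmf \<mu>" for x
  proof -
    have re: "Re (u * e (of_int x * \<theta>)) = 1" using zero[OF that] that by (simp add: set_pmf_iff)
    moreover have "norm (u * e (of_int x * \<theta>)) = 1" using nu by (simp add: norm_mult)
    ultimately have "Im (u * e (of_int x * \<theta>)) = 0"
      using cmod_power2[of "u * e (of_int x * \<theta>)"] by simp
    with re show ?thesis by (simp add: complex_eq_iff)
  qed
  have dvd: "int d dvd c * (x - y)" if "x \<in> set_pmf \<mu>" "y \<in> set_pmf \<mu>" for x y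
  proof -
    have "u \<noteq> 0" using nu by auto
    hence "e (of_int x * \<theta>) = e (of_int y * \<theta>)" using one[OF that(1)] one[OF that(2)] by (metis mult_cancel_left)
    hence "e (of_int (x - y) * \<theta>) = 1"
      using e_add[of "of_int (x - y) * \<theta>" "of_int y * \<theta>"] norm_e[of "of_int y * \<theta>"]
      by (auto simp: algebra_simps simp del: norm_e)
    then obtain k where "of_int (x - y) * \<theta> = of_int k" unfolding e_eq_1_iff by (elim Ints_cases)
    hence "real_of_int (c * (x - y)) = of_int (int d * k)" using d by (simp add: \<theta>_def field_simps)
    thus ?thesis by (simp only: of_int_eq_iff) simp
  qed
  have "int d dvd Gcd ((*) c ` {x - y | x y. x \<in> set_pmf \<mu> \<and> y \<in> set_pmf \<mu>})"
    by (intro Gcd_greatest) (use dvd in auto)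
  hence "int d dvd c" by (simp add: Gcd_mult Gcd_diff)
  with c show False by simp
qed

text \<open>The transform of \<open>X\<^sub>n\<close> at \<open>c/d\<close> is the product of the one-step transforms at \<open>a\<^sup>i c/d\<close>. As \<open>a\<close> is coprime to
  \<open>d\<close>, none of these fractions is an integer, so every factor is at most a fixed \<open>\<kappa> < 1\<close>.\<close>

lemma law_prim_norm_tendsto_0:
  assumes d: "d > 1" "coprime (int d) a"
  shows "(\<lambda>n. law_prim_norm n d) \<longlonglongrightarrow> 0"
proof -
  define S where "S = (\<lambda>r. norm (ft_law 1 (real r / real d))) ` {1..<d}"
  define \<kappa> where "\<kappa> = Max S"
  have S: "finite S" "S \<noteq> {}" using d by (auto simp: S_def)
  have "\<kappa> \<in> S" unfolding \<kappa>_def using S by (rule Max_in)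
  then obtain r0 where r0: "\<kappa> = norm (ft_law 1 (of_int (int r0) / real d))" "r0 \<in> {1..<d}" by (auto simp: S_def)
  have \<kappa>: "0 \<le> \<kappa>" "\<kappa> < 1"
    unfolding r0(1) using norm_ft_law_1_less[of d "int r0"] r0(2) d nat_dvd_not_less[of r0 d] by auto
  have ft1: "norm (ft_law 1 (of_int c / real d)) \<le> \<kappa>" if c: "\<not> int d dvd c" for c
  proof -
    define r where "r = nat (c mod int d)"
    have r: "int r = c mod int d" using d by (simp add: r_def)
    have "c mod int d \<noteq> 0" using c by (simp add: dvd_eq_mod_eq_0)
    hence "r \<noteq> 0" using r by auto
    moreover have "r < d" using r d by (metis of_nat_less_iff pos_mod_bound of_nat_0_less_iff less_trans zero_less_one)
    ultimately have "r \<in> {1..<d}" by auto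
    define k where "k = c div int d"
    have "c = int r + int d * k" by (simp add: r k_def)
    hence "real_of_int c = real r + real d * of_int k" by simp
    hence c_eq: "of_int c / real d = real r / real d + of_int k" using d by (simp add: field_simps)
    have "ft_law 1 (of_int c / real d) = ft_law 1 (real r / real d)"
      unfolding ft_law_def ft_def c_eq
    proof (intro sum.cong refl arg_cong2[where f = "(*)"])
      fix x
      show "e (of_int x * (real r / real d + of_int k)) = e (of_int x * (real r / real d))"
        using e_add_int[of "of_int x * (real r / real d)" "x * k"] by (simp add: distrib_left)
    qed
    moreover have "norm (ft_law 1 (real r / real d)) \<in> S" unfolding S_def using \<open>r \<in> {1..<d}\<close> by (rule imageI)
    ultimately show ?thesis unfolding \<kappa>_def using S by simp
  qed
  have ftn: "norm (ft_law n (of_int c / real d)) \<le> \<kappa> ^ n" if c: "coprime (int d) c" for n c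
    using c
  proof (induction n arbitrary: c)
    case 0
    show ?case by (simp add: ft_law_def ft_def)
  next
    case (Suc n)
    have "\<not> int d dvd c" using Suc.prems d
      using coprime_absorb_left[of "int d" c] by (auto simp: zdvd1_eq)
    hence A: "norm (ft_law 1 (of_int c / real d)) \<le> \<kappa>" by (rule ft1)
    have "coprime (int d) (a * c)" using Suc.prems d by simp
    hence B: "norm (ft_law n (of_int (a * c) / real d)) \<le> \<kappa> ^ n" by (rule Suc.IH)
    have "norm (ft_law 1 (of_int c / real d)) * norm (ft_law n (of_int (a * c) / real d)) \<le> \<kappa> * \<kappa> ^ n"
      by (rule mult_mono[OF A B \<kappa>(1)]) simp
    thus ?case unfolding ft_law_Suc by (simp add: norm_mult)
  qed
  have "law_prim_norm n d \<le> real d * \<kappa> ^ n" for n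
  proof -
    have "(\<Sum>b\<in>coprime_residues d. (norm (ft_law n (real b / real d)))\<^sup>2) \<le> (\<Sum>b\<in>coprime_residues d. (\<kappa> ^ n)\<^sup>2)"
    proof (intro sum_mono power_mono)
      fix b assume "b \<in> coprime_residues d"
      hence "coprime (int d) (int b)" by (simp add: coprime_residues_def coprime_commute)
      thus "norm (ft_law n (real b / real d)) \<le> \<kappa> ^ n" using ftn[of "int b" n] by simp
    qed auto
    also have "\<dots> = real (card (coprime_residues d)) * (\<kappa> ^ n)\<^sup>2" by simp
    also have "\<dots> \<le> (real d)\<^sup>2 * (\<kappa> ^ n)\<^sup>2"
    proof (intro mult_right_mono)
      have "card (coprime_residues d) \<le> d"
        using card_mono[of "{..<d}" "coprime_residues d"] by (auto simp: coprime_residues_def)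
      also have "d \<le> d\<^sup>2" by (simp add: power2_eq_square)
      finally show "real (card (coprime_residues d)) \<le> (real d)\<^sup>2" by (simp flip: of_nat_power)
    qed auto
    finally have "sqrt (\<Sum>b\<in>coprime_residues d. (norm (ft_law n (real b / real d)))\<^sup>2) \<le> real d * \<kappa> ^ n"
      using \<kappa> by (intro real_le_lsqrt) (auto simp: power_mult_distrib)
    thus ?thesis
      using prim_norm_le_sqrt[of d "pmf (law n)" "set_pmf (law n)"] d by (simp add: law_prim_norm_def ft_law_def)
  qed
  moreover have "(\<lambda>n. real d * \<kappa> ^ n) \<longlonglongrightarrow> real d * 0"
    using \<kappa> by (intro tendsto_intros LIMSEQ_power_zero) auto
  ultimately show ?thesis
    by (intro tendsto_sandwich[of "\<lambda>_. 0" "\<lambda>n. law_prim_norm n d" sequentially "\<lambda>n. real d * \<kappa> ^ n" 0] always_eventually)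
       (auto simp: law_prim_norm_nonneg)
qed

end

section \<open>The averaged bound for primitive parts\<close>

context affine_walk
begin

text \<open>The time \<open>m\<close> is chosen with \<open>D \<approx> exp(hm)\<close> for \<open>h = (1 - \<theta>)H\<close>; the hypothesis on \<open>D\<close> says precisely that
  \<open>m \<le> n\<close>, so by monotonicity one may work at time \<open>m\<close>. The law is cut at the level
  \<open>\<kappa> = exp(-(H - \<epsilon>)m)\<close>. The large sieve treats the atoms below this level, and the exponentially small mass
  above it beats the factor \<open>2\<^sup>\<omega>\<^sup>(\<^sup>d\<^sup>)\<close>.\<close>

lemma sum_law_prim_norm_le:
  assumes "\<delta> > 0" and H: "H > 1 / 2 * ln (real_of_int a)"
  obtains c C where "0 < c" "c < 1" "C > 0"
    "\<And>n D. D \<ge> 1 \<Longrightarrow> real D \<le> exp ((1 - \<delta>) * H * real n) \<Longrightarrow>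
       (\<Sum>d\<in>{2..D}. law_prim_norm n d) \<le> C * real D powr (1 - c)"
proof -
  define \<gamma> where "\<gamma> = 2 * H - ln (real_of_int a)"
  have \<gamma>: "\<gamma> > 0" using H by (simp add: \<gamma>_def)
  \<comment> \<open>Shrinking \<open>\<delta>\<close> only weakens the hypothesis on \<open>D\<close>. The last bound gives \<open>2\<theta>H \<le> 2H - ln a\<close>, which is
  what the term with \<open>a\<^sup>m\<close> in the large sieve requires.\<close>
  define \<theta> where "\<theta> = min \<delta> (min (1 / 2) (\<gamma> / (2 * H)))"
  have \<theta>: "\<theta> > 0" "\<theta> \<le> \<delta>" "\<theta> \<le> 1 / 2" using assms \<gamma> H_pos by (auto simp: \<theta>_def)
  have "\<theta> \<le> \<gamma> / (2 * H)" by (simp add: \<theta>_def)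
  hence \<theta>H: "2 * (\<theta> * H) \<le> \<gamma>" using H_pos by (simp add: field_simps)
  define h where "h = (1 - \<theta>) * H"
  have h: "h > 0" using \<theta> H_pos by (simp add: h_def)
  define \<epsilon> where "\<epsilon> = \<theta> * H / 2"
  have "\<theta> * H \<le> 1 / 2 * H" using \<theta> H_pos by (intro mult_right_mono) auto
  hence \<epsilon>: "\<epsilon> > 0" "\<epsilon> < H" using \<theta> H_pos by (auto simp: \<epsilon>_def)
  have \<epsilon>2: "\<epsilon> / 2 > 0" "\<epsilon> / 2 < H" using \<epsilon> by auto
  obtain s C1 where s: "s > 0" "\<And>m. power_sum s (law m) \<le> C1 * exp (- s * (H - \<epsilon> / 2) * real m)"
    using power_sum_law_le[OF \<epsilon>2] by blast
  have C1: "C1 > 0" using s(2)[of 0] power_sum_pos[of "law 0" s] by simp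
  define \<beta> where "\<beta> = \<epsilon> / (2 * h)"
  have \<beta>: "\<beta> > 0" using \<epsilon> h by (simp add: \<beta>_def)
  have s\<beta>: "s * \<beta> / 2 > 0" using s(1) \<beta> by simp
  obtain C2 where C2: "C2 > 0" "\<And>d. d > 0 \<Longrightarrow> 2 ^ card (prime_factors d) \<le> C2 * real d powr (s * \<beta> / 2)"
    using two_power_omega_le[OF s\<beta>] by blast
  define C3 where "C3 = 4 * (4 * of_int step_bound * exp h + 1)"
  have C3: "C3 \<ge> 0" using step_bound_nonneg by (simp add: C3_def)
  define c where "c = min (1 / 2) (min \<beta> (s * \<beta> / 2))"
  have c: "0 < c" "c < 1" "c \<le> \<beta>" "c \<le> s * \<beta> / 2" using s\<beta> \<beta> by (auto simp: c_def)
  show ?thesis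
  proof (rule that[of c "sqrt C3 + C2 * C1"])
    fix n D :: nat assume D: "D \<ge> 1" "real D \<le> exp ((1 - \<delta>) * H * real n)"
    define m where "m = nat \<lceil>ln (real D) / h\<rceil>"
    have "ln (real D) / h \<ge> 0" using D(1) h by (intro divide_nonneg_pos ln_ge_zero) auto
    hence m1: "ln (real D) / h \<le> real m" "real m < ln (real D) / h + 1"
      unfolding m_def by linarith+
    hence m2: "ln (real D) \<le> h * real m" "h * real m \<le> ln (real D) + h" using h by (auto simp: field_simps)
    have mn: "m \<le> n"
    proof -
      have "ln (real D) \<le> ln (exp ((1 - \<delta>) * H * real n))" using D by (intro ln_mono) auto
      hence "ln (real D) \<le> (1 - \<delta>) * H * real n" by (simp only: ln_exp)
      also have "\<dots> \<le> h * real n" unfolding h_def using \<theta> H_pos by (intro mult_right_mono) auto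
      finally have "ln (real D) / h \<le> real n" using h by (simp add: field_simps)
      thus ?thesis by (simp add: m_def nat_le_iff ceiling_le_iff)
    qed
    have Dm: "real D \<le> exp (h * real m)" "exp (h * real m) \<le> exp h * real D"
    proof -
      have "real D = exp (ln (real D))" using D by simp
      also have "\<dots> \<le> exp (h * real m)" using m2 by simp
      finally show "real D \<le> exp (h * real m)" .
      have "exp (h * real m) \<le> exp (ln (real D) + h)" using m2 by simp
      also have "\<dots> = exp h * real D" using D by (simp add: exp_add)
      finally show "exp (h * real m) \<le> exp h * real D" .
    qed
    \<comment> \<open>Exponential decay in \<open>m\<close> is power decay in \<open>D\<close>.\<close>
    have decay: "exp (- (\<epsilon> / 2) * r * real m) \<le> real D powr (- (r * \<beta>))" if "r > 0" for r
    proof -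
      have "r * \<beta> * ln (real D) \<le> r * \<beta> * (h * real m)" using m2 \<beta> that by (intro mult_left_mono) auto
      also have "\<dots> = \<epsilon> / 2 * r * real m" using h by (simp add: \<beta>_def)
      finally show ?thesis using D by (simp add: powr_def)
    qed
    define \<kappa> where "\<kappa> = exp (- (H - \<epsilon>) * real m)"
    define w where "w = pmf (law m)"
    define A1 where "A1 = {x \<in> set_pmf (law m). w x \<le> \<kappa>}"
    define A2 where "A2 = {x. x \<in> set_pmf (law m) \<and> w x > \<kappa>}"
    have A: "finite A1" "finite A2" "A1 \<inter> A2 = {}" "set_pmf (law m) = A1 \<union> A2"
      by (auto simp: A1_def A2_def)
    define L where "L = nat (step_bound * a ^ m)"
    have L: "int L = step_bound * a ^ m" using step_bound_nonneg a_gt_1 by (simp add: L_def)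
    have A1L: "A1 \<subseteq> {- int L..int L}"
    proof
      fix x assume "x \<in> A1"
      hence "\<bar>x\<bar> \<le> step_bound * a ^ m" by (intro abs_law_le) (simp add: A1_def)
      thus "x \<in> {- int L..int L}" unfolding L by auto
    qed
    have "(\<Sum>x\<in>A1. (w x)\<^sup>2) \<le> (\<Sum>x\<in>A1. \<kappa> * w x)"
      unfolding power2_eq_square by (intro sum_mono mult_right_mono) (auto simp: A1_def w_def)
    also have "\<dots> = \<kappa> * measure (law m) A1" using A by (simp add: w_def measure_measure_pmf_finite sum_distrib_left)
    also have "\<dots> \<le> \<kappa> * 1" by (intro mult_left_mono) (auto simp: \<kappa>_def)
    finally have w2: "(\<Sum>x\<in>A1. (w x)\<^sup>2) \<le> \<kappa>" by simp

    define S where "S = (\<lambda>d. \<Sum>b\<in>coprime_residues d. (norm (ft w A1 (real b / real d)))\<^sup>2)"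
    have S0: "S d \<ge> 0" for d unfolding S_def by (intro sum_nonneg) auto
    have "(\<Sum>d\<in>{1..D}. S d) \<le> 4 * real (4 * L + D\<^sup>2) * (\<Sum>x\<in>A1. (w x)\<^sup>2)"
      unfolding S_def using D A1L by (intro large_sieve_farey) auto
    also have "\<dots> \<le> 4 * real (4 * L + D\<^sup>2) * \<kappa>" using w2 by (intro mult_left_mono) auto
    also have "\<dots> = 4 * (4 * (real L * \<kappa>) + (real D)\<^sup>2 * \<kappa>)" by (simp add: algebra_simps)
    also have "real L * \<kappa> \<le> of_int step_bound * exp h * (real D * exp (- \<epsilon> * real m))"
    proof -
      have "real L = real_of_int (int L)" by simp
      also have "\<dots> = of_int step_bound * of_int a ^ m" unfolding L by simp
      also have "real_of_int a ^ m = exp (ln (real_of_int a) * real m)"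
        using a_gt_1 by (simp add: exp_of_nat2_mult)
      finally have "real L * \<kappa> = of_int step_bound * exp ((ln (real_of_int a) - (H - \<epsilon>)) * real m)"
        by (simp add: \<kappa>_def algebra_simps flip: exp_add)
      \<comment> \<open>This is what the choice of \<open>\<theta>\<close> against \<open>2H - ln a\<close> is for.\<close>
      also have "(ln (real_of_int a) - (H - \<epsilon>)) * real m \<le> (h - \<epsilon>) * real m"
        using \<theta>H by (intro mult_right_mono) (auto simp: \<gamma>_def h_def \<epsilon>_def algebra_simps)
      also have "exp ((h - \<epsilon>) * real m) = exp (h * real m) * exp (- \<epsilon> * real m)"
        by (simp add: algebra_simps flip: exp_add)
      also have "exp (h * real m) \<le> exp h * real D" by (rule Dm)
      finally show ?thesis using step_bound_nonneg by (simp add: mult_left_mono mult_right_mono mult.assoc)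
    qed
    also have "(real D)\<^sup>2 * \<kappa> \<le> real D * exp (- \<epsilon> * real m)"
    proof -
      have "(real D)\<^sup>2 * \<kappa> \<le> real D * exp (h * real m) * \<kappa>"
        using Dm by (auto simp: power2_eq_square \<kappa>_def intro!: mult_right_mono mult_left_mono)
      also have "\<dots> = real D * exp (- \<epsilon> * real m)"
        by (simp add: \<kappa>_def h_def \<epsilon>_def algebra_simps flip: exp_add)
      finally show ?thesis .
    qed
    finally have sumS: "(\<Sum>d\<in>{1..D}. S d) \<le> C3 * (real D * exp (- \<epsilon> * real m))"
      by (simp add: C3_def algebra_simps)

    have "(\<Sum>d\<in>{1..D}. sqrt (S d) * 1)\<^sup>2 \<le> (\<Sum>d\<in>{1..D}. (sqrt (S d))\<^sup>2) * (\<Sum>d\<in>{1..D}. 1\<^sup>2)"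
      by (rule Cauchy_Schwarz_ineq_sum)
    also have "\<dots> = (\<Sum>d\<in>{1..D}. S d) * real D" using S0 by simp
    also have "\<dots> \<le> C3 * (real D * exp (- \<epsilon> * real m)) * real D" using sumS by (intro mult_right_mono) auto
    also have "\<dots> = (sqrt C3 * (real D * exp (- (\<epsilon> / 2) * 1 * real m)))\<^sup>2"
      using C3 by (simp add: power_mult_distrib power2_eq_square mult_ac flip: exp_add)
    finally have "(\<Sum>d\<in>{1..D}. sqrt (S d)) \<le> sqrt C3 * (real D * exp (- (\<epsilon> / 2) * 1 * real m))"
      using C3 by (intro power2_le_imp_le[of "\<Sum>d\<in>{1..D}. sqrt (S d)"]) auto
    also have "\<dots> \<le> sqrt C3 * (real D * real D powr (- (1 * \<beta>)))"
      using C3 by (intro mult_left_mono decay) auto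
    also have "real D * real D powr (- (1 * \<beta>)) = real D powr (1 - \<beta>)"
      using D(1) powr_add[of "real D" 1 "- (1 * \<beta>)"] by simp
    also have "sqrt C3 * real D powr (1 - \<beta>) \<le> sqrt C3 * real D powr (1 - c)"
      using C3 c D by (intro mult_left_mono powr_mono) auto
    finally have part1: "(\<Sum>d\<in>{1..D}. sqrt (S d)) \<le> sqrt C3 * real D powr (1 - c)" .

    define M where "M = (\<Sum>x\<in>A2. \<bar>w x\<bar>)"
    have "M = (\<Sum>x\<in>A2. w x)" by (simp add: M_def w_def)
    also have "\<dots> \<le> \<kappa> powr (- s) * power_sum s (law m)"
      unfolding A2_def w_def using s by (intro mass_large_atoms_le) (auto simp: \<kappa>_def)
    also have "\<dots> \<le> \<kappa> powr (- s) * (C1 * exp (- s * (H - \<epsilon> / 2) * real m))"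
      using s(2)[of m] by (intro mult_left_mono) auto
    also have "\<dots> = C1 * exp (- (\<epsilon> / 2) * s * real m)"
      by (simp add: \<kappa>_def powr_def algebra_simps flip: exp_add)
    also have "\<dots> \<le> C1 * real D powr (- (s * \<beta>))" using C1 s by (intro mult_left_mono decay) auto
    finally have M: "M \<le> C1 * real D powr (- (s * \<beta>))" .

    have "(\<Sum>d\<in>{2..D}. law_prim_norm n d) \<le> (\<Sum>d\<in>{2..D}. sqrt (S d) + C2 * C1 * real D powr (- (s * \<beta> / 2)))"
    proof (intro sum_mono)
      fix d assume "d \<in> {2..D}"
      hence d: "d > 0" "d \<le> D" by auto
      have "law_prim_norm n d \<le> law_prim_norm m d" using law_prim_norm_antimono[OF d(1), of m "n - m"] mn by simp
      also have "\<dots> = prim_norm w (A1 \<union> A2) d" by (simp add: law_prim_norm_def w_def A(4))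
      also have "\<dots> \<le> prim_norm w A1 d + prim_norm w A2 d" by (rule prim_norm_union_le[OF A(1-3)])
      also have "prim_norm w A1 d \<le> sqrt (S d)" unfolding S_def by (rule prim_norm_le_sqrt[OF d(1)])
      also have "prim_norm w A2 d \<le> 2 ^ card (prime_factors d) * M" unfolding M_def by (rule prim_norm_le_mass[OF d(1)])
      also have "\<dots> \<le> (C2 * real d powr (s * \<beta> / 2)) * (C1 * real D powr (- (s * \<beta>)))"
        using C2(1) C2(2)[OF d(1)] M by (intro mult_mono) (auto simp: M_def sum_nonneg)
      also have "\<dots> \<le> (C2 * real D powr (s * \<beta> / 2)) * (C1 * real D powr (- (s * \<beta>)))"
        using C1 C2(1) d s(1) \<beta> by (intro mult_right_mono mult_left_mono powr_mono2) auto
      also have "\<dots> = C2 * C1 * (real D powr (s * \<beta> / 2) * real D powr (- (s * \<beta>)))" by simp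
      also have "real D powr (s * \<beta> / 2) * real D powr (- (s * \<beta>)) = real D powr (- (s * \<beta> / 2))"
        unfolding powr_add[symmetric] by (rule arg_cong[where f = "(powr) (real D)"]) simp
      finally show "law_prim_norm n d \<le> sqrt (S d) + C2 * C1 * real D powr (- (s * \<beta> / 2))" by simp
    qed
    also have "\<dots> \<le> (\<Sum>d\<in>{1..D}. sqrt (S d) + C2 * C1 * real D powr (- (s * \<beta> / 2)))"
      using C1 C2(1) by (intro sum_mono2 add_nonneg_nonneg mult_nonneg_nonneg) (auto simp: S0)
    also have "\<dots> = (\<Sum>d\<in>{1..D}. sqrt (S d)) + C2 * C1 * (real D * real D powr (- (s * \<beta> / 2)))"
      by (simp add: sum.distrib)
    also have "real D * real D powr (- (s * \<beta> / 2)) = real D powr (1 - s * \<beta> / 2)"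
      using D(1) powr_add[of "real D" 1 "- (s * \<beta> / 2)"] by simp
    also have "C2 * C1 * real D powr (1 - s * \<beta> / 2) \<le> C2 * C1 * real D powr (1 - c)"
      using C1 C2(1) c D(1) by (intro mult_left_mono powr_mono) auto
    also note part1
    finally show "(\<Sum>d\<in>{2..D}. law_prim_norm n d) \<le> (sqrt C3 + C2 * C1) * real D powr (1 - c)"
      by (simp add: algebra_simps)
  next
    show "sqrt C3 + C2 * C1 > 0" using C1 C2(1) C3 by (intro add_nonneg_pos mult_pos_pos) auto
  qed (rule c(1) c(2))+
qed

end

section \<open>A lower bound for the number of primes\<close>

text \<open>The entries of Leibniz's harmonic triangle are the numbers \<open>1 / ((r + 1) binom(r, c))\<close>. Each entry is a
  difference of two entries of the preceding column, and the column \<open>c = 0\<close> consists of the unit fractions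
  \<open>1/(r + 1)\<close>, so a common multiple of \<open>1, ..., n\<close> clears all denominators in the first \<open>n\<close> rows.\<close>

lemma leibniz_triangle_integral:
  assumes M: "\<And>k. 1 \<le> k \<Longrightarrow> k \<le> n \<Longrightarrow> k dvd M"
  shows "r < n \<Longrightarrow> c \<le> r \<Longrightarrow> real M / (real (Suc r) * real (r choose c)) \<in> \<int>"
proof (induction c arbitrary: r)
  case 0
  then obtain k where "M = Suc r * k" using M[of "Suc r"] by auto
  hence "real M / (real (Suc r) * real (r choose 0)) = real k" by (simp del: of_nat_Suc mult_Suc mult_Suc_right)
  thus ?case by simp
next
  case (Suc c)
  then obtain k where k: "r = Suc k" "c \<le> k" by (cases r) auto
  define X where "X = real (k choose c)"
  have X: "X > 0" using k by (simp add: X_def zero_less_binomial_iff)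
  have "real (Suc c) * real (Suc k choose Suc c) = real (Suc k) * X"
    unfolding X_def by (metis Suc_times_binomial_eq of_nat_mult mult.commute)
  hence b1: "real (Suc k choose Suc c) = real (Suc k) * X / real (Suc c)" by (simp add: field_simps)
  have "(Suc k - c) * (Suc k choose c) = Suc k * (k choose c)"
    using binomial_absorb_comp[of "Suc k" c] by simp
  hence "real (Suc k - c) * real (Suc k choose c) = real (Suc k) * X" unfolding X_def by (metis of_nat_mult)
  hence b2: "real (Suc k choose c) = real (Suc k) * X / (real (Suc k) - real c)"
    using k by (simp add: field_simps of_nat_diff)
  have "real k - real c + 1 > 0" using k by linarith
  hence "1 / (real (Suc r) * real (r choose Suc c))
      = 1 / (real (Suc k) * real (k choose c)) - 1 / (real (Suc r) * real (r choose c))"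
    unfolding k b1 b2 X_def[symmetric] using X by (simp add: divide_simps)
  hence "real M / (real (Suc r) * real (r choose Suc c))
      = real M / (real (Suc k) * real (k choose c)) - real M / (real (Suc r) * real (r choose c))"
    by (metis (no_types, lifting) mult.right_neutral right_diff_distrib times_divide_eq_right)
  moreover have "real M / (real (Suc k) * real (k choose c)) \<in> \<int>" using Suc.prems k by (intro Suc.IH) auto
  moreover have "real M / (real (Suc r) * real (r choose c)) \<in> \<int>" using Suc.prems by (intro Suc.IH) auto
  ultimately show ?case by simp
qed

text \<open>By the preceding lemma \<open>n binom(n - 1, c)\<close> is at most \<open>M\<close> for every \<open>c\<close>; sum over \<open>c\<close>.\<close>

lemma two_power_le_common_multiple:
  assumes M: "\<And>k. 1 \<le> k \<Longrightarrow> k \<le> n \<Longrightarrow> k dvd M" and n: "n \<ge> 1" and M0: "M > 0"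
  shows "2 ^ (n - 1) \<le> real M"
proof -
  have "real (n - 1 choose c) \<le> real M / real n" if c: "c \<in> {..n - 1}" for c
  proof -
    have "real M / (real (Suc (n - 1)) * real (n - 1 choose c)) \<in> \<int>"
      using c n by (intro leibniz_triangle_integral[OF M]) auto
    then obtain k where k: "real M / (real n * real (n - 1 choose c)) = of_int k"
      using n by (auto elim: Ints_cases)
    have pos: "real n * real (n - 1 choose c) > 0" using n c by (simp add: zero_less_binomial_iff)
    hence "of_int k > (0::real)" unfolding k[symmetric] using M0 by (intro divide_pos_pos) auto
    hence "of_int k \<ge> (1::real)" by simp
    hence "real n * real (n - 1 choose c) \<le> real M" unfolding k[symmetric] using pos by (simp add: field_simps)
    thus ?thesis using n by (simp add: field_simps)
  qed
  hence "(\<Sum>c\<le>n - 1. real (n - 1 choose c)) \<le> (\<Sum>c\<le>n - 1. real M / real n)" by (intro sum_mono) auto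
  also have "\<dots> = real M" using n by simp
  finally have "real (\<Sum>c\<le>n - 1. n - 1 choose c) \<le> real M" by simp
  thus ?thesis by (simp only: choose_row_sum) simp
qed

text \<open>Chebyshev's lower bound: the product over \<open>p \<le> n\<close> of the largest power of \<open>p\<close> not exceeding \<open>n\<close> is a common
  multiple of \<open>1, ..., n\<close>, and each factor is at most \<open>n\<close>.\<close>

lemma prime_count_lower_bound:
  assumes n: "n \<ge> 2"
  shows "real (n - 1) * ln 2 \<le> real (card {p. prime p \<and> p \<le> n}) * ln (real n)"
proof -
  define S where "S = {p::nat. prime p \<and> p \<le> n}"
  have S: "finite S" by (simp add: S_def)
  define L where "L = (\<lambda>p. Max {k. p ^ k \<le> n})"
  have fin: "finite {k. p ^ k \<le> n}" if "prime p" for p :: nat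
  proof (rule finite_subset)
    show "{k. p ^ k \<le> n} \<subseteq> {..n}"
    proof
      fix k assume "k \<in> {k. p ^ k \<le> n}"
      moreover have "k < p ^ k" using prime_gt_1_nat[OF that] by (simp add: power_gt_expt)
      ultimately show "k \<in> {..n}" by simp
    qed
  qed auto
  have pL: "p ^ L p \<le> n" if "prime p" for p
  proof -
    have "L p \<in> {k. p ^ k \<le> n}" unfolding L_def using fin[OF that] n by (intro Max_in) (auto intro!: exI[of _ 0])
    thus ?thesis by simp
  qed
  have leL: "k \<le> L p" if "prime p" "p ^ k \<le> n" for p k
    unfolding L_def using fin[OF that(1)] that by (intro Max_ge) auto
  define M where "M = (\<Prod>p\<in>S. p ^ L p)"
  have M0: "M > 0" unfolding M_def by (intro prod_pos) (auto simp: S_def prime_gt_0_nat)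
  have "k dvd M" if k: "1 \<le> k" "k \<le> n" for k
  proof (rule multiplicity_le_imp_dvd)
    fix p :: nat assume p: "prime p"
    have "p ^ multiplicity p k \<le> k" using k by (intro dvd_imp_le multiplicity_dvd) auto
    hence le: "p ^ multiplicity p k \<le> n" using k by simp
    have "multiplicity p M = (if p \<in> S then L p else 0)"
      unfolding M_def using S p by (intro multiplicity_prod_prime_powers) (auto simp: S_def)
    moreover have "multiplicity p k = 0" if "p \<notin> S"
    proof -
      have "\<not> p dvd k" using that p k by (auto simp: S_def dest: dvd_imp_le)
      thus ?thesis by (rule not_dvd_imp_multiplicity_0)
    qed
    ultimately show "multiplicity p k \<le> multiplicity p M" using leL[OF p le] by auto
  qed (use k in auto)
  hence "2 ^ (n - 1) \<le> real M" using n M0 by (intro two_power_le_common_multiple) auto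
  also have "M \<le> (\<Prod>p\<in>S. n)" unfolding M_def using pL by (intro prod_mono) (auto simp: S_def)
  hence "real M \<le> real n ^ card S" by (metis of_nat_le_iff of_nat_power prod_constant)
  finally have "ln (2 ^ (n - 1)) \<le> ln (real n ^ card S)" using n by (intro ln_mono) auto
  thus ?thesis using n by (simp add: ln_realpow S_def)
qed

section \<open>Averages over primes and over composite moduli\<close>

text \<open>Markov's inequality, taken at the square root of the average so that one parameter bounds both the exceptional
  proportion and the values outside it.\<close>

lemma proportion_ge_of_average:
  assumes fin: "finite A" and nonneg: "\<And>q. q \<in> A \<Longrightarrow> f q \<ge> 0" and "\<eta> \<ge> 0"
    and avg: "(\<Sum>q\<in>A. f q) / real (card A) \<le> \<eta>\<^sup>2"
  shows "proportion_ge \<eta> A (\<lambda>q. f q \<le> \<eta>)"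
proof (cases "A = {}")
  case False
  define G where "G = {q \<in> A. f q \<le> \<eta>}"
  define Bd where "Bd = A - G"
  have fins: "finite G" "finite Bd" using fin by (auto simp: G_def Bd_def)
  have "card G + card Bd = card A" unfolding Bd_def G_def using fin
    by (metis (no_types, lifting) card_Diff_subset card_mono finite_subset le_add_diff_inverse mem_Collect_eq subsetI)
  hence card: "real (card A) = real (card G) + real (card Bd)" by linarith
  have sum_le: "(\<Sum>q\<in>A. f q) \<le> \<eta>\<^sup>2 * real (card A)"
    using avg False fin by (simp add: divide_le_eq card_gt_0_iff)
  have "real (card Bd) \<le> \<eta> * real (card A)"
  proof (cases "\<eta> = 0")
    case True
    hence "(\<Sum>q\<in>A. f q) = 0" using sum_le nonneg by (intro antisym sum_nonneg) auto
    hence "\<forall>q\<in>A. f q = 0" using sum_nonneg_eq_0_iff[of A f] fin nonneg by auto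
    hence "Bd = {}" using True by (auto simp: Bd_def G_def)
    thus ?thesis using True by simp
  next
    case False
    have "(\<Sum>q\<in>Bd. \<eta>) \<le> (\<Sum>q\<in>Bd. f q)" by (intro sum_mono) (auto simp: Bd_def G_def)
    hence "real (card Bd) * \<eta> \<le> (\<Sum>q\<in>Bd. f q)" by simp
    also have "\<dots> \<le> (\<Sum>q\<in>A. f q)" using fin nonneg by (intro sum_mono2) (auto simp: Bd_def)
    also have "\<dots> \<le> \<eta>\<^sup>2 * real (card A)" by (rule sum_le)
    finally show ?thesis using False assms(3) by (simp add: power2_eq_square)
  qed
  thus ?thesis using card by (simp add: proportion_ge_def G_def algebra_simps)
qed (simp add: proportion_ge_def)

text \<open>Partial summation. The exponent \<open>1 - c\<close> makes the resulting series converge, so the tail is small uniformly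
  in \<open>N\<close>.\<close>

lemma sum_weighted_tail_le:
  fixes g :: "nat \<Rightarrow> real"
  assumes g: "\<And>d. g d \<ge> 0" and M: "M \<ge> 1"
    and bound: "\<And>k. M \<le> k \<Longrightarrow> k \<le> N \<Longrightarrow> (\<Sum>d\<in>{2..k}. g d) \<le> C * real k powr (1 - c)" and "M \<le> N"
  shows "(\<Sum>d\<in>{M<..N}. g d / real d) \<le> C * real N powr (- c) + C * (\<Sum>k\<in>{M..<N}. real k powr (- 1 - c))"
proof -
  define s where "s = (\<lambda>k. \<Sum>d\<in>{2..k}. g d)"
  have s0: "s k \<ge> 0" for k using g by (auto simp: s_def intro: sum_nonneg)
  have abel: "(\<Sum>d\<in>{M<..n}. g d / real d) \<le> s n / real n + (\<Sum>k\<in>{M..<n}. s k / (real k)\<^sup>2)" if "M \<le> n" for n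
    using that
  proof (induction n rule: dec_induct)
    case base
    show ?case using s0 by simp
  next
    case (step n)
    have n: "real n > 0" using step M by simp
    have "s (Suc n) = s n + g (Suc n)" using n by (simp add: s_def)
    hence "g (Suc n) / real (Suc n) = s (Suc n) / real (Suc n) - s n / real (Suc n)"
      by (simp add: add_divide_distrib)
    moreover have "s n / real n - s n / real (Suc n) \<le> s n / (real n)\<^sup>2"
    proof -
      have "s n / real n - s n / real (Suc n) = s n * (1 / (real n * real (Suc n)))"
        using n by (simp add: field_simps)
      also have "\<dots> \<le> s n * (1 / (real n * real n))"
        using n s0 by (intro mult_left_mono divide_left_mono) auto
      finally show ?thesis by (simp add: power2_eq_square)
    qed
    moreover have "(\<Sum>d\<in>{M<..Suc n}. g d / real d) = (\<Sum>d\<in>{M<..n}. g d / real d) + g (Suc n) / real (Suc n)"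
      using step by (simp add: atLeastSucAtMost_greaterThanAtMost[symmetric])
    moreover have "(\<Sum>k\<in>{M..<Suc n}. s k / (real k)\<^sup>2) = (\<Sum>k\<in>{M..<n}. s k / (real k)\<^sup>2) + s n / (real n)\<^sup>2"
      using step by simp
    ultimately show ?case using step.IH by linarith
  qed
  have *: "s k \<le> C * real k powr (1 - c)" if "M \<le> k" "k \<le> N" for k
    unfolding s_def using bound that by auto
  have "s N / real N \<le> C * real N powr (1 - c) / real N" using *[of N] assms by (intro divide_right_mono) auto
  also have "\<dots> = C * real N powr (- c)" using M assms(4) by (simp add: powr_diff powr_minus field_simps)
  finally have 1: "s N / real N \<le> C * real N powr (- c)" .
  have "(\<Sum>k\<in>{M..<N}. s k / (real k)\<^sup>2) \<le> (\<Sum>k\<in>{M..<N}. C * real k powr (- 1 - c))"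
  proof (intro sum_mono)
    fix k assume k: "k \<in> {M..<N}"
    have "s k / (real k)\<^sup>2 \<le> C * real k powr (1 - c) / (real k)\<^sup>2" using k * by (intro divide_right_mono) auto
    also have "\<dots> = C * real k powr (- 1 - c)"
    proof -
      have "real k powr (1 - c) = real k powr 2 * real k powr (- 1 - c)" by (subst powr_add[symmetric]) simp
      thus ?thesis using k M by (simp add: powr_numeral)
    qed
    finally show "s k / (real k)\<^sup>2 \<le> C * real k powr (- 1 - c)" .
  qed
  with 1 abel[OF assms(4)] show ?thesis by (simp add: sum_distrib_left)
qed

text \<open>The numbers \<open>(a + 1)(ja + 1)\<close> are composite and congruent to 1 modulo \<open>a\<close>; they already form a positive
  proportion of all integers.\<close>

lemma card_composite_coprime_ge:
  fixes a :: int
  assumes "a > 1"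
  shows "card {q. composite q \<and> coprime (int q) a \<and> q \<le> N} \<ge> N div (nat a + 1)\<^sup>2"
proof -
  define b where "b = nat a"
  have b: "b > 1" "int b = a" using assms by (auto simp: b_def)
  define f where "f = (\<lambda>j. (b + 1) * (j * b + 1))"
  let ?J = "{1..N div (b + 1)\<^sup>2}" and ?C = "{q. composite q \<and> coprime (int q) a \<and> q \<le> N}"
  have "inj_on f ?J"
  proof (rule inj_onI)
    fix x y assume "f x = f y"
    hence "x * b + 1 = y * b + 1" unfolding f_def by (subst (asm) nat_mult_eq_cancel1) auto
    thus "x = y" using b by simp
  qed
  moreover have "f ` ?J \<subseteq> ?C"
  proof (rule image_subsetI)
    fix j assume j: "j \<in> ?J"
    have "j * b + 1 \<le> j * (b + 1)" using j by simp
    hence "f j \<le> (b + 1) * (j * (b + 1))" unfolding f_def by (rule mult_le_mono2)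
    also have "\<dots> = j * (b + 1)\<^sup>2" by (simp add: power2_eq_square algebra_simps)
    also have "\<dots> \<le> N div (b + 1)\<^sup>2 * (b + 1)\<^sup>2" using j by (intro mult_le_mono1) auto
    also have "\<dots> \<le> N" by (rule div_times_less_eq_dividend)
    finally have "f j \<le> N" .
    moreover have "composite (f j)"
    proof -
      have "j * b > 0" using j b by simp
      hence "b + 1 \<noteq> 1" "j * b + 1 \<noteq> 1" using b by auto
      hence "\<not> prime (f j)" unfolding f_def using prime_product by blast
      moreover have "1 * 1 < f j" unfolding f_def using \<open>j * b > 0\<close> b by (intro mult_strict_mono) auto
      ultimately show ?thesis by (simp add: composite_def)
    qed
    moreover have "coprime (f j) b"
    proof -
      have cop: "coprime (i * b + 1) b" for i
        by (rule coprimeI) (metis dvd_add_right_iff dvd_mult)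
      have "coprime (b + 1) b" "coprime (j * b + 1) b" using cop[of 1] cop[of j] by simp_all
      thus ?thesis unfolding f_def by (simp only: coprime_mult_left_iff)
    qed
    hence "coprime (int (f j)) a" unfolding b(2)[symmetric] by simp
    ultimately show "f j \<in> ?C" by simp
  qed
  moreover have "finite ?C" by (rule finite_subset[of _ "{..N}"]) auto
  ultimately have "card ?J \<le> card ?C" by (rule card_inj_on_le)
  thus ?thesis by (simp add: b_def)
qed

text \<open>Exchange the sums: at most \<open>N/d\<close> of the integers \<open>q \<le> N\<close> are multiples of \<open>d\<close>.\<close>

lemma sum_divisor_sums_le:
  fixes g :: "nat \<Rightarrow> real"
  assumes g: "\<And>d. g d \<ge> 0" and A: "A \<subseteq> {1..N}"
    and P: "\<And>q d. q \<in> A \<Longrightarrow> d dvd q \<Longrightarrow> d > 1 \<Longrightarrow> P d"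
  shows "(\<Sum>q\<in>A. \<Sum>d | d dvd q \<and> d > 1. g d) \<le> real N * (\<Sum>d | d \<in> {2..N} \<and> P d. g d / real d)"
proof -
  let ?D = "{d \<in> {2..N}. P d}"
  have finA: "finite A" using A by (rule finite_subset) auto
  have "(\<Sum>q\<in>A. \<Sum>d | d dvd q \<and> d > 1. g d) \<le> (\<Sum>q\<in>A. \<Sum>d\<in>?D. if d dvd q then g d else 0)"
  proof (intro sum_mono)
    fix q assume q: "q \<in> A"
    have "{d. d dvd q \<and> d > 1} \<subseteq> {d \<in> ?D. d dvd q}"
    proof
      fix d assume d: "d \<in> {d. d dvd q \<and> d > 1}"
      have "q \<in> {1..N}" using A q by blast
      moreover from this have "d \<le> q" using d by (intro dvd_imp_le) auto
      moreover have "P d" using P[OF q, of d] d by simp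
      ultimately show "d \<in> {d \<in> ?D. d dvd q}" using d by simp
    qed
    hence "(\<Sum>d | d dvd q \<and> d > 1. g d) \<le> (\<Sum>d | d \<in> ?D \<and> d dvd q. g d)"
      using g by (intro sum_mono2) auto
    also have "\<dots> = (\<Sum>d\<in>?D. if d dvd q then g d else 0)"
      by (rule sum.inter_filter) simp
    finally show "(\<Sum>d | d dvd q \<and> d > 1. g d) \<le> (\<Sum>d\<in>?D. if d dvd q then g d else 0)" .
  qed
  also have "\<dots> = (\<Sum>d\<in>?D. \<Sum>q\<in>A. if d dvd q then g d else 0)" by (rule sum.swap)
  also have "\<dots> \<le> (\<Sum>d\<in>?D. real N * (g d / real d))"
  proof (intro sum_mono)
    fix d assume d: "d \<in> ?D"
    have "{q \<in> A. d dvd q} \<subseteq> (\<lambda>j. d * j) ` {1..N div d}"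
    proof
      fix q assume q: "q \<in> {q \<in> A. d dvd q}"
      then obtain j where j: "q = d * j" by auto
      have "1 \<le> q" "q \<le> N" using q A by auto
      moreover have "j \<le> N div d" using d \<open>q \<le> N\<close> j by (simp add: less_eq_div_iff_mult_less_eq mult.commute)
      ultimately show "q \<in> (\<lambda>j. d * j) ` {1..N div d}" using j by (intro image_eqI[of _ _ j]) (auto intro!: Suc_leI gr0I)
    qed
    hence "card {q \<in> A. d dvd q} \<le> card ((\<lambda>j. d * j) ` {1..N div d})" by (intro card_mono) auto
    also have "\<dots> \<le> N div d" using card_image_le[of "{1..N div d}" "\<lambda>j. d * j"] by simp
    finally have "real (card {q \<in> A. d dvd q}) \<le> real N / real d"
      using of_nat_div_le_of_nat[of N d, where ?'a = real] by linarith
    hence "real (card {q \<in> A. d dvd q}) * g d \<le> real N / real d * g d" using g by (intro mult_right_mono) auto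
    moreover have "(\<Sum>q\<in>A. if d dvd q then g d else 0) = real (card {q \<in> A. d dvd q}) * g d"
      using finA by (simp add: sum.inter_filter[symmetric])
    ultimately show "(\<Sum>q\<in>A. if d dvd q then g d else 0) \<le> real N * (g d / real d)" by simp
  qed
  finally show ?thesis by (simp add: sum_distrib_left)
qed

lemma filterlim_nat_floor_exp:
  fixes t :: real
  assumes "t > 0"
  shows "filterlim (\<lambda>n. nat \<lfloor>exp (t * real n)\<rfloor>) at_top sequentially"
proof -
  have lim: "filterlim (\<lambda>n. exp (t * real n)) at_top sequentially"
    using assms by (intro filterlim_compose[OF exp_at_top] filterlim_tendsto_pos_mult_at_top[OF tendsto_const]
        filterlim_real_sequentially)
  show ?thesis
    unfolding filterlim_at_top
  proof
    fix k :: nat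
    have "eventually (\<lambda>n. exp (t * real n) \<ge> real k) sequentially" using lim by (simp add: filterlim_at_top)
    thus "eventually (\<lambda>n. k \<le> nat \<lfloor>exp (t * real n)\<rfloor>) sequentially"
      by eventually_elim (rule le_nat_floor)
  qed
qed

lemma squeeze_0:
  fixes f g :: "nat \<Rightarrow> real"
  assumes "\<And>n. f n \<ge> 0" "eventually (\<lambda>n. f n \<le> g n) sequentially" "g \<longlonglongrightarrow> 0"
  shows "f \<longlonglongrightarrow> 0"
  using assms by (intro tendsto_sandwich[of "\<lambda>_. 0" f sequentially g 0]) auto

lemma unif_dist_nonneg: "unif_dist a \<mu> n q \<ge> 0"
  unfolding unif_dist_def l1_norm_mod_def by (intro sum_nonneg) auto

context affine_walk
begin

text \<open>A prime modulus has only one divisor greater than 1, so the sum over primes is part of the sum bounded by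
  \<open>sum_law_prim_norm_le\<close>. Its saving \<open>N\<^sup>-\<^sup>c\<close> outweighs the logarithm in the prime count.\<close>

lemma prime_average_tendsto_0:
  assumes \<delta>: "0 < \<delta>" "\<delta> < 1" and H: "H > 1 / 2 * ln (real_of_int a)"
  defines "N \<equiv> \<lambda>n. nat \<lfloor>exp ((1 - \<delta>) * H * real n)\<rfloor>"
  shows "(\<lambda>n. (\<Sum>q | prime q \<and> q \<le> N n. unif_dist a \<mu> n q) / real (card {q. prime q \<and> q \<le> N n})) \<longlonglongrightarrow> 0"
proof -
  obtain c C where C: "0 < c" "c < 1" "C > 0"
    "\<And>n D. D \<ge> 1 \<Longrightarrow> real D \<le> exp ((1 - \<delta>) * H * real n) \<Longrightarrow>
       (\<Sum>d\<in>{2..D}. law_prim_norm n d) \<le> C * real D powr (1 - c)"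
    using sum_law_prim_norm_le[OF \<delta>(1) H] by blast
  have N_le: "real (N n) \<le> exp ((1 - \<delta>) * H * real n)" for n
    unfolding N_def by (simp add: of_nat_nat)
  have N_lim: "filterlim N at_top sequentially"
    unfolding N_def using \<delta> H_pos by (intro filterlim_nat_floor_exp) auto
  define K where "K = 4 * C / (c * ln 2)"
  have bound: "(\<Sum>q | prime q \<and> q \<le> N n. unif_dist a \<mu> n q) / real (card {q. prime q \<and> q \<le> N n})
      \<le> K * real (N n) powr (- (c / 2))" if N2: "N n \<ge> 2" for n
  proof -
    define P where "P = {q. prime q \<and> q \<le> N n}"
    have "(\<Sum>q\<in>P. unif_dist a \<mu> n q) \<le> (\<Sum>q\<in>P. law_prim_norm n q)"
    proof (intro sum_mono)
      fix q assume q: "q \<in> P"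
      hence "{d. d dvd q \<and> d > 1} = {q}"
        by (auto simp: P_def prime_nat_iff)
      thus "unif_dist a \<mu> n q \<le> law_prim_norm n q"
        using unif_dist_le_sum_law_prim_norm[of q n] q prime_gt_0_nat by (auto simp: P_def)
    qed
    also have "\<dots> \<le> (\<Sum>q\<in>{2..N n}. law_prim_norm n q)"
      by (intro sum_mono2) (auto simp: P_def law_prim_norm_nonneg prime_ge_2_nat)
    also have "\<dots> \<le> C * real (N n) powr (1 - c)" using N2 N_le by (intro C(4)) auto
    finally have num: "(\<Sum>q\<in>P. unif_dist a \<mu> n q) \<le> C * real (N n) powr (1 - c)" .
    have ln_le: "ln (real (N n)) \<le> real (N n) powr (c / 2) / (c / 2)"
      using N2 C by (intro ln_powr_bound) auto
    have lnpos: "ln (real (N n)) > 0" using N2 by simp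
    have "real (N n) / 2 * ln 2 \<le> real (N n - 1) * ln 2" using N2 by (intro mult_right_mono) auto
    also have "\<dots> \<le> real (card P) * ln (real (N n))" unfolding P_def by (rule prime_count_lower_bound[OF N2])
    also have "\<dots> \<le> real (card P) * (real (N n) powr (c / 2) / (c / 2))" using ln_le by (intro mult_left_mono) auto
    finally have den: "real (card P) \<ge> c * ln 2 / 4 * (real (N n) / real (N n) powr (c / 2))"
      using N2 C by (simp add: field_simps)
    have pos: "c * ln 2 / 4 * (real (N n) / real (N n) powr (c / 2)) > 0" using N2 C by simp
    have "(\<Sum>q\<in>P. unif_dist a \<mu> n q) / real (card P)
        \<le> C * real (N n) powr (1 - c) / (c * ln 2 / 4 * (real (N n) / real (N n) powr (c / 2)))"
      using num den pos C by (intro frac_le) auto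
    also have "\<dots> = K * (real (N n) powr (1 - c) * real (N n) powr (c / 2) / real (N n))"
      using N2 C by (simp add: K_def field_simps)
    also have "real (N n) powr (1 - c) * real (N n) powr (c / 2) / real (N n) = real (N n) powr ((1 - c) + c / 2 - 1)"
      using N2 by (simp only: powr_diff powr_add powr_one)
    also have "(1 - c) + c / 2 - 1 = - (c / 2)" by simp
    finally show ?thesis by (simp add: P_def)
  qed
  have "(\<lambda>n. K * real (N n) powr (- (c / 2))) \<longlonglongrightarrow> K * 0"
    using C by (intro tendsto_intros tendsto_neg_powr filterlim_compose[OF filterlim_real_sequentially N_lim]) auto
  moreover have ev: "eventually (\<lambda>n. N n \<ge> 2) sequentially" using N_lim by (simp add: filterlim_at_top)
  ultimately show ?thesis
    by (intro squeeze_0[OF _ eventually_mono[OF ev bound]])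
       (auto intro!: divide_nonneg_nonneg sum_nonneg unif_dist_nonneg)
qed

text \<open>The average is bounded by a constant times \<open>W n\<close>, a weighted sum over the possible divisors. For \<open>d > M\<close> the
  weights make it small uniformly in \<open>n\<close>; the finitely many \<open>d \<le> M\<close> are all coprime to \<open>a\<close>, and each of their
  terms tends to 0.\<close>

lemma composite_average_tendsto_0:
  assumes \<delta>: "0 < \<delta>" "\<delta> < 1" and H: "H > 1 / 2 * ln (real_of_int a)"
  defines "N \<equiv> \<lambda>n. nat \<lfloor>exp ((1 - \<delta>) * H * real n)\<rfloor>"
  shows "(\<lambda>n. (\<Sum>q | composite q \<and> coprime (int q) a \<and> q \<le> N n. unif_dist a \<mu> n q)
             / real (card {q. composite q \<and> coprime (int q) a \<and> q \<le> N n})) \<longlonglongrightarrow> 0"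
proof -
  obtain c C where C: "0 < c" "c < 1" "C > 0"
    "\<And>n D. D \<ge> 1 \<Longrightarrow> real D \<le> exp ((1 - \<delta>) * H * real n) \<Longrightarrow>
       (\<Sum>d\<in>{2..D}. law_prim_norm n d) \<le> C * real D powr (1 - c)"
    using sum_law_prim_norm_le[OF \<delta>(1) H] by blast
  have N_le: "real (N n) \<le> exp ((1 - \<delta>) * H * real n)" for n
    unfolding N_def by (simp add: of_nat_nat)
  have N_lim: "filterlim N at_top sequentially"
    unfolding N_def using \<delta> H_pos by (intro filterlim_nat_floor_exp) auto
  define W where "W = (\<lambda>n. \<Sum>d | d \<in> {2..N n} \<and> coprime (int d) a. law_prim_norm n d / real d)"
  have W0: "W n \<ge> 0" for n unfolding W_def by (intro sum_nonneg divide_nonneg_nonneg law_prim_norm_nonneg) auto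
  define b where "b = (nat a + 1)\<^sup>2"
  have b: "b > 0" by (simp add: b_def)
  have W_lim: "W \<longlonglongrightarrow> 0"
  proof (rule tendstoI)
    fix \<eta> :: real assume \<eta>: "\<eta> > 0"
    have "summable (\<lambda>k. real k powr (- 1 - c))" using C by (simp add: summable_real_powr_iff)
    then obtain M1 where M1: "\<And>m n. m \<ge> M1 \<Longrightarrow> norm (\<Sum>k\<in>{m..<n}. real k powr (- 1 - c)) < \<eta> / (4 * C)"
      unfolding summable_Cauchy using \<eta> C by (meson divide_pos_pos mult_pos_pos zero_less_numeral)
    have "(\<lambda>k. C * real k powr (- c)) \<longlonglongrightarrow> C * 0"
      using C by (intro tendsto_intros tendsto_neg_powr filterlim_real_sequentially) auto
    hence "eventually (\<lambda>k. C * real k powr (- c) < \<eta> / 4) sequentially" using \<eta> by (intro order_tendstoD) auto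
    then obtain M2 where M2: "\<And>k. k \<ge> M2 \<Longrightarrow> C * real k powr (- c) < \<eta> / 4" by (auto simp: eventually_sequentially)
    define M where "M = max 1 (max M1 M2)"
    have M: "M \<ge> 1" "M \<ge> M1" "M \<ge> M2" by (auto simp: M_def)
    have tail: "(\<Sum>d\<in>{M<..N n}. law_prim_norm n d / real d) \<le> \<eta> / 2" for n
    proof (cases "M \<le> N n")
      case True
      have "(\<Sum>d\<in>{M<..N n}. law_prim_norm n d / real d) \<le> C * real (N n) powr (- c) + C * (\<Sum>k\<in>{M..<N n}. real k powr (- 1 - c))"
      proof (rule sum_weighted_tail_le[OF law_prim_norm_nonneg M(1) _ True])
        fix k assume k: "M \<le> k" "k \<le> N n"
        hence "real k \<le> real (N n)" by simp
        also note N_le[of n]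
        finally show "(\<Sum>d\<in>{2..k}. law_prim_norm n d) \<le> C * real k powr (1 - c)" using k M by (intro C(4)) auto
      qed
      moreover have "C * real (N n) powr (- c) < \<eta> / 4" using True M by (intro M2) auto
      moreover have "C * (\<Sum>k\<in>{M..<N n}. real k powr (- 1 - c)) \<le> C * (\<eta> / (4 * C))"
        using M1[OF M(2), of "N n"] C by (intro mult_left_mono) auto
      moreover have "C * (\<eta> / (4 * C)) = \<eta> / 4" using C by simp
      ultimately show ?thesis by linarith
    qed (use \<eta> in auto)
    have "(\<lambda>n. \<Sum>d | d \<in> {2..M} \<and> coprime (int d) a. law_prim_norm n d / real d) \<longlonglongrightarrow> (\<Sum>d | d \<in> {2..M} \<and> coprime (int d) a. 0 / real d)"
      by (intro tendsto_sum tendsto_divide law_prim_norm_tendsto_0 tendsto_const) auto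
    hence "eventually (\<lambda>n. (\<Sum>d | d \<in> {2..M} \<and> coprime (int d) a. law_prim_norm n d / real d) < \<eta> / 2) sequentially"
      using \<eta> by (intro order_tendstoD) auto
    thus "eventually (\<lambda>n. dist (W n) 0 < \<eta>) sequentially"
    proof eventually_elim
      case (elim n)
      have "W n \<le> (\<Sum>d\<in>{d \<in> {2..M}. coprime (int d) a} \<union> {M<..N n}. law_prim_norm n d / real d)"
        unfolding W_def by (intro sum_mono2) (auto intro!: divide_nonneg_nonneg law_prim_norm_nonneg)
      also have "\<dots> = (\<Sum>d | d \<in> {2..M} \<and> coprime (int d) a. law_prim_norm n d / real d) + (\<Sum>d\<in>{M<..N n}. law_prim_norm n d / real d)"
        by (intro sum.union_disjoint) auto
      also have "\<dots> < \<eta> / 2 + \<eta> / 2" using elim tail[of n] by (intro add_less_le_mono)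
      finally show ?case using W0[of n] by simp
    qed
  qed
  have bound: "(\<Sum>q | composite q \<and> coprime (int q) a \<and> q \<le> N n. unif_dist a \<mu> n q)
             / real (card {q. composite q \<and> coprime (int q) a \<and> q \<le> N n}) \<le> 2 * real b * W n"
    if Nb: "N n \<ge> b" for n
  proof -
    define Q where "Q = {q. composite q \<and> coprime (int q) a \<and> q \<le> N n}"
    have "(\<Sum>q\<in>Q. unif_dist a \<mu> n q) \<le> (\<Sum>q\<in>Q. \<Sum>d | d dvd q \<and> d > 1. law_prim_norm n d)"
      by (intro sum_mono unif_dist_le_sum_law_prim_norm) (auto simp: Q_def composite_def)
    also have "\<dots> \<le> real (N n) * W n"
      unfolding W_def
    proof (rule sum_divisor_sums_le[OF law_prim_norm_nonneg])
      show "Q \<subseteq> {1..N n}" by (auto simp: Q_def composite_def)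
      show "coprime (int d) a" if "q \<in> Q" "d dvd q" for q d
        using that by (auto simp: Q_def elim!: dvdE)
    qed
    finally have num: "(\<Sum>q\<in>Q. unif_dist a \<mu> n q) \<le> real (N n) * W n" .
    have "N n < b * (N n div b + 1)" using b by (metis add.commute dividend_less_div_times mult.commute mult_Suc_right plus_1_eq_Suc)
    moreover have "N n div b \<ge> 1" using Nb b by (simp add: Suc_le_eq div_greater_zero_iff)
    hence "b * (N n div b + 1) \<le> b * (2 * (N n div b))" by (intro mult_le_mono2) auto
    ultimately have "N n \<le> b * (2 * (N n div b))" by linarith
    hence "N n \<le> 2 * b * (N n div b)" by (simp only: mult_ac)
    also have "\<dots> \<le> 2 * b * card Q" unfolding Q_def b_def by (intro mult_le_mono2 card_composite_coprime_ge a_gt_1)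
    finally have "real (N n) \<le> 2 * real b * real (card Q)" by (metis of_nat_le_iff of_nat_mult of_nat_numeral)
    hence den: "real (card Q) \<ge> real (N n) / (2 * real b)" using b by (simp add: field_simps)
    have Npos: "real (N n) > 0" using Nb b by simp
    have "(\<Sum>q\<in>Q. unif_dist a \<mu> n q) / real (card Q) \<le> real (N n) * W n / (real (N n) / (2 * real b))"
      using num den Npos b W0[of n] by (intro frac_le) auto
    also have "\<dots> = 2 * real b * W n" using Npos b by (simp add: field_simps)
    finally show ?thesis by (simp add: Q_def)
  qed
  have "(\<lambda>n. 2 * real b * W n) \<longlonglongrightarrow> 2 * real b * 0" by (intro tendsto_intros W_lim)
  moreover have ev: "eventually (\<lambda>n. N n \<ge> b) sequentially" using N_lim by (simp add: filterlim_at_top)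
  ultimately show ?thesis
    by (intro squeeze_0[OF _ eventually_mono[OF ev bound]])
       (auto intro!: divide_nonneg_nonneg sum_nonneg unif_dist_nonneg)
qed

end

section \<open>Mixing for almost all moduli\<close>

lemma ln_le_iff_le_floor_exp:
  assumes "q > 0"
  shows "ln (real q) \<le> t \<longleftrightarrow> q \<le> nat \<lfloor>exp t\<rfloor>"
proof -
  have "ln (real q) \<le> t \<longleftrightarrow> real q \<le> exp t" using assms by (metis exp_le_cancel_iff exp_ln of_nat_0_less_iff)
  also have "\<dots> \<longleftrightarrow> q \<le> nat \<lfloor>exp t\<rfloor>" by (simp add: le_nat_iff le_floor_iff)
  finally show ?thesis .
qed

context affine_walk
begin

text \<open>The sequence \<open>\<eta>\<close> is built from the square roots of the two averages. For \<open>\<delta> \<ge> 1\<close> both sets of moduli are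
  empty.\<close>

lemma many_steps_nearly_uniform:
  assumes \<delta>: "\<delta> > 0" and H: "H > 1 / 2 * ln (real_of_int a)"
  shows "\<exists>\<eta> :: nat \<Rightarrow> real. \<eta> \<longlonglongrightarrow> 0 \<and>
              (\<forall>\<^sub>F n in sequentially.
                 proportion_ge (\<eta> n)
                   {q. prime q \<and> ln (real q) \<le> (1 - \<delta>) * H * real n}
                   (\<lambda>q. unif_dist a \<mu> n q \<le> \<eta> n) \<and>
                 proportion_ge (\<eta> n)
                   {q. composite q \<and> coprime (int q) a \<and>
                       ln (real q) \<le> (1 - \<delta>) * H * real n}
                   (\<lambda>q. unif_dist a \<mu> n q \<le> \<eta> n))"
proof -
  define N where "N = (\<lambda>n::nat. nat \<lfloor>exp ((1 - \<delta>) * H * real n)\<rfloor>)"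
  define P where "P = (\<lambda>n. {q::nat. prime q \<and> q \<le> N n})"
  define Q where "Q = (\<lambda>n. {q. composite q \<and> coprime (int q) a \<and> q \<le> N n})"
  have P_eq: "{q. prime q \<and> ln (real q) \<le> (1 - \<delta>) * H * real n} = P n" for n
    unfolding P_def N_def using ln_le_iff_le_floor_exp prime_gt_0_nat by blast
  have Q_eq: "{q. composite q \<and> coprime (int q) a \<and> ln (real q) \<le> (1 - \<delta>) * H * real n} = Q n" for n
  proof -
    have "q > 0" if "composite q" for q using that by (simp add: composite_def)
    thus ?thesis unfolding Q_def N_def using ln_le_iff_le_floor_exp by blast
  qed
  have fin: "finite (P n)" "finite (Q n)" for n
    by (auto simp: P_def Q_def intro: finite_subset[of _ "{..N n}"])
  define avg where "avg = (\<lambda>A n. (\<Sum>q\<in>A n. unif_dist a \<mu> n q) / real (card (A n)))"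
  have avg0: "avg A n \<ge> 0" for A n
    unfolding avg_def by (intro divide_nonneg_nonneg sum_nonneg unif_dist_nonneg) auto
  have "avg P \<longlonglongrightarrow> 0 \<and> avg Q \<longlonglongrightarrow> 0"
  proof (cases "\<delta> < 1")
    case True
    show ?thesis
      using prime_average_tendsto_0[OF \<delta> True H] composite_average_tendsto_0[OF \<delta> True H]
      by (simp add: avg_def[abs_def] P_def Q_def N_def)
  next
    case False
    have "N n \<le> 1" for n
    proof -
      have "(1 - \<delta>) * H * real n \<le> 0" using False H_pos by (intro mult_nonpos_nonneg) auto
      hence "exp ((1 - \<delta>) * H * real n) \<le> 1" by simp
      thus ?thesis unfolding N_def by linarith
    qed
    hence "P n = {}" "Q n = {}" for n
      unfolding P_def Q_def composite_def using prime_gt_1_nat order_trans not_less by blast+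
    thus ?thesis by (simp add: avg_def)
  qed
  hence lim: "avg P \<longlonglongrightarrow> 0" "avg Q \<longlonglongrightarrow> 0" by auto
  define \<eta> where "\<eta> = (\<lambda>n. sqrt (avg P n) + sqrt (avg Q n))"
  have sq: "avg P n \<le> (\<eta> n)\<^sup>2" "avg Q n \<le> (\<eta> n)\<^sup>2" "\<eta> n \<ge> 0" for n
    using avg0[of P n] avg0[of Q n] by (auto simp: \<eta>_def power2_sum)
  have "\<eta> \<longlonglongrightarrow> sqrt 0 + sqrt 0" unfolding \<eta>_def by (intro tendsto_intros lim)
  hence "\<eta> \<longlonglongrightarrow> 0" by simp
  moreover have "proportion_ge (\<eta> n) (P n) (\<lambda>q. unif_dist a \<mu> n q \<le> \<eta> n)"
    "proportion_ge (\<eta> n) (Q n) (\<lambda>q. unif_dist a \<mu> n q \<le> \<eta> n)" for n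
    using sq(1,2)[of n] by (auto intro!: proportion_ge_of_average fin unif_dist_nonneg sq(3) simp: avg_def)
  ultimately show ?thesis unfolding P_eq Q_eq by (intro exI[of _ \<eta>]) auto
qed

end

theorem theorem1p1:
  fixes a :: int and \<mu> :: "int pmf" and \<delta> :: real
  assumes "a > 1"
    and "finite (set_pmf \<mu>)"
    and "Gcd {x - y | x y. x \<in> set_pmf \<mu> \<and> y \<in> set_pmf \<mu>} = 1"
    and "\<delta> > 0"
  shows "(\<forall>\<eta>>0. \<exists>q1::nat. \<forall>q\<ge>q1. \<forall>n::nat.
            asymp_entropy a \<mu> * real n \<le> (1 - \<delta>) * ln (real q) \<longrightarrow>
              1 / 2 * unif_dist a \<mu> n q \<ge> 1 - \<eta>)
       \<and> (asymp_entropy a \<mu> > 1 / 2 * ln (real_of_int a) \<longrightarrow>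
            (\<exists>\<eta> :: nat \<Rightarrow> real. \<eta> \<longlonglongrightarrow> 0 \<and>
              (\<forall>\<^sub>F n in sequentially.
                 proportion_ge (\<eta> n)
                   {q. prime q \<and> ln (real q) \<le> (1 - \<delta>) * asymp_entropy a \<mu> * real n}
                   (\<lambda>q. unif_dist a \<mu> n q \<le> \<eta> n) \<and>
                 proportion_ge (\<eta> n)
                   {q. composite q \<and> coprime (int q) a \<and>
                       ln (real q) \<le> (1 - \<delta>) * asymp_entropy a \<mu> * real n}
                   (\<lambda>q. unif_dist a \<mu> n q \<le> \<eta> n))))"
proof -
  interpret affine_walk a \<mu> using assms(1-3) by unfold_locales
  show ?thesis
    using few_steps_far_from_uniform[OF assms(4)] many_steps_nearly_uniform[OF assms(4)] by blast
qed

end
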